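(* Let $a>0$, $b$, $c$ be smooth functions of $x$ on an interval. The equation $u_t=a(x)u_{xx}+b(x)u_x+c(x)u$ can be mapped to the heat equation $\tilde u_{\tilde t}=\tilde u_{\tilde x\tilde x}$ by an invertible point transformation if and only if $K=c_2I^2+c_1I+c_0$ for some constants $c_0,c_1,c_2$. Moreover, in that case, for any function $T(t)$ with $\dot T>0$ satisfying $\{T,t\}=8c_2$, any solution $\omega(t)$ of $\ddot\omega+4c_2\omega=2c_1$, and any constant $C\neq0$, the transformation $$\tilde t=T(t),\quad \tilde x=\sqrt{\dot T}\,(I(x)+\omega(t)),$$ $$u=C(\dot T a)^{1/4}\exp\!\Big[-\!\int\frac{b}{2a}dx+\frac{\ddot T}{8\dot T}(I+\omega)^2+\frac{\dot\omega I}{2}-\int\big(c_2\omega^2-\tfrac14\dot\omega^2-c_0\big)dt\Big]\tilde u(\tilde x,\tilde t)$$ maps solutions $\tilde u$ of the heat equation to solutions $u$ of the given equation (and conversely).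
   Context: $I(x)=\int^x a(s)^{-1/2}ds$, $J=\frac{d}{dx}\sqrt a-\frac{b}{\sqrt a}$, $K=\tfrac12\sqrt a\,J'-\tfrac14J^2+c$. $\{T,t\}=\dddot T/\dot T-\tfrac32(\ddot T/\dot T)^2$ is the Schwarzian derivative; dots denote $d/dt$. $\int\frac{b}{2a}dx$ denotes a fixed antiderivative in $x$, and $\int(\cdot)dt$ a fixed antiderivative in $t$. *)

theory Defs
  imports "HOL-Analysis.Analysis"
begin

definition dir_deriv :: "'a::real_normed_vector \<Rightarrow> ('a \<Rightarrow> real) \<Rightarrow> 'a \<Rightarrow> real" where
  "dir_deriv v f x = deriv (\<lambda>h. f (x + h *\<^sub>R v)) 0"

definition smooth_on :: "'a::euclidean_space set \<Rightarrow> ('a \<Rightarrow> 'b::euclidean_space) \<Rightarrow> bool" where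
  "smooth_on U f \<longleftrightarrow>
     (\<forall>b\<in>Basis. \<forall>vs. set vs \<subseteq> Basis \<longrightarrow>
        continuous_on U (foldr dir_deriv vs (\<lambda>x. f x \<bullet> b)) \<and>
        (\<forall>v\<in>Basis. \<forall>x\<in>U.
           (\<lambda>h. foldr dir_deriv vs (\<lambda>y. f y \<bullet> b) (x + h *\<^sub>R v)) differentiable (at 0)))"

definition pt :: "(real \<Rightarrow> real \<Rightarrow> real) \<Rightarrow> real \<Rightarrow> real \<Rightarrow> real" where
  "pt u t x = deriv (\<lambda>s. u s x) t"
definition px :: "(real \<Rightarrow> real \<Rightarrow> real) \<Rightarrow> real \<Rightarrow> real \<Rightarrow> real" where
  "px u t x = deriv (\<lambda>y. u t y) x"
definition pxx :: "(real \<Rightarrow> real \<Rightarrow> real) \<Rightarrow> real \<Rightarrow> real \<Rightarrow> real" where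
  "pxx u t x = deriv (\<lambda>y. px u t y) x"

definition lsol :: "(real \<Rightarrow> real) \<Rightarrow> (real \<Rightarrow> real) \<Rightarrow> (real \<Rightarrow> real) \<Rightarrow> real set
    \<Rightarrow> (real \<times> real) set \<Rightarrow> (real \<Rightarrow> real \<Rightarrow> real) \<Rightarrow> bool" where
  "lsol a b c S Om u \<longleftrightarrow> open Om \<and> Om \<subseteq> UNIV \<times> S \<and>
     smooth_on Om (\<lambda>p. u (fst p) (snd p)) \<and>
     (\<forall>(t,x)\<in>Om. pt u t x = a x * pxx u t x + b x * px u t x + c x * u t x)"

definition heatsol :: "(real \<times> real) set \<Rightarrow> (real \<Rightarrow> real \<Rightarrow> real) \<Rightarrow> bool" where
  "heatsol = lsol (\<lambda>_. 1) (\<lambda>_. 0) (\<lambda>_. 0) UNIV"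

definition graph :: "(real \<Rightarrow> real \<Rightarrow> real) \<Rightarrow> (real \<times> real) set \<Rightarrow> (real \<times> real \<times> real) set" where
  "graph u Om = {(t, x, u t x) | t x. (t, x) \<in> Om}"

definition maps_solutions ::
  "((real \<times> real) set \<Rightarrow> (real \<Rightarrow> real \<Rightarrow> real) \<Rightarrow> bool) \<Rightarrow>
   ((real \<times> real) set \<Rightarrow> (real \<Rightarrow> real \<Rightarrow> real) \<Rightarrow> bool) \<Rightarrow>
   (real \<times> real \<times> real \<Rightarrow> real \<times> real \<times> real) \<Rightarrow> (real \<times> real \<times> real) set \<Rightarrow> bool" where
  "maps_solutions E1 E2 Phi D \<longleftrightarrow>
     (\<forall>Om u. E1 Om u \<and> graph u Om \<subseteq> D \<longrightarrow>
        (\<forall>Om' u'. open Om' \<and> smooth_on Om' (\<lambda>p. u' (fst p) (snd p)) \<and>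
                  graph u' Om' \<subseteq> Phi ` graph u Om \<longrightarrow> E2 Om' u'))"

definition point_transformation ::
  "(real \<times> real \<times> real) set \<Rightarrow> (real \<times> real \<times> real \<Rightarrow> real \<times> real \<times> real) \<Rightarrow> bool" where
  "point_transformation D Phi \<longleftrightarrow> open D \<and> D \<noteq> {} \<and> inj_on Phi D \<and> open (Phi ` D) \<and>
     smooth_on D Phi \<and> smooth_on (Phi ` D) (inv_into D Phi)"

definition maps_to_heat ::
  "(real \<Rightarrow> real) \<Rightarrow> (real \<Rightarrow> real) \<Rightarrow> (real \<Rightarrow> real) \<Rightarrow> real set \<Rightarrow> real set
   \<Rightarrow> (real \<times> real \<times> real \<Rightarrow> real \<times> real \<times> real) \<Rightarrow> bool" where
  "maps_to_heat a b c S Tint Phi \<longleftrightarrow>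
     (let D = Tint \<times> S \<times> UNIV in
        point_transformation D Phi \<and>
        maps_solutions (lsol a b c S) heatsol Phi D \<and>
        maps_solutions heatsol (lsol a b c S) (inv_into D Phi) (Phi ` D))"

definition Jf :: "(real \<Rightarrow> real) \<Rightarrow> (real \<Rightarrow> real) \<Rightarrow> real \<Rightarrow> real" where
  "Jf a b x = deriv (\<lambda>y. sqrt (a y)) x - b x / sqrt (a x)"

definition Kf :: "(real \<Rightarrow> real) \<Rightarrow> (real \<Rightarrow> real) \<Rightarrow> (real \<Rightarrow> real) \<Rightarrow> real \<Rightarrow> real" where
  "Kf a b c x = 1/2 * sqrt (a x) * deriv (Jf a b) x - 1/4 * (Jf a b x)^2 + c x"

definition schwarzian :: "(real \<Rightarrow> real) \<Rightarrow> real \<Rightarrow> real" where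
  "schwarzian T t = deriv (deriv (deriv T)) t / deriv T t
     - 3/2 * (deriv (deriv T) t / deriv T t)^2"

end

theory Submission
  imports Defs
begin

text \<open>
  A change of variables $\tilde t = T(t)$, $\tilde x = X(t, x)$, $u = M(t, x)\, \tilde u$
  carries the heat equation to the given one if and only if $T_t = a X_x^2$, $M$ solves the
  given equation, and $M (X_t - a X_{xx} - b X_x) = 2 a M_x X_x$. Writing $X_x = \sigma(t) /
  \sqrt a$ and $X_t = \sigma \mu$, the last two conditions become $M_x / M = (J + \mu) / (2
  \sqrt a)$ and $M_t / M = K + \mu^2 / 4 + \sigma_t / (2 \sigma)$. Equality of mixed derivatives
  is $2 \, dK/dI = \mu_t - \mu \sigma_t / \sigma$. Since $d\mu/dI = \sigma_t / \sigma$ depends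
  on $t$ only, $dK/dI$ is affine in $I$. For quadratic $K$ the Schwarzian and oscillator
  equations solve these conditions.

  An arbitrary point transformation $(T, X, U)(t, x, u)$ to the heat equation and a solution $w$
  of the latter define a solution $u$ of the given equation implicitly by $U = w(T, X)$. Heat
  polynomials realise every jet $(w, w_y, w_s = w_{yy}, w_{ss})$ at a point. Comparing the
  coefficients of $w_{ss}$, $w_s$ and $w_y$ gives $T = T(t)$, $X = X(t, x)$, that $U$ is affine
  in $u$, and the conditions above with $M = 1 / U_u$.
\<close>

section \<open>Smooth functions\<close>

lemma isCont_rectangle:
  fixes \<phi> :: "'a::t2_space \<times> 'b::metric_space \<Rightarrow> 'c::topological_space"
  assumes "isCont \<phi> (x, y)" "open U" "\<phi> (x, y) \<in> U"
  obtains X e where "open X" "x \<in> X" "e > 0" "\<And>h s. h \<in> X \<Longrightarrow> s \<in> ball y e \<Longrightarrow> \<phi> (h, s) \<in> U"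
proof -
  have "\<forall>\<^sub>F k in nhds (x, y). \<phi> k \<in> U"
    using tendsto_at_iff_tendsto_nhds[of \<phi> "(x, y)"] assms
    by (simp add: isCont_def topological_tendstoD)
  then obtain W where W: "open W" "(x, y) \<in> W" "\<And>k. k \<in> W \<Longrightarrow> \<phi> k \<in> U"
    unfolding eventually_nhds by blast
  obtain X Y where X: "open X" "x \<in> X" and Y: "open Y" "y \<in> Y" and "X \<times> Y \<subseteq> W"
    using open_prod_elim[OF W(1,2)] by (metis mem_Sigma_iff)
  moreover obtain e where "e > 0" "ball y e \<subseteq> Y"
    using Y by (meson openE)
  ultimately show thesis
    using W(3) by (intro that[of X e]) (auto simp: subset_iff)
qed

lemma has_derivative_along_line_shift:
  fixes f :: "'a::real_normed_vector \<Rightarrow> real"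
  assumes "((\<lambda>k. f (z + s *\<^sub>R v + k *\<^sub>R v)) has_real_derivative d) (at 0)"
  shows "((\<lambda>s. f (z + s *\<^sub>R v)) has_derivative (d *\<^sub>R id_blinfun)) (at s within A)"
proof -
  have "((\<lambda>k. f (z + s *\<^sub>R v + k *\<^sub>R v)) has_real_derivative d) (at (s + - s))"
    using assms by simp
  from DERIV_shift[THEN iffD1, OF this]
  have "((\<lambda>s. f (z + s *\<^sub>R v)) has_real_derivative d) (at s)"
    by (simp add: algebra_simps)
  then show ?thesis
    unfolding has_field_derivative_def
    by (rule has_derivative_eq_rhs[OF has_derivative_at_withinI]) (auto simp: blinfun.scaleR_left)
qed

lemma has_derivative_add_direction:
  fixes f :: "'a::real_normed_vector \<Rightarrow> real" and p :: "'b::real_normed_vector \<Rightarrow> 'a" and l :: "'b \<Rightarrow> real"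
  assumes "open U" "x \<in> U"
    and deriv: "\<And>y. y \<in> U \<Longrightarrow> ((\<lambda>s. f (y + s *\<^sub>R v)) has_real_derivative d y) (at 0)"
    and cont: "isCont d x" "isCont p 0" "p 0 = 0"
    and f': "((\<lambda>h. f (x + p h)) has_derivative f') (at 0)"
    and l: "bounded_linear l"
  shows "((\<lambda>h. f (x + p h + l h *\<^sub>R v)) has_derivative (\<lambda>h. f' h + l h * d x)) (at 0)"
proof -
  define \<phi> where "\<phi> = (\<lambda>k. x + p (fst k) + snd k *\<^sub>R v)"
  have \<phi>: "isCont \<phi> (0, 0)" "\<phi> (0, 0) = x"
    unfolding \<phi>_def using cont isCont_o2[of "(0, 0)" fst p] by (auto intro!: continuous_intros)
  then obtain X e where X: "open X" "0 \<in> X" and e: "e > 0"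
    and in_U: "\<And>h s. h \<in> X \<Longrightarrow> s \<in> ball 0 e \<Longrightarrow> x + p h + s *\<^sub>R v \<in> U"
    using isCont_rectangle[OF \<phi>(1) assms(1)] assms(2) by (auto simp: \<phi>_def)
  have "((\<lambda>(h, s). f (x + p h + s *\<^sub>R v)) has_derivative
      (\<lambda>(h, s). f' h + (d (x + p 0 + 0 *\<^sub>R v) *\<^sub>R id_blinfun) s)) (at (0, 0) within X \<times> ball 0 e)"
  proof (rule has_derivative_partialsI)
    show "((\<lambda>h. f (x + p h + 0 *\<^sub>R v)) has_derivative f') (at 0 within X)"
      using f' by (simp add: has_derivative_at_withinI)
    have "isCont (\<lambda>k. d (\<phi> k) *\<^sub>R (id_blinfun :: real \<Rightarrow>\<^sub>L real)) (0, 0)"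
      using isCont_o2[OF \<phi>(1), of d] \<phi>(2) cont(1) by (intro continuous_intros) simp
    then show "continuous (at (0, 0) within X \<times> ball 0 e)
        (\<lambda>(h, s). d (x + p h + s *\<^sub>R v) *\<^sub>R (id_blinfun :: real \<Rightarrow>\<^sub>L real))"
      unfolding \<phi>_def split_beta by (rule continuous_at_imp_continuous_at_within)
    fix h and s :: real
    assume "h \<in> X" "s \<in> ball 0 e"
    then show "((\<lambda>s. f (x + p h + s *\<^sub>R v)) has_derivative (d (x + p h + s *\<^sub>R v) *\<^sub>R id_blinfun))
        (at s within ball 0 e)"
      by (intro has_derivative_along_line_shift deriv in_U)
  qed (use e in auto)
  then have "((\<lambda>(h, s). f (x + p h + s *\<^sub>R v)) has_derivative (\<lambda>(h, s). f' h + s * d x)) (at (0, 0))"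
    by (subst (asm) at_within_open)
       (use X e cont(3) in \<open>simp_all add: open_Times blinfun.scaleR_left mult.commute\<close>)
  moreover have "((\<lambda>h. (h, l h)) has_derivative (\<lambda>h. (h, l h))) (at 0)"
    using l by (intro bounded_linear_imp_has_derivative bounded_linear_Pair bounded_linear_ident)
  ultimately show ?thesis
    using has_derivative_compose[of "\<lambda>h. (h, l h)" "\<lambda>h. (h, l h)" 0 UNIV
        "\<lambda>(h, s). f (x + p h + s *\<^sub>R v)" "\<lambda>(h, s). f' h + s * d x"] linear_simps(3)[OF l] by simp
qed

lemma has_derivative_of_continuous_partials:
  fixes f :: "'a::euclidean_space \<Rightarrow> real"
  assumes U: "open U" "x \<in> U"
    and deriv: "\<And>y v. y \<in> U \<Longrightarrow> v \<in> Basis \<Longrightarrow> ((\<lambda>h. f (y + h *\<^sub>R v)) has_real_derivative d v y) (at 0)"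
    and cont: "\<And>v. v \<in> Basis \<Longrightarrow> continuous_on U (d v)"
  shows "(f has_derivative (\<lambda>h. \<Sum>v\<in>Basis. (h \<bullet> v) * d v x)) (at x)"
proof -
  have "((\<lambda>h. f (x + (\<Sum>v\<in>B. (h \<bullet> v) *\<^sub>R v))) has_derivative (\<lambda>h. \<Sum>v\<in>B. (h \<bullet> v) * d v x)) (at 0)"
    if "B \<subseteq> Basis" for B
    using finite_subset[OF that finite_Basis] that
  proof (induction B rule: finite_induct)
    case (insert v B)
    have "((\<lambda>h. f (x + (\<Sum>v\<in>B. (h \<bullet> v) *\<^sub>R v) + (h \<bullet> v) *\<^sub>R v))
        has_derivative (\<lambda>h. (\<Sum>v\<in>B. (h \<bullet> v) * d v x) + (h \<bullet> v) * d v x)) (at 0)"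
    proof (rule has_derivative_add_direction[OF U])
      show "isCont (d v) x"
        using cont[of v] U insert.prems by (simp add: continuous_on_eq_continuous_at)
    qed (use insert deriv in \<open>auto intro!: continuous_intros bounded_linear_inner_left\<close>)
    then show ?case
      using insert.hyps by (simp add: add.commute add.left_commute)
  qed simp
  from this[of Basis]
  have "((\<lambda>h. f (x + h)) has_derivative (\<lambda>h. \<Sum>v\<in>Basis. (h \<bullet> v) * d v x)) (at 0)"
    by (simp add: euclidean_representation)
  then show ?thesis
    by (simp add: has_derivative_at)
qed

primrec Ck_on :: "nat \<Rightarrow> 'a::euclidean_space set \<Rightarrow> ('a \<Rightarrow> 'b::real_normed_vector) \<Rightarrow> bool" where
  "Ck_on 0 U f \<longleftrightarrow> continuous_on U f"
| "Ck_on (Suc k) U f \<longleftrightarrow> (\<exists>f'. (\<forall>x\<in>U. (f has_derivative f' x) (at x)) \<and> (\<forall>v. Ck_on k U (\<lambda>x. f' x v)))"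

declare Ck_on.simps(2) [simp del]

lemma Ck_on_SucI:
  assumes "\<And>x. x \<in> U \<Longrightarrow> (f has_derivative f' x) (at x)" "\<And>v. Ck_on k U (\<lambda>x. f' x v)"
  shows "Ck_on (Suc k) U f"
  using assms by (auto simp: Ck_on.simps)

lemma Ck_on_SucE:
  assumes "Ck_on (Suc k) U f"
  obtains f' where "\<forall>x\<in>U. (f has_derivative f' x) (at x)" "\<forall>v. Ck_on k U (\<lambda>x. f' x v)"
  using assms by (auto simp: Ck_on.simps)

lemma Ck_on_cong:
  assumes "open U" "\<And>x. x \<in> U \<Longrightarrow> f x = g x" "Ck_on k U f"
  shows "Ck_on k U g"
proof (cases k)
  case 0
  then show ?thesis using assms(2,3) continuous_on_cong by force
next
  case (Suc n)
  obtain f' where "\<forall>x\<in>U. (f has_derivative f' x) (at x)" "\<forall>v. Ck_on n U (\<lambda>x. f' x v)"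
    by (rule Ck_on_SucE[OF assms(3)[unfolded Suc]])
  then show ?thesis
    unfolding Suc by (intro Ck_on_SucI) (auto intro: has_derivative_transform_within_open assms(1,2))
qed

lemma Ck_on_subset: "Ck_on k U f \<Longrightarrow> V \<subseteq> U \<Longrightarrow> Ck_on k V f"
proof (induction k arbitrary: f)
  case (Suc k)
  then show ?case by (elim Ck_on_SucE) (rule Ck_on_SucI, auto)
qed (auto intro: continuous_on_subset)

lemma Ck_on_SucD: "Ck_on (Suc k) U f \<Longrightarrow> Ck_on k U f"
proof (induction k arbitrary: f)
  case 0
  then show ?case
    by (auto elim!: Ck_on_SucE intro: has_derivative_continuous_on has_derivative_at_withinI)
next
  case (Suc k)
  then show ?case by (elim Ck_on_SucE[of "Suc k"]) (rule Ck_on_SucI, auto)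
qed

lemma Ck_on_const: "Ck_on k U (\<lambda>x. c)"
  by (induction k arbitrary: c) (auto intro!: Ck_on_SucI[where f' = "\<lambda>_ _. 0"])

lemma Ck_on_bounded_linear: "bounded_linear L \<Longrightarrow> Ck_on k U f \<Longrightarrow> Ck_on k U (\<lambda>x. L (f x))"
proof (induction k arbitrary: f)
  case (Suc k)
  from Suc.prems(2) show ?case
    by (elim Ck_on_SucE) (rule Ck_on_SucI, auto intro: bounded_linear.has_derivative Suc)
qed (auto intro: bounded_linear.continuous_on)

lemma Ck_on_add: "Ck_on k U f \<Longrightarrow> Ck_on k U g \<Longrightarrow> Ck_on k U (\<lambda>x. f x + g x)"
proof (induction k arbitrary: f g)
  case (Suc k)
  from Suc.prems show ?case
    by (elim Ck_on_SucE) (rule Ck_on_SucI, auto intro: has_derivative_add Suc.IH)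
qed (auto intro: continuous_intros)

lemma Ck_on_bounded_bilinear:
  assumes B: "bounded_bilinear B"
  shows "Ck_on k U f \<Longrightarrow> Ck_on k U g \<Longrightarrow> Ck_on k U (\<lambda>x. B (f x) (g x))"
proof (induction k arbitrary: f g)
  case 0
  then show ?case by (simp add: bounded_bilinear.continuous_on[OF B])
next
  case (Suc k)
  obtain f' where "\<forall>x\<in>U. (f has_derivative f' x) (at x)" "\<forall>v. Ck_on k U (\<lambda>x. f' x v)"
    by (rule Ck_on_SucE[OF Suc.prems(1)])
  moreover obtain g' where "\<forall>x\<in>U. (g has_derivative g' x) (at x)" "\<forall>v. Ck_on k U (\<lambda>x. g' x v)"
    by (rule Ck_on_SucE[OF Suc.prems(2)])
  ultimately show ?case
    using Ck_on_SucD[OF Suc.prems(1)] Ck_on_SucD[OF Suc.prems(2)]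
    by (intro Ck_on_SucI[where f' = "\<lambda>x v. B (f x) (g' x v) + B (f' x v) (g x)"])
       (auto intro!: bounded_bilinear.FDERIV[OF B] Ck_on_add Suc.IH)
qed

lemmas Ck_on_mult = Ck_on_bounded_bilinear[OF bounded_bilinear_mult]

lemma Ck_on_sum: "(\<And>i. i \<in> A \<Longrightarrow> Ck_on k U (f i)) \<Longrightarrow> Ck_on k U (\<lambda>x. \<Sum>i\<in>A. f i x)"
  by (induction A rule: infinite_finite_induct) (auto intro: Ck_on_const Ck_on_add)

lemma Ck_on_id: "Ck_on k U (\<lambda>x. x)"
  by (cases k) (auto intro!: Ck_on_SucI[where f' = "\<lambda>_ v. v"] Ck_on_const)

lemma Ck_on_componentwise:
  fixes f :: "'a::euclidean_space \<Rightarrow> 'b::euclidean_space"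
  shows "Ck_on k U f \<longleftrightarrow> (\<forall>b\<in>Basis. Ck_on k U (\<lambda>x. f x \<bullet> b))"
proof
  assume "\<forall>b\<in>Basis. Ck_on k U (\<lambda>x. f x \<bullet> b)"
  then have "Ck_on k U (\<lambda>x. \<Sum>b\<in>Basis. (f x \<bullet> b) *\<^sub>R b)"
    by (intro Ck_on_sum Ck_on_bounded_bilinear[OF bounded_bilinear_scaleR] Ck_on_const) auto
  then show "Ck_on k U f" by (simp add: euclidean_representation)
qed (auto intro: Ck_on_bounded_linear bounded_linear_inner_left)

lemma Ck_on_compose:
  fixes f :: "'a::euclidean_space \<Rightarrow> 'b::euclidean_space" and g :: "'b \<Rightarrow> 'c::real_normed_vector"
  assumes "Ck_on k V g" "Ck_on k U f" "f ` U \<subseteq> V"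
  shows "Ck_on k U (\<lambda>x. g (f x))"
  using assms(1,2)
proof (induction k arbitrary: g)
  case 0
  then show ?case using assms(3) by (auto intro: continuous_on_compose2)
next
  case (Suc k)
  obtain f' where f': "\<forall>x\<in>U. (f has_derivative f' x) (at x)" "\<forall>v. Ck_on k U (\<lambda>x. f' x v)"
    by (rule Ck_on_SucE[OF Suc.prems(2)])
  obtain g' where g': "\<forall>y\<in>V. (g has_derivative g' y) (at y)" "\<forall>v. Ck_on k V (\<lambda>y. g' y v)"
    by (rule Ck_on_SucE[OF Suc.prems(1)])
  have chain: "((\<lambda>x. g (f x)) has_derivative (\<lambda>v. \<Sum>b\<in>Basis. (f' x v \<bullet> b) *\<^sub>R g' (f x) b)) (at x)"
    if "x \<in> U" for x
  proof -
    have g'_fx: "(g has_derivative g' (f x)) (at (f x))"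
      using that assms(3) by (auto simp: g'(1))
    then have "linear (g' (f x))"
      by (rule has_derivative_linear)
    then have "g' (f x) (f' x v) = (\<Sum>b\<in>Basis. (f' x v \<bullet> b) *\<^sub>R g' (f x) b)" for v
      by (subst euclidean_representation[of "f' x v", symmetric]) (simp only: linear_sum linear_scale)
    with has_derivative_compose[OF f'(1)[rule_format, OF that] g'_fx] show ?thesis by simp
  qed
  have g'_f: "Ck_on k U (\<lambda>x. g' (f x) b)" for b
    using Suc.IH[OF g'(2)[rule_format] Ck_on_SucD[OF Suc.prems(2)]] .
  show ?case
    by (rule Ck_on_SucI[OF chain])
       (auto intro!: Ck_on_sum Ck_on_bounded_bilinear[OF bounded_bilinear_scaleR] g'_f
          Ck_on_bounded_linear[OF bounded_linear_inner_left] f'(2)[rule_format])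
qed

lemma has_derivative_along_line:
  fixes f :: "'a::real_normed_vector \<Rightarrow> real"
  assumes "(f has_derivative f') (at (x + s *\<^sub>R v))"
  shows "((\<lambda>s. f (x + s *\<^sub>R v)) has_real_derivative f' v) (at s)"
proof -
  have "((\<lambda>s. x + s *\<^sub>R v) has_derivative (\<lambda>h. h *\<^sub>R v)) (at s)"
    by (auto intro!: derivative_eq_intros)
  from has_derivative_compose[OF this assms] show ?thesis
    unfolding has_field_derivative_def
    by (rule has_derivative_eq_rhs)
      (simp add: fun_eq_iff linear_cmul[OF has_derivative_linear[OF assms]])
qed

lemma dir_deriv_eqI: "(f has_derivative f') (at x) \<Longrightarrow> dir_deriv v f x = f' v"
  using has_derivative_along_line[of f f' x 0 v] by (simp add: dir_deriv_def DERIV_imp_deriv)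

lemma differentiable_has_dir_deriv:
  assumes "f differentiable (at x)"
  shows "(f has_derivative (\<lambda>v. dir_deriv v f x)) (at x)"
proof -
  obtain f' where "(f has_derivative f') (at x)"
    using assms by (auto simp: differentiable_def)
  then show ?thesis by (simp add: dir_deriv_eqI)
qed

lemma dir_deriv_cong:
  assumes "open U" "x \<in> U" "\<And>y. y \<in> U \<Longrightarrow> f y = g y"
  shows "dir_deriv v f x = dir_deriv v g x"
proof -
  have "((\<lambda>h. x + h *\<^sub>R v) \<longlongrightarrow> x) (nhds 0)"
    by (auto intro!: tendsto_eq_intros filterlim_ident)
  then have "\<forall>\<^sub>F h in nhds 0. x + h *\<^sub>R v \<in> U"
    using assms(1,2) by (rule topological_tendstoD)
  then show ?thesis
    unfolding dir_deriv_def by (intro deriv_cong_ev) (auto elim!: eventually_mono simp: assms(3))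
qed

lemma smooth_on_componentwise: "smooth_on U f \<longleftrightarrow> (\<forall>b\<in>Basis. smooth_on U (\<lambda>x. f x \<bullet> b))"
  by (simp add: smooth_on_def)

lemma smooth_on_real_iff:
  fixes f :: "'a::euclidean_space \<Rightarrow> real"
  shows "smooth_on U f \<longleftrightarrow> (\<forall>vs. set vs \<subseteq> Basis \<longrightarrow> continuous_on U (foldr dir_deriv vs f) \<and>
    (\<forall>v\<in>Basis. \<forall>x\<in>U. (\<lambda>h. foldr dir_deriv vs f (x + h *\<^sub>R v)) differentiable (at 0)))"
  by (simp add: smooth_on_def)

lemma smooth_on_imp_Ck_on_real:
  fixes f :: "'a::euclidean_space \<Rightarrow> real"
  assumes "open U" "smooth_on U f"
  shows "Ck_on k U f"
  using assms(2)
proof (induction k arbitrary: f)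
  case 0
  then show ?case by (auto simp: smooth_on_real_iff dest: spec[of _ "[]"])
next
  case (Suc k)
  have partials: "smooth_on U (dir_deriv v f)" if "v \<in> Basis" for v
    unfolding smooth_on_real_iff
  proof (intro allI impI)
    fix vs :: "'a list"
    assume "set vs \<subseteq> Basis"
    then show "continuous_on U (foldr dir_deriv vs (dir_deriv v f)) \<and>
        (\<forall>w\<in>Basis. \<forall>x\<in>U. (\<lambda>h. foldr dir_deriv vs (dir_deriv v f) (x + h *\<^sub>R w)) differentiable (at 0))"
      using Suc.prems[unfolded smooth_on_real_iff, rule_format, of "vs @ [v]"] that by simp
  qed
  have "((\<lambda>h. f (y + h *\<^sub>R v)) has_real_derivative dir_deriv v f y) (at 0)"
    if "v \<in> Basis" "y \<in> U" for v y
    using Suc.prems[unfolded smooth_on_real_iff, rule_format, of "[]"] that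
    by (simp add: dir_deriv_def DERIV_deriv_iff_real_differentiable)
  moreover have "continuous_on U (dir_deriv v f)" if "v \<in> Basis" for v
    using partials[OF that, unfolded smooth_on_real_iff, rule_format, of "[]"] by simp
  ultimately have total: "(f has_derivative (\<lambda>v. \<Sum>w\<in>Basis. (v \<bullet> w) * dir_deriv w f x)) (at x)"
    if "x \<in> U" for x
    using assms(1) that by (intro has_derivative_of_continuous_partials)
  show ?case
    by (rule Ck_on_SucI[OF total], assumption) (intro Ck_on_sum Ck_on_mult Ck_on_const Suc.IH partials)
qed

lemma Ck_on_dir_deriv:
  assumes "open U" "Ck_on (Suc k) U f"
  shows "Ck_on k U (dir_deriv v f)"
proof -
  obtain f' where "\<forall>x\<in>U. (f has_derivative f' x) (at x)" "\<forall>v. Ck_on k U (\<lambda>x. f' x v)"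
    by (rule Ck_on_SucE[OF assms(2)])
  then show ?thesis
    by (intro Ck_on_cong[OF assms(1) _ spec[of _ v]]) (auto simp: dir_deriv_eqI)
qed

lemma Ck_on_imp_smooth_on_real:
  fixes f :: "'a::euclidean_space \<Rightarrow> real"
  assumes "open U" and f: "\<And>k. Ck_on k U f"
  shows "smooth_on U f"
proof -
  have iter: "Ck_on k U (foldr dir_deriv vs f)" for k vs
    by (induction vs arbitrary: k) (use f Ck_on_dir_deriv[OF assms(1)] in auto)
  have "(\<lambda>h. g (x + h *\<^sub>R v)) differentiable (at 0)"
    if "Ck_on (Suc 0) U g" "x \<in> U" for g :: "'a \<Rightarrow> real" and x v
    using that has_derivative_along_line[of g _ x 0 v]
    by (elim Ck_on_SucE) (auto simp: real_differentiable_def)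
  with iter show ?thesis
    unfolding smooth_on_real_iff by (metis Ck_on.simps(1))
qed

lemma smooth_on_iff_Ck_on:
  assumes "open U"
  shows "smooth_on U f \<longleftrightarrow> (\<forall>k. Ck_on k U f)"
  using smooth_on_imp_Ck_on_real[OF assms] Ck_on_imp_smooth_on_real[OF assms]
  by (subst smooth_on_componentwise, subst Ck_on_componentwise) blast

lemma smooth_on_imp_continuous_on:
  assumes "smooth_on U f"
  shows "continuous_on U f"
  using assms[unfolded smooth_on_def, rule_format, of _ "[]"]
  by (subst continuous_on_componentwise) simp

lemma smooth_on_subset: "open U \<Longrightarrow> open V \<Longrightarrow> V \<subseteq> U \<Longrightarrow> smooth_on U f \<Longrightarrow> smooth_on V f"
  by (simp add: smooth_on_iff_Ck_on) (blast intro: Ck_on_subset)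

lemma smooth_on_cong: "open U \<Longrightarrow> (\<And>x. x \<in> U \<Longrightarrow> f x = g x) \<Longrightarrow> smooth_on U f \<Longrightarrow> smooth_on U g"
  by (simp add: smooth_on_iff_Ck_on) (blast intro: Ck_on_cong)

lemma smooth_on_const: "open U \<Longrightarrow> smooth_on U (\<lambda>x. c)"
  by (simp add: smooth_on_iff_Ck_on Ck_on_const)

lemma smooth_on_bounded_linear: "open U \<Longrightarrow> bounded_linear L \<Longrightarrow> smooth_on U L"
  by (simp add: smooth_on_iff_Ck_on Ck_on_bounded_linear[OF _ Ck_on_id])

lemma smooth_on_add: "open U \<Longrightarrow> smooth_on U f \<Longrightarrow> smooth_on U g \<Longrightarrow> smooth_on U (\<lambda>x. f x + g x)"
  by (simp add: smooth_on_iff_Ck_on Ck_on_add)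

lemma smooth_on_mult:
  fixes f g :: "'a::euclidean_space \<Rightarrow> real"
  shows "open U \<Longrightarrow> smooth_on U f \<Longrightarrow> smooth_on U g \<Longrightarrow> smooth_on U (\<lambda>x. f x * g x)"
  by (simp add: smooth_on_iff_Ck_on Ck_on_mult)

lemma smooth_on_compose:
  assumes "open U" "open V" "smooth_on V g" "smooth_on U f" "f ` U \<subseteq> V"
  shows "smooth_on U (\<lambda>x. g (f x))"
  using assms by (simp add: smooth_on_iff_Ck_on) (blast intro: Ck_on_compose)

lemma smooth_on_minus: "open U \<Longrightarrow> smooth_on U f \<Longrightarrow> smooth_on U (\<lambda>x. - f x)"
  using smooth_on_compose[of U UNIV uminus f] smooth_on_bounded_linear[of UNIV uminus]
  by (simp add: bounded_linear_minus bounded_linear_ident)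

lemma smooth_on_diff: "open U \<Longrightarrow> smooth_on U f \<Longrightarrow> smooth_on U g \<Longrightarrow> smooth_on U (\<lambda>x. f x - g x)"
  using smooth_on_add[of U f "\<lambda>x. - g x"] smooth_on_minus[of U g] by simp

lemma smooth_on_power:
  fixes f :: "'a::euclidean_space \<Rightarrow> real"
  shows "open U \<Longrightarrow> smooth_on U f \<Longrightarrow> smooth_on U (\<lambda>x. f x ^ n)"
  by (induction n) (auto intro: smooth_on_const smooth_on_mult)

lemma smooth_on_Pair_iff: "smooth_on U (\<lambda>x. (f x, g x)) \<longleftrightarrow> smooth_on U f \<and> smooth_on U g"
  by (subst (1 2 3) smooth_on_componentwise) (auto simp: Basis_prod_def ball_Un)

lemma smooth_on_fst: "smooth_on U f \<Longrightarrow> smooth_on U (\<lambda>x. fst (f x))"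
  and smooth_on_snd: "smooth_on U f \<Longrightarrow> smooth_on U (\<lambda>x. snd (f x))"
  using smooth_on_Pair_iff[of U "\<lambda>x. fst (f x)" "\<lambda>x. snd (f x)"] by simp_all

lemma smooth_on_id: "open U \<Longrightarrow> smooth_on U (\<lambda>x. x)"
  by (simp add: smooth_on_iff_Ck_on Ck_on_id)

lemma smooth_on_bootstrap:
  assumes "open U" "\<And>x. x \<in> U \<Longrightarrow> (f has_derivative f' x) (at x)"
    and "\<And>k v. Ck_on k U f \<Longrightarrow> Ck_on k U (\<lambda>x. f' x v)"
  shows "smooth_on U f"
proof -
  have "Ck_on k U f" for k
  proof (induction k)
    case 0
    show ?case
      using assms(2) by (auto intro: has_derivative_continuous_on has_derivative_at_withinI)
  next
    case (Suc k)
    then show ?case using assms(2,3) by (intro Ck_on_SucI)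
  qed
  then show ?thesis using assms(1) by (simp add: smooth_on_iff_Ck_on)
qed

lemma smooth_on_imp_differentiable:
  assumes "open U" "smooth_on U f" "x \<in> U"
  shows "f differentiable (at x)"
proof -
  have "Ck_on (Suc 0) U f"
    using assms(1,2) smooth_on_iff_Ck_on by blast
  then show ?thesis
    using assms(3) by (elim Ck_on_SucE) (auto simp: differentiable_def)
qed

lemma smooth_on_imp_has_derivative:
  fixes f :: "'a::euclidean_space \<Rightarrow> real"
  shows "open U \<Longrightarrow> smooth_on U f \<Longrightarrow> x \<in> U \<Longrightarrow> (f has_derivative (\<lambda>v. dir_deriv v f x)) (at x)"
  by (intro differentiable_has_dir_deriv smooth_on_imp_differentiable)

lemma smooth_on_dir_deriv:
  fixes f :: "'a::euclidean_space \<Rightarrow> real"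
  shows "open U \<Longrightarrow> smooth_on U f \<Longrightarrow> smooth_on U (dir_deriv v f)"
  by (simp add: smooth_on_iff_Ck_on Ck_on_dir_deriv)

lemma smooth_on_has_dir_deriv:
  fixes f :: "'a::euclidean_space \<Rightarrow> real"
  assumes "open U" "smooth_on U f" "x + s *\<^sub>R v \<in> U"
  shows "((\<lambda>s. f (x + s *\<^sub>R v)) has_real_derivative dir_deriv v f (x + s *\<^sub>R v)) (at s)"
  by (rule has_derivative_along_line[OF smooth_on_imp_has_derivative[OF assms]])

lemma second_difference_mvt:
  fixes f :: "'a::euclidean_space \<Rightarrow> real"
  assumes f: "open U" "smooth_on U f" and h: "h > 0"
    and box: "\<And>s t. 0 \<le> s \<Longrightarrow> s \<le> h \<Longrightarrow> 0 \<le> t \<Longrightarrow> t \<le> h \<Longrightarrow> x + s *\<^sub>R u + t *\<^sub>R v \<in> U"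
  obtains s t where "0 < s" "s < h" "0 < t" "t < h"
    "f (x + h *\<^sub>R u + h *\<^sub>R v) - f (x + h *\<^sub>R u) - f (x + h *\<^sub>R v) + f x
      = h\<^sup>2 * dir_deriv v (dir_deriv u f) (x + s *\<^sub>R u + t *\<^sub>R v)"
proof -
  have "((\<lambda>s. f (x + s *\<^sub>R u + h *\<^sub>R v) - f (x + s *\<^sub>R u)) has_real_derivative
      dir_deriv u f (x + s *\<^sub>R u + h *\<^sub>R v) - dir_deriv u f (x + s *\<^sub>R u)) (at s)"
    if "0 \<le> s" "s \<le> h" for s
    using smooth_on_has_dir_deriv[OF f, of "x + h *\<^sub>R v" s u] smooth_on_has_dir_deriv[OF f, of x s u]
      box[OF that, of h] box[OF that, of 0] h by (auto intro: DERIV_diff simp: algebra_simps)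
  from MVT2[OF h this] obtain s where s: "0 < s" "s < h" and
    first: "f (x + h *\<^sub>R u + h *\<^sub>R v) - f (x + h *\<^sub>R u) - (f (x + h *\<^sub>R v) - f x)
      = h * (dir_deriv u f (x + s *\<^sub>R u + h *\<^sub>R v) - dir_deriv u f (x + s *\<^sub>R u))"
    by auto
  have "((\<lambda>t. dir_deriv u f (x + s *\<^sub>R u + t *\<^sub>R v)) has_real_derivative
      dir_deriv v (dir_deriv u f) (x + s *\<^sub>R u + t *\<^sub>R v)) (at t)" if "0 \<le> t" "t \<le> h" for t
    by (rule smooth_on_has_dir_deriv[OF f(1) smooth_on_dir_deriv[OF f]]) (use box that s in auto)
  from MVT2[OF h this] obtain t where "0 < t" "t < h" and
    "dir_deriv u f (x + s *\<^sub>R u + h *\<^sub>R v) - dir_deriv u f (x + s *\<^sub>R u)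
      = h * dir_deriv v (dir_deriv u f) (x + s *\<^sub>R u + t *\<^sub>R v)"
    by auto
  with s first show thesis
    by (intro that[of s t]) (simp_all add: power2_eq_square)
qed

lemma second_difference_tendsto:
  fixes f :: "'a::euclidean_space \<Rightarrow> real"
  assumes U: "open U" "x \<in> U" and f: "smooth_on U f"
  shows "((\<lambda>h. (f (x + h *\<^sub>R u + h *\<^sub>R v) - f (x + h *\<^sub>R u) - f (x + h *\<^sub>R v) + f x) / h\<^sup>2)
    \<longlongrightarrow> dir_deriv v (dir_deriv u f) x) (at_right 0)"
proof (rule tendstoI)
  fix e :: real
  assume "e > 0"
  let ?A = "dir_deriv v (dir_deriv u f)"
  have "isCont ?A x"
    using smooth_on_imp_continuous_on[OF smooth_on_dir_deriv[OF U(1) smooth_on_dir_deriv[OF U(1) f]]] U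
    by (simp add: continuous_on_eq_continuous_at)
  then have "\<forall>\<^sub>F y in nhds x. y \<in> U \<and> dist (?A y) (?A x) < e"
    using U \<open>e > 0\<close> by (simp add: isCont_def tendsto_at_iff_tendsto_nhds tendstoD eventually_conj
      eventually_nhds_in_open)
  then obtain d where d: "d > 0" "\<And>y. dist y x < d \<Longrightarrow> y \<in> U \<and> dist (?A y) (?A x) < e"
    unfolding eventually_nhds_metric by blast
  have "((\<lambda>h. h * (norm u + norm v)) \<longlongrightarrow> 0) (at_right 0)"
    by (auto intro!: tendsto_eq_intros)
  then have "\<forall>\<^sub>F h in at_right 0. h * (norm u + norm v) < d"
    using d(1) by (rule order_tendstoD)
  then show "\<forall>\<^sub>F h in at_right 0. dist
    ((f (x + h *\<^sub>R u + h *\<^sub>R v) - f (x + h *\<^sub>R u) - f (x + h *\<^sub>R v) + f x) / h\<^sup>2)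
      (?A x) < e"
    using eventually_at_right_less[of 0]
  proof eventually_elim
    case (elim h)
    have near: "dist (x + s *\<^sub>R u + t *\<^sub>R v) x < d" if "0 \<le> s" "s \<le> h" "0 \<le> t" "t \<le> h" for s t
    proof -
      have "dist (x + s *\<^sub>R u + t *\<^sub>R v) x \<le> s * norm u + t * norm v"
        using norm_triangle_ineq[of "s *\<^sub>R u" "t *\<^sub>R v"] that by (simp add: dist_norm add.assoc)
      also have "\<dots> \<le> h * norm u + h * norm v"
        using that by (intro add_mono mult_right_mono) auto
      finally show ?thesis using elim(1) by (simp add: distrib_left)
    qed
    then have "x + s *\<^sub>R u + t *\<^sub>R v \<in> U" if "0 \<le> s" "s \<le> h" "0 \<le> t" "t \<le> h" for s t
      using that d(2) by blast
    then obtain s t where "0 < s" "s < h" "0 < t" "t < h"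
      "f (x + h *\<^sub>R u + h *\<^sub>R v) - f (x + h *\<^sub>R u) - f (x + h *\<^sub>R v) + f x
        = h\<^sup>2 * ?A (x + s *\<^sub>R u + t *\<^sub>R v)"
      by (rule second_difference_mvt[OF U(1) f elim(2)])
    then show ?case using d(2)[OF near[of s t]] elim(2) by simp
  qed
qed

lemma dir_deriv_commute:
  fixes f :: "'a::euclidean_space \<Rightarrow> real"
  assumes "open U" "x \<in> U" "smooth_on U f"
  shows "dir_deriv u (dir_deriv v f) x = dir_deriv v (dir_deriv u f) x"
proof (rule tendsto_unique[OF _ second_difference_tendsto[OF assms]])
  show "((\<lambda>h. (f (x + h *\<^sub>R v + h *\<^sub>R u) - f (x + h *\<^sub>R v) - f (x + h *\<^sub>R u) + f x) / h\<^sup>2)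
      \<longlongrightarrow> dir_deriv v (dir_deriv u f) x) (at_right 0)"
    using second_difference_tendsto[OF assms, of u v] by (simp add: algebra_simps)
qed simp

subsection \<open>Functions of one variable\<close>

lemma Ck_on_real_SucI:
  fixes f f' :: "real \<Rightarrow> real"
  assumes "\<And>x. x \<in> S \<Longrightarrow> (f has_real_derivative f' x) (at x)" "Ck_on k S f'"
  shows "Ck_on (Suc k) S f"
  using assms by (intro Ck_on_SucI[where f' = "\<lambda>x. (*) (f' x)"] Ck_on_mult Ck_on_const)
    (auto simp: has_field_derivative_def)

lemma smooth_on_antiderivative:
  fixes f f' :: "real \<Rightarrow> real"
  assumes "open S" "\<And>x. x \<in> S \<Longrightarrow> (f has_real_derivative f' x) (at x)" "smooth_on S f'"
  shows "smooth_on S f"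
  using assms Ck_on_real_SucI Ck_on_SucD by (metis smooth_on_iff_Ck_on)

lemma smooth_on_real_bootstrap:
  fixes f f' :: "real \<Rightarrow> real"
  assumes "open S" "\<And>x. x \<in> S \<Longrightarrow> (f has_real_derivative f' x) (at x)"
    and "\<And>k. Ck_on k S f \<Longrightarrow> Ck_on k S f'"
  shows "smooth_on S f"
  using assms by (intro smooth_on_bootstrap[where f' = "\<lambda>x. (*) (f' x)"] Ck_on_mult Ck_on_const)
    (auto simp: has_field_derivative_def)

lemma smooth_on_imp_DERIV:
  fixes f :: "real \<Rightarrow> real"
  assumes "open S" "smooth_on S f" "x \<in> S"
  shows "(f has_real_derivative deriv f x) (at x)"
proof -
  have "(f has_real_derivative dir_deriv 1 f x) (at x)"
    using smooth_on_has_dir_deriv[of S f 0 x 1] assms by simp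
  then show ?thesis by (simp add: DERIV_imp_deriv)
qed

lemma smooth_on_deriv:
  fixes f :: "real \<Rightarrow> real"
  assumes "open S" "smooth_on S f"
  shows "smooth_on S (deriv f)"
proof (rule smooth_on_cong[OF assms(1) _ smooth_on_dir_deriv[OF assms]])
  show "dir_deriv 1 f x = deriv f x" if "x \<in> S" for x
    using dir_deriv_eqI[OF smooth_on_imp_DERIV[OF assms that, unfolded has_field_derivative_def],
      of 1] by simp
qed

lemma smooth_on_inverse:
  fixes f :: "'a::euclidean_space \<Rightarrow> real"
  assumes "open U" "smooth_on U f" "\<And>x. x \<in> U \<Longrightarrow> f x \<noteq> 0"
  shows "smooth_on U (\<lambda>x. inverse (f x))"
proof (rule smooth_on_compose[OF assms(1) _ _ assms(2), of "- {0}" inverse])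
  show "smooth_on (- {0}) (inverse :: real \<Rightarrow> real)"
  proof (rule smooth_on_real_bootstrap)
    show "(inverse has_real_derivative (-1) * (inverse x * inverse x)) (at x)"
      if "x \<in> - {0}" for x :: real
      using that by (auto intro!: derivative_eq_intros simp: power2_eq_square)
    show "Ck_on k (- {0}) (\<lambda>x::real. (-1) * (inverse x * inverse x))"
      if "Ck_on k (- {0}) (inverse :: real \<Rightarrow> real)" for k
      by (intro Ck_on_mult Ck_on_const that)
  qed (simp add: open_Compl)
qed (use assms(3) in auto)

lemma smooth_on_divide:
  fixes f g :: "'a::euclidean_space \<Rightarrow> real"
  assumes "open U" "smooth_on U f" "smooth_on U g" "\<And>x. x \<in> U \<Longrightarrow> g x \<noteq> 0"
  shows "smooth_on U (\<lambda>x. f x / g x)"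
  unfolding divide_inverse by (intro smooth_on_mult smooth_on_inverse assms)

lemma smooth_on_exp:
  fixes f :: "'a::euclidean_space \<Rightarrow> real"
  assumes "open U" "smooth_on U f"
  shows "smooth_on U (\<lambda>x. exp (f x))"
proof (rule smooth_on_compose[OF assms(1) _ _ assms(2)])
  show "smooth_on UNIV (exp :: real \<Rightarrow> real)"
    by (rule smooth_on_real_bootstrap[of _ _ exp]) auto
qed auto

lemma smooth_on_ln:
  fixes f :: "'a::euclidean_space \<Rightarrow> real"
  assumes "open U" "smooth_on U f" "\<And>x. x \<in> U \<Longrightarrow> f x > 0"
  shows "smooth_on U (\<lambda>x. ln (f x))"
proof (rule smooth_on_compose[OF assms(1) _ _ assms(2), of "{0<..}" ln])
  show "smooth_on {0<..} (ln :: real \<Rightarrow> real)"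
    by (rule smooth_on_antiderivative[of _ _ inverse])
       (auto intro!: derivative_eq_intros smooth_on_inverse smooth_on_id simp: divide_inverse)
qed (use assms(3) in auto)

lemma smooth_on_powr:
  fixes f :: "'a::euclidean_space \<Rightarrow> real"
  assumes "open U" "smooth_on U f" "\<And>x. x \<in> U \<Longrightarrow> f x > 0"
  shows "smooth_on U (\<lambda>x. f x powr c)"
proof (rule smooth_on_cong[OF assms(1)])
  show "smooth_on U (\<lambda>x. exp (c * ln (f x)))"
    by (intro smooth_on_exp smooth_on_mult smooth_on_const smooth_on_ln assms)
qed (use assms(3) in \<open>force simp: powr_def\<close>)

lemma smooth_on_sqrt:
  fixes f :: "'a::euclidean_space \<Rightarrow> real"
  assumes "open U" "smooth_on U f" "\<And>x. x \<in> U \<Longrightarrow> f x > 0"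
  shows "smooth_on U (\<lambda>x. sqrt (f x))"
  by (rule smooth_on_cong[OF assms(1) _ smooth_on_powr[OF assms, of "1/2"]])
     (use assms(3) in \<open>auto simp: powr_half_sqrt less_imp_le\<close>)

lemmas smooth_on_intros = smooth_on_const smooth_on_id smooth_on_fst smooth_on_snd smooth_on_add
  smooth_on_minus smooth_on_diff smooth_on_mult smooth_on_power smooth_on_divide smooth_on_exp
  smooth_on_powr smooth_on_sqrt

lemma inj_on_of_deriv_pos:
  fixes f f' :: "real \<Rightarrow> real"
  assumes "is_interval S" "\<And>x. x \<in> S \<Longrightarrow> (f has_real_derivative f' x) (at x)" "\<And>x. x \<in> S \<Longrightarrow> f' x > 0"
  shows "inj_on f S"
proof -
  have "f x < f y" if "x \<in> S" "y \<in> S" "x < y" for x y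
  proof (rule DERIV_pos_imp_increasing[OF that(3)])
    fix z
    assume "x \<le> z" "z \<le> y"
    then have "z \<in> S"
      using assms(1) that by (meson mem_is_interval_1_I)
    then show "\<exists>d. (f has_real_derivative d) (at z) \<and> d > 0"
      using assms(2,3) by blast
  qed
  then show ?thesis
    by (metis inj_onI linorder_neqE_linordered_idom less_irrefl)
qed

lemma smooth_on_inv_into:
  fixes f :: "real \<Rightarrow> real"
  assumes S: "open S" and f: "smooth_on S f" "inj_on f S" and nonzero: "\<And>x. x \<in> S \<Longrightarrow> deriv f x \<noteq> 0"
  shows "open (f ` S)" "smooth_on (f ` S) (inv_into S f)"
proof -
  let ?g = "inv_into S f"
  have cont: "continuous_on S f"
    by (rule smooth_on_imp_continuous_on[OF f(1)])
  then show open_image: "open (f ` S)"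
    using f(2) S by (intro invariance_of_domain)
  have g_deriv: "(?g has_real_derivative inverse (deriv f (?g y))) (at y)" if y: "y \<in> f ` S" for y
  proof -
    obtain x where x: "x \<in> S" "y = f x"
      using y by blast
    have "(?g has_derivative (*) (inverse (deriv f x))) (at (f x))"
    proof (rule has_derivative_inverse_strong[OF S x(1) cont])
      show "(f has_derivative (*) (deriv f x)) (at x)"
        using smooth_on_imp_DERIV[OF S f(1) x(1)] by (simp add: has_field_derivative_def)
      show "(*) (deriv f x) \<circ> (*) (inverse (deriv f x)) = id"
        using nonzero[OF x(1)] by (auto simp: fun_eq_iff)
    qed (use f(2) in auto)
    then show ?thesis
      using x f(2) by (simp add: has_field_derivative_def)
  qed
  show "smooth_on (f ` S) ?g"
  proof (rule smooth_on_real_bootstrap[OF open_image g_deriv])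
    fix k
    assume g: "Ck_on k (f ` S) ?g"
    have "smooth_on S (\<lambda>x. inverse (deriv f x))"
      by (intro smooth_on_inverse smooth_on_deriv S f nonzero)
    then have "Ck_on k S (\<lambda>x. inverse (deriv f x))"
      using S by (simp add: smooth_on_iff_Ck_on)
    then show "Ck_on k (f ` S) (\<lambda>y. inverse (deriv f (?g y)))"
      by (rule Ck_on_compose[OF _ g]) (auto simp: inv_into_into)
  qed
qed

subsection \<open>Implicit functions\<close>

lemma linear_prod_real:
  fixes L :: "'a::real_vector \<times> real \<Rightarrow> real"
  assumes "linear L"
  shows "L (v, s) = L (v, 0) + s * L (0, 1)"
  using linear_add[OF assms, of "(v, 0)" "s *\<^sub>R (0, 1)"] linear_cmul[OF assms, of s "(0, 1)"] by simp

lemma graph_map_inverse: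
  fixes D :: "'a::real_normed_vector \<times> real \<Rightarrow> real"
  assumes D: "bounded_linear D" and "D (0, 1) \<noteq> 0"
  obtains N :: "('a \<times> real) \<Rightarrow>\<^sub>L ('a \<times> real)" where "\<And>v. blinfun_apply N (fst v, D v) = v"
proof
  let ?N = "\<lambda>w. (fst w, (snd w - D (fst w, 0)) / D (0, 1))"
  have "bounded_linear ?N"
    by (intro bounded_linear_Pair bounded_linear_compose[OF bounded_linear_divide] bounded_linear_sub
        bounded_linear_compose[OF D] bounded_linear_fst bounded_linear_snd bounded_linear_zero)
  then show "blinfun_apply (Blinfun ?N) (fst v, D v) = v" for v
    using linear_prod_real[OF bounded_linear.linear[OF D], of "fst v" "snd v"] assms(2)
    by (simp add: bounded_linear_Blinfun_apply prod_eq_iff)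
qed

lemma smooth_on_graph_map_C1:
  fixes F :: "'a::euclidean_space \<times> real \<Rightarrow> real"
  assumes U: "open U" and F: "smooth_on U F"
  obtains M where "continuous_on U M"
    "\<forall>p\<in>U. ((\<lambda>p. (fst p, F p)) has_derivative blinfun_apply (M p)) (at p)"
    "\<forall>p\<in>U. blinfun_apply (M p) = (\<lambda>v. (fst v, dir_deriv v F p))"
proof
  let ?M = "\<lambda>p. Blinfun (\<lambda>v. (fst v, dir_deriv v F p))"
  have M: "blinfun_apply (?M p) = (\<lambda>v. (fst v, dir_deriv v F p))" if "p \<in> U" for p
    using smooth_on_imp_has_derivative[OF U F that] has_derivative_bounded_linear
    by (intro bounded_linear_Blinfun_apply bounded_linear_Pair bounded_linear_fst) blast
  then show "\<forall>p\<in>U. blinfun_apply (?M p) = (\<lambda>v. (fst v, dir_deriv v F p))"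
    by blast
  have "((\<lambda>p. (fst p, F p)) has_derivative blinfun_apply (?M p)) (at p)" if "p \<in> U" for p
    unfolding M[OF that] by (auto
      intro!: derivative_eq_intros smooth_on_imp_has_derivative[OF U F that])
  then show "\<forall>p\<in>U. ((\<lambda>p. (fst p, F p)) has_derivative blinfun_apply (?M p)) (at p)"
    by blast
  show "continuous_on U ?M"
  proof (rule continuous_on_blinfun_componentwise)
    fix v :: "'a \<times> real"
    have "continuous_on U (\<lambda>p. (fst v, dir_deriv v F p))"
      by (intro continuous_intros smooth_on_imp_continuous_on smooth_on_dir_deriv U F)
    then show "continuous_on U (\<lambda>p. blinfun_apply (?M p) v)"
      by (rule continuous_on_eq) (simp add: M)
  qed
qed

lemma graph_map_local_inverse:
  fixes F :: "'a::euclidean_space \<times> real \<Rightarrow> real"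
  assumes U: "open U" "p \<in> U" and F: "smooth_on U F" and nonzero: "dir_deriv (0, 1) F p \<noteq> 0"
  obtains V g g' where "open V" "(fst p, F p) \<in> V" "g (fst p, F p) = p"
    "\<And>q. q \<in> V \<Longrightarrow> g q \<in> U \<and> (fst (g q), F (g q)) = q \<and> (g has_derivative g' q) (at q)"
proof -
  let ?h = "\<lambda>p. (fst p, F p)"
  obtain M where cont_M: "continuous_on U M"
    and h': "\<forall>p\<in>U. (?h has_derivative blinfun_apply (M p)) (at p)"
    and M: "\<forall>p\<in>U. blinfun_apply (M p) = (\<lambda>v. (fst v, dir_deriv v F p))"
    by (rule smooth_on_graph_map_C1[OF U(1) F])
  have F': "(F has_derivative (\<lambda>v. dir_deriv v F p)) (at p)"
    by (rule smooth_on_imp_has_derivative[OF U(1) F U(2)])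
  obtain N :: "('a \<times> real) \<Rightarrow>\<^sub>L ('a \<times> real)"
    where "\<And>v. blinfun_apply N (fst v, dir_deriv v F p) = v"
    using graph_map_inverse[OF has_derivative_bounded_linear[OF F'] nonzero] by blast
  then have inverse: "N o\<^sub>L M p = id_blinfun"
    by (intro blinfun_eqI) (simp add: M U(2))
  show thesis
  proof (rule inverse_function_theorem[OF U(1) h'[rule_format] cont_M U(2) inverse])
    fix U' V g g'
    assume V: "open V" "?h p \<in> V" and U': "p \<in> U'" "U' \<subseteq> U"
      and g: "homeomorphism U' V ?h g" and g': "\<And>q. q \<in> V \<Longrightarrow> (g has_derivative g' q) (at q)"
    have "g q \<in> U" "?h (g q) = q" if "q \<in> V" for q
      using homeomorphism_apply2[OF g that] homeomorphism_image2[OF g] that U'(2) by auto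
    then show thesis
      using V homeomorphism_apply1[OF g U'(1)] g' by (intro that[of V g g']) simp_all
  qed
qed

lemma implicit_function_differentiable:
  fixes F :: "'a::euclidean_space \<times> real \<Rightarrow> real"
  assumes U: "open U" "(x0, y0) \<in> U" and F: "smooth_on U F" "F (x0, y0) = 0"
    and nonzero: "dir_deriv (0, 1) F (x0, y0) \<noteq> 0"
  obtains V u u' where "open V" "x0 \<in> V" "u x0 = y0"
    "\<And>x. x \<in> V \<Longrightarrow> (x, u x) \<in> U \<and> F (x, u x) = 0 \<and> (u has_derivative u' x) (at x)"
proof -
  obtain V g g' where V: "open V" "(x0, 0) \<in> V" and g0: "g (x0, 0) = (x0, y0)"
    and g: "\<And>q. q \<in> V \<Longrightarrow> g q \<in> U \<and> (fst (g q), F (g q)) = q \<and> (g has_derivative g' q) (at q)"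
    using graph_map_local_inverse[OF U F(1) nonzero] F(2) by (metis fst_conv)
  show thesis
  proof (rule that[of "(\<lambda>x. (x, 0)) -` V" "\<lambda>x. snd (g (x, 0))" "\<lambda>x v. snd (g' (x, 0) (v, 0))"])
    show "open ((\<lambda>x. (x, 0)) -` V)"
      by (intro open_vimage V continuous_intros)
    show "x0 \<in> (\<lambda>x. (x, 0)) -` V" "snd (g (x0, 0)) = y0"
      using V g0 by simp_all
    fix x
    assume "x \<in> (\<lambda>x. (x, 0)) -` V"
    then have "g (x, 0) \<in> U" and inverse: "(fst (g (x, 0)), F (g (x, 0))) = (x, 0)"
      and g': "(g has_derivative g' (x, 0)) (at (x, 0))"
      using g[of "(x, 0)"] by auto
    have "g (x, 0) = (x, snd (g (x, 0)))"
      using inverse by (simp add: prod_eq_iff)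
    moreover have "((\<lambda>x. (x, 0)) has_derivative (\<lambda>v. (v, 0))) (at x)"
      by (auto intro!: derivative_eq_intros)
    then have "((\<lambda>x. g (x, 0)) has_derivative (\<lambda>v. g' (x, 0) (v, 0))) (at x)"
      using has_derivative_compose[of "\<lambda>x. (x, 0)", OF _ g'] by blast
    ultimately show "(x, snd (g (x, 0))) \<in> U \<and> F (x, snd (g (x, 0))) = 0 \<and>
        ((\<lambda>x. snd (g (x, 0))) has_derivative (\<lambda>v. snd (g' (x, 0) (v, 0)))) (at x)"
      using \<open>g (x, 0) \<in> U\<close> inverse by (auto intro: has_derivative_snd)
  qed
qed

lemma smooth_on_implicit_solution:
  fixes F :: "'a::euclidean_space \<times> real \<Rightarrow> real"
  assumes U: "open U" "smooth_on U F" "\<And>p. p \<in> U \<Longrightarrow> dir_deriv (0, 1) F p \<noteq> 0"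
    and V: "open V" "\<And>x. x \<in> V \<Longrightarrow> (x, u x) \<in> U \<and> F (x, u x) = 0 \<and> (u has_derivative u' x) (at x)"
  shows "smooth_on V u"
proof (rule smooth_on_bootstrap[OF V(1)])
  show "(u has_derivative (\<lambda>v. - (dir_deriv (v, 0) F (x, u x) / dir_deriv (0, 1) F (x, u x)))) (at x)"
    if "x \<in> V" for x
  proof -
    have F': "(F has_derivative (\<lambda>v. dir_deriv v F (x, u x))) (at (x, u x))"
      using smooth_on_imp_has_derivative[OF U(1,2)] V(2)[OF that] by blast
    have u': "(u has_derivative u' x) (at x)"
      using V(2)[OF that] by blast
    have "((\<lambda>x. F (x, u x)) has_derivative (\<lambda>v. dir_deriv (v, u' x v) F (x, u x))) (at x)"
      by (rule has_derivative_compose[OF has_derivative_Pair[OF has_derivative_ident u'] F'])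
    moreover have "((\<lambda>x. F (x, u x)) has_derivative (\<lambda>v. 0)) (at x)"
      by (rule has_derivative_transform_within_open[OF has_derivative_const V(1) that]) (simp add: V(2))
    ultimately have "(\<lambda>v. dir_deriv (v, u' x v) F (x, u x)) = (\<lambda>v. 0)"
      by (rule has_derivative_unique)
    then have "dir_deriv (v, 0) F (x, u x) + u' x v * dir_deriv (0, 1) F (x, u x) = 0" for v
      using linear_prod_real[OF has_derivative_linear[OF F'], of v "u' x v"] by (simp add: fun_eq_iff)
    then have "u' x = (\<lambda>v. - (dir_deriv (v, 0) F (x, u x) / dir_deriv (0, 1) F (x, u x)))"
      using U(3) V(2)[OF that] by (auto simp: fun_eq_iff field_simps add_eq_0_iff)
    with u' show ?thesis by simp
  qed
  fix k v
  assume "Ck_on k V u"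
  then have graph: "Ck_on k V (\<lambda>x. (x, u x))"
    by (subst Ck_on_componentwise)
       (auto simp: Basis_prod_def intro: Ck_on_bounded_linear bounded_linear_inner_left Ck_on_id)
  have "smooth_on U (\<lambda>p. - (dir_deriv (v, 0) F p / dir_deriv (0, 1) F p))"
    by (intro smooth_on_minus smooth_on_divide smooth_on_dir_deriv U)
  then have "Ck_on k U (\<lambda>p. - (dir_deriv (v, 0) F p / dir_deriv (0, 1) F p))"
    using U(1) by (simp add: smooth_on_iff_Ck_on)
  then show "Ck_on k V (\<lambda>x. - (dir_deriv (v, 0) F (x, u x) / dir_deriv (0, 1) F (x, u x)))"
    by (rule Ck_on_compose[OF _ graph]) (auto simp: V(2))
qed

lemma smooth_implicit_function:
  fixes F :: "'a::euclidean_space \<times> real \<Rightarrow> real"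
  assumes U: "open U" "(x0, y0) \<in> U" and F: "smooth_on U F" "F (x0, y0) = 0"
    and nonzero: "dir_deriv (0, 1) F (x0, y0) \<noteq> 0"
  obtains V u where "open V" "x0 \<in> V" "u x0 = y0" "smooth_on V u"
    "\<And>x. x \<in> V \<Longrightarrow> (x, u x) \<in> U \<and> F (x, u x) = 0"
proof -
  define U0 where "U0 = U \<inter> dir_deriv (0, 1) F -` (- {0})"
  have U0: "open U0" "(x0, y0) \<in> U0" "U0 \<subseteq> U"
    unfolding U0_def using U nonzero
    by (auto intro: continuous_open_preimage smooth_on_imp_continuous_on smooth_on_dir_deriv F(1))
  have F0: "smooth_on U0 F"
    by (rule smooth_on_subset[OF U(1) U0(1,3) F(1)])
  obtain V u u' where V: "open V" "x0 \<in> V" "u x0 = y0"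
    "\<And>x. x \<in> V \<Longrightarrow> (x, u x) \<in> U0 \<and> F (x, u x) = 0 \<and> (u has_derivative u' x) (at x)"
    using implicit_function_differentiable[OF U0(1,2) F0 F(2) nonzero] by metis
  have "smooth_on V u"
    by (rule smooth_on_implicit_solution[OF U0(1) F0 _ V(1,4)]) (auto simp: U0_def)
  then show thesis using that V U0(3) by blast
qed

subsection \<open>Directional derivatives of composite functions\<close>

lemma dir_deriv_const: "dir_deriv v (\<lambda>x. c) x = 0"
  by (rule dir_deriv_eqI[OF has_derivative_const])

lemma dir_deriv_add:
  assumes "f differentiable (at x)" "g differentiable (at x)"
  shows "dir_deriv v (\<lambda>x. f x + g x) x = dir_deriv v f x + dir_deriv v g x"
  by (rule dir_deriv_eqI[OF has_derivative_add[OF assms[THEN differentiable_has_dir_deriv]]])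

lemma dir_deriv_diff:
  assumes "f differentiable (at x)" "g differentiable (at x)"
  shows "dir_deriv v (\<lambda>x. f x - g x) x = dir_deriv v f x - dir_deriv v g x"
  by (rule dir_deriv_eqI[OF has_derivative_diff[OF assms[THEN differentiable_has_dir_deriv]]])

lemma dir_deriv_minus:
  assumes "f differentiable (at x)"
  shows "dir_deriv v (\<lambda>x. - f x) x = - dir_deriv v f x"
  by (rule dir_deriv_eqI[OF has_derivative_minus[OF assms[THEN differentiable_has_dir_deriv]]])

lemma dir_deriv_mult:
  assumes "f differentiable (at x)" "g differentiable (at x)"
  shows "dir_deriv v (\<lambda>x. f x * g x) x = f x * dir_deriv v g x + dir_deriv v f x * g x"
  by (rule dir_deriv_eqI[OF has_derivative_mult[OF assms[THEN differentiable_has_dir_deriv]]])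

lemma dir_deriv_divide:
  assumes "f differentiable (at x)" "g differentiable (at x)" "g x \<noteq> 0"
  shows "dir_deriv v (\<lambda>x. f x / g x) x = (dir_deriv v f x * g x - f x * dir_deriv v g x) / (g x * g x)"
  by (rule dir_deriv_eqI[OF has_derivative_divide'[OF assms(1,2)[THEN differentiable_has_dir_deriv]
    assms(3)]])

lemma dir_deriv_power:
  assumes "f differentiable (at x)"
  shows "dir_deriv v (\<lambda>x. f x ^ n) x = of_nat n * dir_deriv v f x * f x ^ (n - 1)"
  by (rule dir_deriv_eqI[OF has_derivative_power[OF assms[THEN differentiable_has_dir_deriv]]])

lemma dir_deriv_bounded_linear: "bounded_linear L \<Longrightarrow> dir_deriv v L x = L v"
  by (rule dir_deriv_eqI[OF bounded_linear_imp_has_derivative])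

lemma dir_deriv_compose_real:
  assumes "(f has_real_derivative f') (at (g x))" "g differentiable (at x)"
  shows "dir_deriv v (\<lambda>x. f (g x)) x = dir_deriv v g x * f'"
  by (rule dir_deriv_eqI[OF DERIV_compose_FDERIV[OF assms(1)
    differentiable_has_dir_deriv[OF assms(2)]]])

lemmas dir_deriv_simps = dir_deriv_const dir_deriv_add dir_deriv_minus dir_deriv_diff dir_deriv_mult
  dir_deriv_divide dir_deriv_power

abbreviation Dt :: "(real \<times> real \<Rightarrow> real) \<Rightarrow> real \<times> real \<Rightarrow> real" where "Dt \<equiv> dir_deriv (1, 0)"
abbreviation Dx :: "(real \<times> real \<Rightarrow> real) \<Rightarrow> real \<times> real \<Rightarrow> real" where "Dx \<equiv> dir_deriv (0, 1)"

lemma Dx_eqI: "((\<lambda>x. F (t, x)) has_real_derivative d) (at x) \<Longrightarrow> Dx F (t, x) = d"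
  and Dt_eqI: "((\<lambda>t. F (t, x)) has_real_derivative d) (at t) \<Longrightarrow> Dt F (t, x) = d"
  using deriv_shift_0[of "\<lambda>x. F (t, x)" x] deriv_shift_0[of "\<lambda>t. F (t, x)" t]
  by (auto simp: dir_deriv_def o_def dest: DERIV_imp_deriv)

lemma dir_deriv_real_prod:
  fixes F :: "real \<times> real \<Rightarrow> real"
  assumes "F differentiable (at p)"
  shows "dir_deriv (s, y) F p = s * Dt F p + y * Dx F p"
proof -
  have "linear (\<lambda>v. dir_deriv v F p)"
    by (rule has_derivative_linear[OF differentiable_has_dir_deriv[OF assms]])
  from linear_prod_real[OF this, of s y] linear_cmul[OF this, of s "(1, 0)"] show ?thesis
    by simp
qed

lemma has_derivative_compose_Pair:
  fixes F :: "real \<times> real \<Rightarrow> real"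
  assumes "F differentiable (at (f x, g x))" "f differentiable (at x)" "g differentiable (at x)"
  shows "((\<lambda>x. F (f x, g x)) has_derivative
    (\<lambda>v. dir_deriv v f x * Dt F (f x, g x) + dir_deriv v g x * Dx F (f x, g x))) (at x)"
  using has_derivative_compose[OF has_derivative_Pair[OF assms(2,3)[THEN differentiable_has_dir_deriv]]
      differentiable_has_dir_deriv[OF assms(1)]]
  by (simp only: dir_deriv_real_prod[OF assms(1), of "dir_deriv _ f x"])

lemmas dir_deriv_compose_Pair = dir_deriv_eqI[OF has_derivative_compose_Pair]
  and differentiable_compose_Pair = differentiableI[OF has_derivative_compose_Pair]

section \<open>Parabolic equations and their reduction to the heat equation\<close>

definition parabolic_op ::
  "(real \<Rightarrow> real) \<Rightarrow> (real \<Rightarrow> real) \<Rightarrow> (real \<Rightarrow> real) \<Rightarrow> (real \<times> real \<Rightarrow> real) \<Rightarrow> real \<times> real \<Rightarrow> real" where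
  "parabolic_op a b c F p = Dt F p - (a (snd p) * Dx (Dx F) p + b (snd p) * Dx F p + c (snd p) * F p)"

lemma pt_eq: "pt u t x = Dt (\<lambda>p. u (fst p) (snd p)) (t, x)"
  and px_eq: "px u t x = Dx (\<lambda>p. u (fst p) (snd p)) (t, x)"
  using deriv_shift_0[of "\<lambda>s. u s x" t] deriv_shift_0[of "\<lambda>y. u t y" x]
  by (simp_all add: pt_def px_def dir_deriv_def o_def)

lemma pxx_eq: "pxx u t x = Dx (Dx (\<lambda>p. u (fst p) (snd p))) (t, x)"
proof -
  have "pxx u t x = px (px u) t x"
    by (simp only: pxx_def px_def[of "px u"])
  then show ?thesis by (simp add: px_eq)
qed

lemma lsol_iff_parabolic_op:
  "lsol a b c S Om u \<longleftrightarrow> open Om \<and> Om \<subseteq> UNIV \<times> S \<and> smooth_on Om (\<lambda>p. u (fst p) (snd p)) \<and>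
     (\<forall>p\<in>Om. parabolic_op a b c (\<lambda>p. u (fst p) (snd p)) p = 0)"
  by (auto simp: lsol_def parabolic_op_def pt_eq px_eq pxx_eq)

lemma parabolic_op_cong:
  assumes "open U" "p \<in> U" "\<And>q. q \<in> U \<Longrightarrow> F q = G q"
  shows "parabolic_op a b c F p = parabolic_op a b c G p"
proof -
  have "Dx F q = Dx G q" if "q \<in> U" for q
    by (rule dir_deriv_cong[OF assms(1) that assms(3)])
  then show ?thesis
    using dir_deriv_cong[OF assms(1,2), of "Dx F" "Dx G"
      "(0, 1)"] dir_deriv_cong[OF assms, of _ "(1, 0)"] assms(2,3)
    by (simp add: parabolic_op_def)
qed

locale parabolic =
  fixes a b c I B :: "real \<Rightarrow> real" and S :: "real set"
  assumes S: "is_interval S" "open S" "S \<noteq> {}"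
    and smooth: "smooth_on S a" "smooth_on S b" "smooth_on S c"
    and a_pos: "x \<in> S \<Longrightarrow> a x > 0"
    and I: "x \<in> S \<Longrightarrow> (I has_real_derivative 1 / sqrt (a x)) (at x)"
    and B: "x \<in> S \<Longrightarrow> (B has_real_derivative b x / (2 * a x)) (at x)"
begin

definition sqrt_a :: "real \<Rightarrow> real" where "sqrt_a x = sqrt (a x)"
abbreviation J :: "real \<Rightarrow> real" where "J \<equiv> Jf a b"
abbreviation K :: "real \<Rightarrow> real" where "K \<equiv> Kf a b c"

lemma sqrt_a_pos: "x \<in> S \<Longrightarrow> sqrt_a x > 0"
  and a_eq: "x \<in> S \<Longrightarrow> a x = (sqrt_a x)\<^sup>2"
  using a_pos by (auto simp: sqrt_a_def less_imp_le)

lemma smooth_sqrt_a: "smooth_on S sqrt_a"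
  unfolding sqrt_a_def[abs_def] by (rule smooth_on_sqrt[OF S(2) smooth(1) a_pos])

lemma J_eq: "J x = deriv sqrt_a x - b x / sqrt_a x"
  by (simp add: Jf_def sqrt_a_def[abs_def])

lemma b_eq: "x \<in> S \<Longrightarrow> b x = sqrt_a x * (deriv sqrt_a x - J x)"
  using sqrt_a_pos[of x] by (simp add: J_eq)

lemma smooth_J: "smooth_on S J"
proof -
  have "smooth_on S (\<lambda>x. deriv sqrt_a x - b x / sqrt_a x)"
    using sqrt_a_pos by (intro smooth_on_diff smooth_on_divide smooth_on_deriv
      smooth_sqrt_a smooth S) force
  then show ?thesis by (simp add: J_eq[abs_def])
qed

lemma K_eq: "K x = sqrt_a x * deriv J x / 2 - (J x)\<^sup>2 / 4 + c x"
  by (simp add: Kf_def sqrt_a_def)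

lemma smooth_K: "smooth_on S K"
proof -
  have "smooth_on S (\<lambda>x. sqrt_a x * deriv J x / 2 - (J x)\<^sup>2 / 4 + c x)"
    by (intro smooth_on_intros smooth_on_deriv smooth_sqrt_a smooth_J smooth S) simp_all
  then show ?thesis by (simp add: K_eq[abs_def])
qed

lemma DERIV_I: "x \<in> S \<Longrightarrow> (I has_real_derivative 1 / sqrt_a x) (at x)"
  using I by (simp add: sqrt_a_def)

lemma smooth_I: "smooth_on S I"
proof (rule smooth_on_antiderivative[OF S(2) DERIV_I])
  show "smooth_on S (\<lambda>x. 1 / sqrt_a x)"
    using sqrt_a_pos by (intro smooth_on_divide smooth_on_const smooth_sqrt_a S) force
qed

lemma smooth_B: "smooth_on S B"
proof (rule smooth_on_antiderivative[OF S(2) B])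
  show "smooth_on S (\<lambda>x. b x / (2 * a x))"
    using a_pos by (intro smooth_on_divide smooth_on_mult smooth_on_const smooth S) force
qed

end

locale heat_reduction = parabolic +
  fixes N :: "(real \<times> real) set" and T X M :: "real \<times> real \<Rightarrow> real"
  assumes N: "open N" "N \<subseteq> UNIV \<times> S"
    and smooth_TXM: "smooth_on N T" "smooth_on N X" "smooth_on N M"
    and M_nonzero: "p \<in> N \<Longrightarrow> M p \<noteq> 0" and X_x_nonzero: "p \<in> N \<Longrightarrow> Dx X p \<noteq> 0"
    and T_x: "p \<in> N \<Longrightarrow> Dx T p = 0"
    and T_t: "p \<in> N \<Longrightarrow> Dt T p = a (snd p) * (Dx X p)\<^sup>2"
    and X_drift: "p \<in> N \<Longrightarrow> M p * parabolic_op a b (\<lambda>_. 0) X p = 2 * a (snd p) * Dx M p * Dx X p"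
    and M_solution: "p \<in> N \<Longrightarrow> parabolic_op a b c M p = 0"
begin

lemma differentiable_TXM:
  assumes "p \<in> N"
  shows "T differentiable (at p)" "X differentiable (at p)" "M differentiable (at p)"
    "Dx X differentiable (at p)" "Dx M differentiable (at p)"
  using assms N(1) smooth_TXM by (blast intro: smooth_on_imp_differentiable smooth_on_dir_deriv)+

lemma snd_in_S: "p \<in> N \<Longrightarrow> snd p \<in> S"
  using N(2) by auto

lemma open_TX_preimage: "open Om \<Longrightarrow> open (N \<inter> (\<lambda>p. (T p, X p)) -` Om)"
  using N(1) smooth_TXM by (intro continuous_open_preimage continuous_on_Pair
    smooth_on_imp_continuous_on)

lemma parabolic_op_pullback:
  assumes Om: "open Om" "smooth_on Om w" and p: "p \<in> N" "(T p, X p) \<in> Om"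
  shows "parabolic_op a b c (\<lambda>p. M p * w (T p, X p)) p
    = M p * Dt T p * parabolic_op (\<lambda>_. 1) (\<lambda>_. 0) (\<lambda>_. 0) w (T p, X p)"
proof -
  define N' where "N' = N \<inter> (\<lambda>p. (T p, X p)) -` Om"
  have N': "open N'"
    unfolding N'_def by (rule open_TX_preimage[OF Om(1)])
  have pull: "dir_deriv v (\<lambda>p. g (T p, X p)) q =
      dir_deriv v T q * Dt g (T q, X q) + dir_deriv v X q * Dx g (T q, X q)"
    "(\<lambda>p. g (T p, X p)) differentiable (at q)"
    if "smooth_on Om g" "q \<in> N'" for g :: "real \<times> real \<Rightarrow> real" and q v
    using that smooth_on_imp_differentiable[OF Om(1) that(1)]
    by (auto simp: N'_def intro!: dir_deriv_compose_Pair differentiable_compose_Pair differentiable_TXM)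
  note pull_w = pull[OF Om(2)] and pull_w_x = pull[OF smooth_on_dir_deriv[OF Om]]
  have p': "p \<in> N'"
    using p by (simp add: N'_def)
  have Wx: "Dx (\<lambda>p. M p * w (T p, X p)) q = M q * (Dx X q * Dx w (T q, X q)) + Dx M q * w (T q, X q)"
    if "q \<in> N'" for q
    using that by (simp add: N'_def dir_deriv_mult differentiable_TXM pull_w[OF that] T_x)
  have "Dx (Dx (\<lambda>p. M p * w (T p, X p))) p
      = Dx (\<lambda>q. M q * (Dx X q * Dx w (T q, X q)) + Dx M q * w (T q, X q)) p"
    by (rule dir_deriv_cong[OF N' p' Wx])
  also have "\<dots> = M p * (Dx X p)\<^sup>2 * Dx (Dx w) (T p, X p)
    + (M p * Dx (Dx X) p + 2 * Dx M p * Dx X p) * Dx w (T p, X p)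
      + Dx (Dx M) p * w (T p, X p)"
    using p by (simp add: dir_deriv_simps differentiable_TXM pull_w[OF p'] pull_w_x[OF p'] T_x
      power2_eq_square algebra_simps)
  finally have Wxx: "Dx (Dx (\<lambda>p. M p * w (T p, X p))) p
      = M p * (Dx X p)\<^sup>2 * Dx (Dx w) (T p, X p)
        + (M p * Dx (Dx X) p + 2 * Dx M p * Dx X p) * Dx w (T p, X p)
      + Dx (Dx M) p * w (T p, X p)" .
  have Wt: "Dt (\<lambda>p. M p * w (T p, X p)) p
      = M p * (Dt T p * Dt w (T p, X p) + Dt X p * Dx w (T p, X p)) + Dt M p * w (T p, X p)"
    using p by (simp add: dir_deriv_mult differentiable_TXM pull_w[OF p'])
  show ?thesis
    using X_drift[OF p(1)] M_solution[OF p(1)] unfolding parabolic_op_def Wxx Wt Wx[OF p'] T_t[OF p(1)]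
    by algebra
qed

end

context parabolic
begin

lemma smooth_on_along_snd:
  assumes "smooth_on S f" "open N" "N \<subseteq> UNIV \<times> S"
  shows "smooth_on N (\<lambda>p. f (snd p))"
  using assms by (intro smooth_on_compose[OF _ S(2) assms(1)] smooth_on_snd smooth_on_id) auto

lemma dir_deriv_along_snd:
  assumes "smooth_on S f" "snd p \<in> S"
  shows "dir_deriv v (\<lambda>p. f (snd p)) p = snd v * deriv f (snd p)"
  using dir_deriv_compose_real[where g = snd, OF smooth_on_imp_DERIV[OF S(2) assms], of v]
  by (simp add: dir_deriv_bounded_linear[OF bounded_linear_snd]
    bounded_linear_imp_differentiable[OF bounded_linear_snd])

lemma parabolic_op_of_log_derivative:
  assumes N: "open N" "N \<subseteq> UNIV \<times> S" and M: "smooth_on N M" and drift: "smooth_on N drift"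
    and M_x: "\<And>p. p \<in> N \<Longrightarrow> Dx M p = M p * (J (snd p) + drift p) / (2 * sqrt_a (snd p))" and p: "p \<in> N"
  shows "parabolic_op a b c M p
    = Dt M p - M p * (K (snd p) + (drift p)\<^sup>2 / 4 + sqrt_a (snd p) * Dx drift p / 2)"
proof -
  have x: "snd p \<in> S" and "sqrt_a (snd p) > 0"
    using p N sqrt_a_pos by auto
  have diff: "M differentiable (at p)" "drift differentiable (at p)"
    "(\<lambda>p. J (snd p)) differentiable (at p)" "(\<lambda>p. sqrt_a (snd p)) differentiable (at p)"
    using N p M drift smooth_on_along_snd[OF smooth_J] smooth_on_along_snd[OF smooth_sqrt_a]
    by (blast intro: smooth_on_imp_differentiable)+
  have "Dx (Dx M) p = Dx (\<lambda>p. M p * (J (snd p) + drift p) / (2 * sqrt_a (snd p))) p"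
    by (rule dir_deriv_cong[OF N(1) p M_x])
  also have "\<dots> =
      (M p * (deriv J (snd p) + Dx drift p) + Dx M p * (J (snd p) + drift p)) / (2 * sqrt_a (snd p))
      - M p * (J (snd p) + drift p) * deriv sqrt_a (snd p) / (2 * (sqrt_a (snd p))\<^sup>2)"
    using \<open>sqrt_a (snd p) > 0\<close> diff
    by (simp add: dir_deriv_simps dir_deriv_along_snd[OF smooth_J x]
      dir_deriv_along_snd[OF smooth_sqrt_a x]
        field_simps power2_eq_square)
  finally have M_xx: "Dx (Dx M) p = \<dots>" .
  show ?thesis
    using \<open>sqrt_a (snd p) > 0\<close> unfolding parabolic_op_def a_eq[OF x] b_eq[OF x] K_eq M_xx M_x[OF p]
    by (simp add: field_simps power2_eq_square)
qed

lemma X_drift_iff_log_derivative: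
  assumes N: "open N" "N \<subseteq> UNIV \<times> S" "p \<in> N"
    and scaling: "smooth_on N scaling" "scaling p \<noteq> 0" "Dx scaling p = 0"
    and X_x: "\<And>p. p \<in> N \<Longrightarrow> Dx X p = scaling p / sqrt_a (snd p)" and X_t: "Dt X p = scaling p * drift"
  shows "M p * parabolic_op a b (\<lambda>_. 0) X p = 2 * a (snd p) * Dx M p * Dx X p
    \<longleftrightarrow> Dx M p = M p * (J (snd p) + drift) / (2 * sqrt_a (snd p))"
proof -
  have x: "snd p \<in> S" and sqrt_a: "sqrt_a (snd p) > 0"
    using N sqrt_a_pos by auto
  have "Dx (Dx X) p = Dx (\<lambda>p. scaling p / sqrt_a (snd p)) p"
    by (rule dir_deriv_cong[OF N(1,3) X_x])
  also have "\<dots> = - scaling p * deriv sqrt_a (snd p) / (sqrt_a (snd p))\<^sup>2"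
  proof -
    have "scaling differentiable (at p)" "(\<lambda>p. sqrt_a (snd p)) differentiable (at p)"
      using N scaling(1) smooth_on_along_snd[OF smooth_sqrt_a]
      by (blast intro: smooth_on_imp_differentiable)+
    then show ?thesis
      using sqrt_a by (simp add: dir_deriv_divide dir_deriv_along_snd[OF smooth_sqrt_a x] scaling(3)
        power2_eq_square)
  qed
  finally have "parabolic_op a b (\<lambda>_. 0) X p = scaling p * (J (snd p) + drift)"
    using sqrt_a unfolding parabolic_op_def a_eq[OF x] b_eq[OF x] X_x[OF N(3)] X_t
    by (simp add: field_simps power2_eq_square)
  moreover have "2 * a (snd p) * Dx M p * Dx X p = scaling p * (2 * sqrt_a (snd p) * Dx M p)"
    using sqrt_a unfolding a_eq[OF x] X_x[OF N(3)] by (simp add: power2_eq_square)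
  ultimately have "M p * parabolic_op a b (\<lambda>_. 0) X p = 2 * a (snd p) * Dx M p * Dx X p
      \<longleftrightarrow> scaling p * (M p * (J (snd p) + drift)) = scaling p * (2 * sqrt_a (snd p) * Dx M p)"
    by (simp only: mult.left_commute)
  also have "\<dots> \<longleftrightarrow> M p * (J (snd p) + drift) = 2 * sqrt_a (snd p) * Dx M p"
    using scaling(2) by simp
  finally show ?thesis
    using sqrt_a by (auto simp: field_simps)
qed

lemma quadratic_in_I:
  assumes f: "\<And>x. x \<in> S \<Longrightarrow> (f has_real_derivative f1 x / sqrt_a x) (at x)"
    and f1: "\<And>x. x \<in> S \<Longrightarrow> (f1 has_real_derivative f2 x / sqrt_a x) (at x)"
    and f2: "\<And>x. x \<in> S \<Longrightarrow> (f2 has_real_derivative 0) (at x)"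
  shows "\<exists>c0 c1 c2. \<forall>x\<in>S. f x = c2 * (I x)\<^sup>2 + c1 * I x + c0"
proof -
  have const: "\<exists>k. \<forall>x\<in>S. g x = k" if "\<And>x. x \<in> S \<Longrightarrow> (g has_real_derivative 0) (at x)" for g
    using has_field_derivative_zero_constant[of S g] S(1) that
    by (metis has_field_derivative_at_within is_interval_convex_1)
  obtain k2 where k2: "\<forall>x\<in>S. f2 x = k2"
    using const[OF f2] by blast
  have "((\<lambda>x. f1 x - k2 * I x) has_real_derivative 0) (at x)" if "x \<in> S" for x
    using DERIV_diff[OF f1 DERIV_cmult[OF DERIV_I], OF that that, of k2] k2 that by simp
  from const[OF this] obtain k1 where k1: "\<forall>x\<in>S. f1 x = k2 * I x + k1"
    by (auto simp: diff_eq_eq add.commute)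
  have "((\<lambda>x. f x - (k2 / 2 * (I x)\<^sup>2 + k1 * I x)) has_real_derivative 0) (at x)" if "x \<in> S" for x
    using sqrt_a_pos[OF that] k1 that
    by (auto intro!: derivative_eq_intros f DERIV_I simp: field_simps)
  from const[OF this] obtain k0 where "\<forall>x\<in>S. f x = k2 / 2 * (I x)\<^sup>2 + k1 * I x + k0"
    by (auto simp: diff_eq_eq algebra_simps)
  then show ?thesis by blast
qed

end

context heat_reduction
begin

lemma smooth_on_N_differentiable: "smooth_on N f \<Longrightarrow> p \<in> N \<Longrightarrow> f differentiable (at p)"
  for f :: "real \<times> real \<Rightarrow> real"
  by (rule smooth_on_imp_differentiable[OF N(1)])

lemma Dx_Dt: "smooth_on N f \<Longrightarrow> p \<in> N \<Longrightarrow> Dx (Dt f) p = Dt (Dx f) p" for f :: "real \<times> real \<Rightarrow> real"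
  by (rule dir_deriv_commute[OF N(1)])

definition scaling :: "real \<times> real \<Rightarrow> real" where "scaling p = sqrt_a (snd p) * Dx X p"
definition drift :: "real \<times> real \<Rightarrow> real" where "drift p = Dt X p / scaling p"
definition dilation :: "real \<times> real \<Rightarrow> real" where "dilation p = Dt scaling p / scaling p"

lemma sqrt_a_N: "p \<in> N \<Longrightarrow> sqrt_a (snd p) > 0"
  using sqrt_a_pos snd_in_S by blast

lemma scaling_nonzero: "p \<in> N \<Longrightarrow> scaling p \<noteq> 0"
  using sqrt_a_N X_x_nonzero by (fastforce simp: scaling_def)

lemma smooth_sqrt_a_N: "smooth_on N (\<lambda>p. sqrt_a (snd p))"
  by (rule smooth_on_along_snd[OF smooth_sqrt_a N])

lemma smooth_scaling: "smooth_on N scaling"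
  unfolding scaling_def[abs_def]
  by (intro smooth_on_mult smooth_sqrt_a_N smooth_on_dir_deriv smooth_TXM N)

lemma smooth_drift: "smooth_on N drift"
  unfolding drift_def[abs_def] by (intro smooth_on_divide smooth_scaling smooth_on_dir_deriv
    smooth_TXM N scaling_nonzero)

lemma smooth_dilation: "smooth_on N dilation"
  unfolding dilation_def[abs_def]
  by (intro smooth_on_divide smooth_scaling smooth_on_dir_deriv N scaling_nonzero)

lemma X_x_eq: "p \<in> N \<Longrightarrow> Dx X p = scaling p / sqrt_a (snd p)"
  using sqrt_a_N[of p] by (simp add: scaling_def)

lemma X_t_eq: "p \<in> N \<Longrightarrow> Dt X p = scaling p * drift p"
  using scaling_nonzero[of p] by (simp add: drift_def)

lemma scaling_t: "p \<in> N \<Longrightarrow> Dt scaling p = scaling p * dilation p"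
  using scaling_nonzero[of p] by (simp add: dilation_def)

lemma Dx_Dt_eq_0:
  fixes f :: "real \<times> real \<Rightarrow> real"
  assumes "smooth_on N f" "\<And>p. p \<in> N \<Longrightarrow> Dx f p = 0" "p \<in> N"
  shows "Dx (Dt f) p = 0"
proof -
  have "Dx (Dt f) p = Dt (Dx f) p"
    by (rule Dx_Dt[OF assms(1,3)])
  also have "\<dots> = Dt (\<lambda>_. 0) p"
    by (rule dir_deriv_cong[OF N(1) assms(3,2)])
  finally show ?thesis by (simp add: dir_deriv_const)
qed

lemma scaling_x: assumes "p \<in> N" shows "Dx scaling p = 0"
proof -
  have "Dt T q = (scaling q)\<^sup>2" if "q \<in> N" for q
    using T_t[OF that] a_eq[OF snd_in_S[OF that]] by (simp add: scaling_def power_mult_distrib)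
  then have "Dx (Dt T) p = Dx (\<lambda>q. (scaling q)\<^sup>2) p"
    by (rule dir_deriv_cong[OF N(1) assms])
  also have "\<dots> = 2 * Dx scaling p * scaling p"
    by (simp add: dir_deriv_power smooth_on_N_differentiable[OF smooth_scaling assms])
  finally show ?thesis
    using Dx_Dt_eq_0[OF smooth_TXM(1) T_x assms] scaling_nonzero[OF assms] by simp
qed

lemma drift_x: assumes "p \<in> N" shows "Dx drift p = dilation p / sqrt_a (snd p)"
proof -
  note diff = smooth_on_N_differentiable[OF _ assms]
  have "scaling p * Dx drift p = Dx (\<lambda>p. scaling p * drift p) p"
    by (simp add: dir_deriv_mult diff smooth_scaling smooth_drift scaling_x assms)
  also have "\<dots> = Dx (Dt X) p"
    by (rule dir_deriv_cong[OF N(1) assms]) (simp add: X_t_eq)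
  also have "\<dots> = Dt (Dx X) p"
    by (rule Dx_Dt[OF smooth_TXM(2) assms])
  also have "\<dots> = Dt (\<lambda>p. scaling p / sqrt_a (snd p)) p"
    by (rule dir_deriv_cong[OF N(1) assms X_x_eq])
  also have "\<dots> = scaling p * (dilation p / sqrt_a (snd p))"
    using sqrt_a_N[OF assms]
    by (simp add: dir_deriv_divide diff smooth_scaling smooth_sqrt_a_N
      dir_deriv_along_snd[OF smooth_sqrt_a snd_in_S[OF assms]] scaling_t assms)
  finally show ?thesis
    using scaling_nonzero[OF assms] sqrt_a_N[OF assms] by (simp add: field_simps)
qed

lemma dilation_x: assumes "p \<in> N" shows "Dx dilation p = 0"
  unfolding dilation_def[abs_def]
  using Dx_Dt_eq_0[OF smooth_scaling scaling_x assms] scaling_x[OF assms]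
  scaling_nonzero[OF assms] assms
  by (simp add: dir_deriv_divide smooth_on_N_differentiable smooth_scaling smooth_on_dir_deriv N)

lemma M_x: assumes "p \<in> N" shows "Dx M p = M p * (J (snd p) + drift p) / (2 * sqrt_a (snd p))"
  using X_drift_iff_log_derivative[OF N assms smooth_scaling scaling_nonzero[OF assms]
    scaling_x[OF assms] X_x_eq X_t_eq[OF assms]]
    X_drift[OF assms] by blast

lemma M_t: assumes "p \<in> N" shows "Dt M p = M p * (K (snd p) + (drift p)\<^sup>2 / 4 + dilation p / 2)"
  using parabolic_op_of_log_derivative[OF N smooth_TXM(3) smooth_drift M_x assms] M_solution[OF assms]
    drift_x[OF assms] sqrt_a_N[OF assms] by simp

lemma K_x:
  assumes "p \<in> N"
  shows "deriv K (snd p) = ((Dt drift p - drift p * dilation p) / 2) / sqrt_a (snd p)"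
proof -
  note diff = smooth_on_N_differentiable[OF _ assms] and x = snd_in_S[OF assms]
    and sqrt_a = sqrt_a_N[OF assms]
  note along = smooth_on_along_snd[OF smooth_J N] smooth_on_along_snd[OF smooth_K N] smooth_sqrt_a_N
    dir_deriv_along_snd[OF smooth_J x] dir_deriv_along_snd[OF smooth_K x]
    dir_deriv_along_snd[OF smooth_sqrt_a x]
  have "Dt (Dx M) p = Dt (\<lambda>p. M p * (J (snd p) + drift p) / (2 * sqrt_a (snd p))) p"
    by (rule dir_deriv_cong[OF N(1) assms M_x])
  also have "\<dots> = Dt M p * ((J (snd p) + drift p) / (2 * sqrt_a (snd p)))
    + M p * (Dt drift p / (2 * sqrt_a (snd p)))"
    using sqrt_a by (simp add: dir_deriv_simps diff smooth_TXM smooth_drift along field_simps)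
  finally have M_xt: "Dt (Dx M) p = \<dots>" .
  have "Dx (Dt M) p = Dx (\<lambda>p. M p * (K (snd p) + (drift p)\<^sup>2 / 4 + dilation p / 2)) p"
    by (rule dir_deriv_cong[OF N(1) assms M_t])
  also have "\<dots> = Dx M p * (K (snd p) + (drift p)\<^sup>2 / 4 + dilation p / 2)
    + M p * (deriv K (snd p) + drift p * (dilation p / sqrt_a (snd p)) / 2)"
    by (simp add: dir_deriv_simps diff smooth_TXM smooth_drift smooth_dilation along drift_x
      dilation_x assms mult_ac)
  finally have M_tx: "Dx (Dt M) p = \<dots>" .
  have "M p * (Dt drift p / (2 * sqrt_a (snd p)))
    = M p * (deriv K (snd p) + drift p * (dilation p / sqrt_a (snd p)) / 2)"
    using Dx_Dt[OF smooth_TXM(3) assms] unfolding M_xt M_tx M_x[OF assms] M_t[OF assms]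
    by (simp add: mult_ac)
  then have "Dt drift p / (2 * sqrt_a (snd p)) =
      deriv K (snd p) + drift p * (dilation p / sqrt_a (snd p)) / 2"
    using mult_left_cancel[OF M_nonzero[OF assms]] by blast
  then show ?thesis
    using sqrt_a by (simp add: field_simps)
qed

lemma DERIV_section: "smooth_on N f \<Longrightarrow> (t, x) \<in> N \<Longrightarrow>
  ((\<lambda>x. f (t, x)) has_real_derivative Dx f (t, x)) (at x)"
  for f :: "real \<times> real \<Rightarrow> real"
  using smooth_on_has_dir_deriv[OF N(1), of f "(t, 0)" x "(0, 1)"] by simp

theorem K_quadratic:
  assumes section_N: "\<And>x. x \<in> S \<Longrightarrow> (t, x) \<in> N"
  shows "\<exists>c0 c1 c2. \<forall>x\<in>S. K x = c2 * (I x)\<^sup>2 + c1 * I x + c0"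
proof (rule quadratic_in_I)
  define k1 where "k1 p = (Dt drift p - drift p * dilation p) / 2" for p
  define k2 where "k2 p = (Dt dilation p - (dilation p)\<^sup>2) / 2" for p
  have smooth_k: "smooth_on N k1" "smooth_on N k2"
    unfolding k1_def k2_def by (auto
      intro!: smooth_on_intros smooth_on_dir_deriv smooth_drift smooth_dilation N)
  fix x
  assume x: "x \<in> S"
  let ?p = "(t, x)"
  have p: "?p \<in> N" and sqrt_a: "sqrt_a x > 0"
    using section_N x sqrt_a_pos by auto
  note diff = smooth_on_N_differentiable[OF _ p]
  show "(K has_real_derivative k1 ?p / sqrt_a x) (at x)"
    using smooth_on_imp_DERIV[OF S(2) smooth_K x] K_x[OF p] by (simp add: k1_def)
  have "Dx (Dt drift) ?p = Dt (Dx drift) ?p"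
    by (rule Dx_Dt[OF smooth_drift p])
  also have "\<dots> = Dt (\<lambda>p. dilation p / sqrt_a (snd p)) ?p"
    by (rule dir_deriv_cong[OF N(1) p drift_x])
  also have "\<dots> = Dt dilation ?p / sqrt_a x"
    using sqrt_a dir_deriv_along_snd[OF smooth_sqrt_a, of ?p] x
    by (simp add: dir_deriv_divide diff smooth_dilation smooth_sqrt_a_N)
  finally have "Dx k1 ?p = k2 ?p / sqrt_a x"
    unfolding k1_def k2_def
    by (simp add: dir_deriv_simps diff smooth_drift smooth_dilation smooth_on_mult smooth_on_diff
      smooth_on_dir_deriv N drift_x[OF p] dilation_x[OF p]
        power2_eq_square diff_divide_distrib)
  then show "((\<lambda>x. k1 (t, x)) has_real_derivative k2 ?p / sqrt_a x) (at x)"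
    using DERIV_section[OF smooth_k(1) p] by simp
  have "Dx k2 ?p = 0"
    unfolding k2_def
    by (simp add: dir_deriv_simps diff smooth_dilation smooth_on_power smooth_on_diff
      smooth_on_dir_deriv N dilation_x[OF p]
        Dx_Dt_eq_0[OF smooth_dilation dilation_x p])
  then show "((\<lambda>x. k2 (t, x)) has_real_derivative 0) (at x)"
    using DERIV_section[OF smooth_k(2) p] by simp
qed

end

context heat_reduction
begin

definition \<Phi> :: "real \<times> real \<times> real \<Rightarrow> real \<times> real \<times> real" where
  "\<Phi> = (\<lambda>(t, x, u). (T (t, x), X (t, x), u / M (t, x)))"

lemma T_t_nonzero: "p \<in> N \<Longrightarrow> Dt T p \<noteq> 0"
  using T_t[of p] X_x_nonzero[of p] a_pos[OF snd_in_S, of p] by simp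

lemma solution_iff_heat_solution:
  assumes N': "open N'" "N' \<subseteq> N" "p \<in> N'"
    and w: "open Om" "smooth_on Om (\<lambda>k. w (fst k) (snd k))"
    and u: "\<And>q. q \<in> N' \<Longrightarrow> (T q, X q) \<in> Om \<and> u (fst q) (snd q) = M q * w (T q) (X q)"
  shows "parabolic_op a b c (\<lambda>q. u (fst q) (snd q)) p = 0
    \<longleftrightarrow> parabolic_op (\<lambda>_. 1) (\<lambda>_. 0) (\<lambda>_. 0) (\<lambda>k. w (fst k) (snd k)) (T p, X p) = 0"
proof -
  have p: "p \<in> N"
    using N' by blast
  have "parabolic_op a b c (\<lambda>q. u (fst q) (snd q)) p = parabolic_op a b c (\<lambda>q. M q * w (T q) (X q)) p"
    by (rule parabolic_op_cong[OF N'(1,3)]) (simp add: u)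
  also have "\<dots> = M p * Dt T p * parabolic_op (\<lambda>_. 1) (\<lambda>_. 0) (\<lambda>_. 0) (\<lambda>k. w (fst k) (snd k)) (T p, X p)"
    using parabolic_op_pullback[OF w p] u[OF N'(3)] by simp
  finally show ?thesis
    using M_nonzero[OF p] T_t_nonzero[OF p] by simp
qed

lemma inj_on_\<Phi>:
  assumes "inj_on (\<lambda>p. (T p, X p)) N"
  shows "inj_on \<Phi> {(t, x, u). (t, x) \<in> N}"
proof (rule inj_onI)
  fix k k'
  assume k: "k \<in> {(t, x, u). (t, x) \<in> N}" "k' \<in> {(t, x, u). (t, x) \<in> N}" and eq: "\<Phi> k = \<Phi> k'"
  obtain t x u t' x' u' where components: "k = (t, x, u)" "k' = (t', x', u')"
    by (metis prod_cases3)
  then have "(t, x) = (t', x')"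
    using inj_onD[OF assms, of "(t, x)" "(t', x')"] k eq by (simp add: \<Phi>_def)
  then show "k = k'"
    using components k eq M_nonzero by (auto simp: \<Phi>_def)
qed

lemma graph_subset_iff: "graph u Om \<subseteq> {(t, x, k). (t, x) \<in> N} \<longleftrightarrow> Om \<subseteq> N"
  by (auto simp: graph_def)

lemma graph_subset_\<Phi>_imageE:
  assumes "graph w Om' \<subseteq> \<Phi> ` graph u Om" "k \<in> Om'"
  obtains p where "p \<in> Om" "k = (T p, X p)" "w (fst k) (snd k) = u (fst p) (snd p) / M p"
proof -
  have "(fst k, snd k, w (fst k) (snd k)) \<in> \<Phi> ` graph u Om"
    using assms by (auto simp: graph_def)
  then obtain t x where "(t, x) \<in> Om" "(fst k, snd k, w (fst k) (snd k)) = \<Phi> (t, x, u t x)"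
    by (auto simp: graph_def)
  then show thesis
    by (intro that[of "(t, x)"]) (auto simp: \<Phi>_def prod_eq_iff)
qed

lemma maps_solutions_to_heat:
  assumes inj: "inj_on (\<lambda>p. (T p, X p)) N"
  shows "maps_solutions (lsol a b c S) heatsol \<Phi> {(t, x, u). (t, x) \<in> N}"
  unfolding maps_solutions_def graph_subset_iff
proof (intro allI impI, elim conjE)
  fix Om u Om' w
  assume u: "lsol a b c S Om u" and Om: "Om \<subseteq> N" and Om': "open Om'"
    and w: "smooth_on Om' (\<lambda>k. w (fst k) (snd k))" and sub: "graph w Om' \<subseteq> \<Phi> ` graph u Om"
  note preimage = graph_subset_\<Phi>_imageE[OF sub]
  define N' where "N' = N \<inter> (\<lambda>p. (T p, X p)) -` Om'"
  have N': "open N'"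
    unfolding N'_def by (rule open_TX_preimage[OF Om'])
  have pulled_back: "(T q, X q) \<in> Om' \<and> u (fst q) (snd q) = M q * w (T q) (X q)" if "q \<in> N'" for q
  proof -
    have q: "q \<in> N" "(T q, X q) \<in> Om'"
      using that by (auto simp: N'_def)
    then obtain p where p: "p \<in> Om" "(T q, X q) = (T p, X p)" "w (T q) (X q) = u (fst p) (snd p) / M p"
      using preimage[OF q(2)] by auto
    then have "q = p"
      using inj_onD[OF inj, of q p] q Om by auto
    then show ?thesis
      using p q M_nonzero by simp
  qed
  have "parabolic_op (\<lambda>_. 1) (\<lambda>_. 0) (\<lambda>_. 0) (\<lambda>k. w (fst k) (snd k)) k = 0" if k: "k \<in> Om'" for k
  proof -
    obtain p where p: "p \<in> Om" "k = (T p, X p)"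
      using preimage[OF k] by blast
    then have "p \<in> N'"
      using Om k by (auto simp: N'_def)
    moreover have "parabolic_op a b c (\<lambda>q. u (fst q) (snd q)) p = 0"
      using u p(1) by (simp add: lsol_iff_parabolic_op)
    ultimately show ?thesis
      using solution_iff_heat_solution[OF N' _ _ Om' w pulled_back] p(2) by (simp add: N'_def)
  qed
  then show "heatsol Om' w"
    using Om' w by (simp add: heatsol_def lsol_iff_parabolic_op)
qed

lemma maps_solutions_from_heat:
  "maps_solutions heatsol (lsol a b c S) (inv_into {(t, x, u). (t, x) \<in> N} \<Phi>)
    (\<Phi> ` {(t, x, u). (t, x) \<in> N})"
  unfolding maps_solutions_def
proof (intro allI impI, elim conjE)
  let ?D = "{(t, x, u :: real). (t, x) \<in> N}"
  fix Om w Om' u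
  assume w: "heatsol Om w" and gr: "graph w Om \<subseteq> \<Phi> ` ?D"
    and Om': "open Om'" and u: "smooth_on Om' (\<lambda>p. u (fst p) (snd p))"
    and sub: "graph u Om' \<subseteq> inv_into ?D \<Phi> ` graph w Om"
  have pulled_back: "p \<in> N \<and> (T p, X p) \<in> Om \<and> u (fst p) (snd p) = M p * w (T p) (X p)"
    if p: "p \<in> Om'" for p
  proof -
    have "(fst p, snd p, u (fst p) (snd p)) \<in> inv_into ?D \<Phi> ` graph w Om"
      using sub p by (auto simp: graph_def)
    then obtain k where k: "k \<in> graph w Om" "(fst p, snd p, u (fst p) (snd p)) = inv_into ?D \<Phi> k"
      by blast
    moreover from this(1) have "k \<in> \<Phi> ` ?D"
      using gr by blast
    ultimately have "\<Phi> (fst p, snd p, u (fst p) (snd p)) = k" "(fst p, snd p, u (fst p) (snd p)) \<in> ?D"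
      by (simp_all only: f_inv_into_f inv_into_into)
    then show ?thesis
      using k(1) M_nonzero[of p] by (auto simp: graph_def \<Phi>_def field_simps)
  qed
  have "parabolic_op a b c (\<lambda>p. u (fst p) (snd p)) p = 0" if p: "p \<in> Om'" for p
  proof (subst solution_iff_heat_solution[OF Om' _ p, of Om])
    show "parabolic_op (\<lambda>_. 1) (\<lambda>_. 0) (\<lambda>_. 0) (\<lambda>k. w (fst k) (snd k)) (T p, X p) = 0"
      using w pulled_back[OF p] by (simp add: heatsol_def lsol_iff_parabolic_op)
  qed (use w pulled_back in \<open>auto simp: heatsol_def lsol_iff_parabolic_op\<close>)
  moreover have "Om' \<subseteq> UNIV \<times> S"
    using pulled_back N(2) by blast
  ultimately show "lsol a b c S Om' u"
    using Om' u by (simp add: lsol_iff_parabolic_op)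
qed

end

section \<open>The explicit transformation\<close>

definition has_schwarzian_on :: "(real \<Rightarrow> real) \<Rightarrow> real \<Rightarrow> real set \<Rightarrow> bool" where
  "has_schwarzian_on T k A \<longleftrightarrow> (\<forall>t\<in>A. T differentiable (at t) \<and> deriv T differentiable (at t) \<and>
     deriv (deriv T) differentiable (at t) \<and> deriv T t > 0 \<and> schwarzian T t = k)"

definition forced_oscillation_on :: "(real \<Rightarrow> real) \<Rightarrow> real \<Rightarrow> real \<Rightarrow> real set \<Rightarrow> bool" where
  "forced_oscillation_on \<omega> k f A \<longleftrightarrow> (\<forall>t\<in>A. \<omega> differentiable (at t) \<and> deriv \<omega> differentiable (at t) \<and>
     deriv (deriv \<omega>) t + k * \<omega> t = f)"

locale heat_transformation = parabolic +
  fixes c0 c1 c2 :: real and A :: "real set" and T \<omega> W :: "real \<Rightarrow> real" and C :: real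
  assumes K_quadratic: "x \<in> S \<Longrightarrow> Kf a b c x = c2 * (I x)\<^sup>2 + c1 * I x + c0"
    and A: "is_interval A" "open A" "A \<noteq> {}"
    and T: "has_schwarzian_on T (8 * c2) A"
    and \<omega>: "forced_oscillation_on \<omega> (4 * c2) (2 * c1) A"
    and W: "t \<in> A \<Longrightarrow> (W has_real_derivative (c2 * (\<omega> t)\<^sup>2 - 1/4 * (deriv \<omega> t)\<^sup>2 - c0)) (at t)"
    and C: "C \<noteq> 0"
begin

definition pre_schwarzian :: "real \<Rightarrow> real" where "pre_schwarzian t = deriv (deriv T) t / deriv T t"

lemma deriv_T_pos: "t \<in> A \<Longrightarrow> deriv T t > 0"
  using T by (simp add: has_schwarzian_on_def)

lemma DERIV_T: "t \<in> A \<Longrightarrow> (T has_real_derivative deriv T t) (at t)"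
  and DERIV_deriv_T: "t \<in> A \<Longrightarrow> (deriv T has_real_derivative pre_schwarzian t * deriv T t) (at t)"
  using T deriv_T_pos[of t]
  by (auto simp: has_schwarzian_on_def pre_schwarzian_def DERIV_deriv_iff_real_differentiable)

lemma DERIV_pre_schwarzian:
  assumes t: "t \<in> A"
  shows "(pre_schwarzian has_real_derivative (pre_schwarzian t)\<^sup>2 / 2 + 8 * c2) (at t)"
proof -
  have deriv2_T: "(deriv (deriv T) has_real_derivative deriv (deriv (deriv T)) t) (at t)"
    using T t by (simp add: has_schwarzian_on_def DERIV_deriv_iff_real_differentiable)
  have "deriv (deriv (deriv T)) t / deriv T t - 3/2 * (pre_schwarzian t)\<^sup>2 = 8 * c2"
    using T t by (simp add: has_schwarzian_on_def schwarzian_def pre_schwarzian_def)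
  then have Schwarzian: "deriv (deriv (deriv T)) t / deriv T t = 8 * c2 + 3/2 * (pre_schwarzian t)\<^sup>2"
    by simp
  have "(pre_schwarzian has_real_derivative
      deriv (deriv (deriv T)) t / deriv T t - (pre_schwarzian t)\<^sup>2) (at t)"
    unfolding pre_schwarzian_def[abs_def] using deriv_T_pos[OF t]
    by (auto intro!: derivative_eq_intros DERIV_deriv_T deriv2_T t
      simp: pre_schwarzian_def field_simps power2_eq_square)
  then show ?thesis
    by (rule DERIV_cong) (simp add: Schwarzian)
qed

lemma smooth_pre_schwarzian: "smooth_on A pre_schwarzian"
proof (rule smooth_on_real_bootstrap[OF A(2)])
  show "(pre_schwarzian has_real_derivative
      pre_schwarzian t * pre_schwarzian t * (1/2) + 8 * c2) (at t)" if "t \<in> A" for t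
    using DERIV_pre_schwarzian[OF that] by (simp add: power2_eq_square)
qed (intro Ck_on_add Ck_on_mult Ck_on_const)

lemma smooth_deriv_T: "smooth_on A (deriv T)"
  using smooth_pre_schwarzian A(2) by (intro smooth_on_real_bootstrap[OF A(2) DERIV_deriv_T] Ck_on_mult)
    (auto simp: smooth_on_iff_Ck_on)

lemma smooth_T: "smooth_on A T"
  by (rule smooth_on_antiderivative[OF A(2) DERIV_T smooth_deriv_T])

lemma DERIV_\<omega>: "t \<in> A \<Longrightarrow> (\<omega> has_real_derivative deriv \<omega> t) (at t)"
  using \<omega> by (auto simp: forced_oscillation_on_def DERIV_deriv_iff_real_differentiable)

lemma DERIV_deriv_\<omega>:
  assumes "t \<in> A"
  shows "(deriv \<omega> has_real_derivative 2 * c1 - 4 * c2 * \<omega> t) (at t)"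
proof -
  have "(deriv \<omega> has_real_derivative deriv (deriv \<omega>) t) (at t)"
    "deriv (deriv \<omega>) t + 4 * c2 * \<omega> t = 2 * c1"
    using \<omega> assms by (auto simp: forced_oscillation_on_def DERIV_deriv_iff_real_differentiable)
  then show ?thesis
    by (elim DERIV_cong) linarith
qed

lemma smooth_\<omega>: "smooth_on A \<omega>"
proof (rule smooth_on_real_bootstrap[OF A(2) DERIV_\<omega>])
  fix k
  assume "Ck_on k A \<omega>"
  then have "Ck_on k A (\<lambda>t. 2 * c1 + (- 4 * c2) * \<omega> t)"
    by (intro Ck_on_add Ck_on_mult Ck_on_const)
  then have "Ck_on (Suc k) A (deriv \<omega>)"
    using DERIV_deriv_\<omega> by (intro Ck_on_real_SucI) auto
  then show "Ck_on k A (deriv \<omega>)"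
    by (rule Ck_on_SucD)
qed

lemma smooth_deriv_\<omega>: "smooth_on A (deriv \<omega>)"
  by (rule smooth_on_deriv[OF A(2) smooth_\<omega>])

lemma smooth_W: "smooth_on A W"
  by (rule smooth_on_antiderivative[OF A(2) W], assumption)
     (intro smooth_on_diff smooth_on_mult smooth_on_power smooth_on_const smooth_\<omega> smooth_deriv_\<omega> A)

definition scalingf :: "real \<Rightarrow> real" where "scalingf t = sqrt (deriv T t)"

lemma scalingf_pos: "t \<in> A \<Longrightarrow> scalingf t > 0"
  and scalingf_sq: "t \<in> A \<Longrightarrow> (scalingf t)\<^sup>2 = deriv T t"
  using deriv_T_pos by (auto simp: scalingf_def less_imp_le)

lemma smooth_scalingf: "smooth_on A scalingf"
  unfolding scalingf_def[abs_def] by (rule smooth_on_sqrt[OF A(2) smooth_deriv_T deriv_T_pos])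

lemma DERIV_scalingf:
  assumes t: "t \<in> A"
  shows "(scalingf has_real_derivative scalingf t * pre_schwarzian t / 2) (at t)"
proof -
  have "(scalingf has_real_derivative pre_schwarzian t * deriv T t * (inverse (scalingf t) / 2)) (at t)"
    unfolding scalingf_def[abs_def]
    by (rule DERIV_cong[OF DERIV_chain2[OF DERIV_real_sqrt[OF deriv_T_pos[OF t]]
      DERIV_deriv_T[OF t]]]) simp
  then show ?thesis
    by (rule DERIV_cong) (use scalingf_pos[OF t] scalingf_sq[OF t] in
      \<open>simp add: field_simps power2_eq_square\<close>)
qed

definition Xf :: "real \<times> real \<Rightarrow> real" where "Xf p = scalingf (fst p) * (I (snd p) + \<omega> (fst p))"

definition Mf :: "real \<times> real \<Rightarrow> real" where
  "Mf p = C * (deriv T (fst p) * a (snd p)) powr (1/4) *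
     exp (- B (snd p) + pre_schwarzian (fst p) / 8 * (I (snd p) + \<omega> (fst p))\<^sup>2
       + deriv \<omega> (fst p) * I (snd p) / 2 - W (fst p))"

definition driftf :: "real \<times> real \<Rightarrow> real" where
  "driftf p = pre_schwarzian (fst p) * (I (snd p) + \<omega> (fst p)) / 2 + deriv \<omega> (fst p)"

lemma DERIV_Xf_x: "x \<in> S \<Longrightarrow> ((\<lambda>x. Xf (t, x)) has_real_derivative scalingf t / sqrt_a x) (at x)"
  unfolding Xf_def by (auto intro!: derivative_eq_intros DERIV_I)

lemma DERIV_Xf_t: "t \<in> A \<Longrightarrow> ((\<lambda>t. Xf (t, x)) has_real_derivative scalingf t * driftf (t, x)) (at t)"
  unfolding Xf_def by (auto intro!: derivative_eq_intros DERIV_scalingf DERIV_\<omega>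
    simp: driftf_def field_simps)

lemma DERIV_driftf_x:
  "x \<in> S \<Longrightarrow> ((\<lambda>x. driftf (t, x)) has_real_derivative pre_schwarzian t / (2 * sqrt_a x)) (at x)"
  unfolding driftf_def by (auto intro!: derivative_eq_intros DERIV_I)

definition lnMf :: "real \<times> real \<Rightarrow> real" where
  "lnMf p = (ln (deriv T (fst p)) + ln (a (snd p))) / 4 - B (snd p)
    + pre_schwarzian (fst p) / 8 * (I (snd p) + \<omega> (fst p))\<^sup>2
      + deriv \<omega> (fst p) * I (snd p) / 2 - W (fst p)"

lemma Mf_eq_exp:
  assumes "t \<in> A" "x \<in> S"
  shows "Mf (t, x) = C * exp (lnMf (t, x))"
  using deriv_T_pos[OF assms(1)] a_pos[OF assms(2)]
  by (simp add: Mf_def lnMf_def powr_def ln_mult mult.assoc add_divide_distrib flip: exp_add)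

lemma DERIV_lnMf_x:
  assumes x: "x \<in> S"
  shows "((\<lambda>x. lnMf (t, x)) has_real_derivative (J x + driftf (t, x)) / (2 * sqrt_a x)) (at x)"
proof -
  have "((\<lambda>x. (sqrt_a x)\<^sup>2) has_real_derivative 2 * sqrt_a x * deriv sqrt_a x) (at x)"
    by (auto intro!: derivative_eq_intros smooth_on_imp_DERIV[OF S(2) smooth_sqrt_a x])
  then have "(a has_real_derivative 2 * sqrt_a x * deriv sqrt_a x) (at x)"
    by (rule has_field_derivative_transform_within_open[OF _ S(2) x]) (simp add: a_eq)
  then have "((\<lambda>x. lnMf (t, x)) has_real_derivative
      2 * sqrt_a x * deriv sqrt_a x / a x / 4 - b x / (2 * a x)
      + pre_schwarzian t / 8 * (2 * (I x + \<omega> t) * (1 / sqrt_a x))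
        + deriv \<omega> t * (1 / sqrt_a x) / 2) (at x)"
    unfolding lnMf_def using a_pos[OF x] by (auto intro!: derivative_eq_intros B DERIV_I x)
  then show ?thesis
    by (rule DERIV_cong) (use sqrt_a_pos[OF x] in
      \<open>simp add: a_eq[OF x] b_eq[OF x] driftf_def field_simps power2_eq_square\<close>)
qed

lemma DERIV_lnMf_t:
  assumes t: "t \<in> A" and x: "x \<in> S"
  shows "((\<lambda>t. lnMf (t, x)) has_real_derivative
    K x + (driftf (t, x))\<^sup>2 / 4 + pre_schwarzian t / 4) (at t)"
proof -
  have "((\<lambda>t. lnMf (t, x)) has_real_derivative
      pre_schwarzian t / 4 + ((pre_schwarzian t)\<^sup>2 / 2 + 8 * c2) / 8 * (I x + \<omega> t)\<^sup>2
      + pre_schwarzian t / 8 * (2 * (I x + \<omega> t) * deriv \<omega> t) + (2 * c1 - 4 * c2 * \<omega> t) * I x / 2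
      - (c2 * (\<omega> t)\<^sup>2 - 1/4 * (deriv \<omega> t)\<^sup>2 - c0)) (at t)"
    unfolding lnMf_def using deriv_T_pos[OF t]
    by (auto intro!: derivative_eq_intros DERIV_deriv_T DERIV_pre_schwarzian DERIV_\<omega> DERIV_deriv_\<omega> W
      t simp: field_simps)
  then show ?thesis
    by (rule DERIV_cong) (simp add: K_quadratic[OF x] driftf_def field_simps power2_eq_square)
qed

lemma DERIV_Mf_x:
  assumes "t \<in> A" "x \<in> S"
  shows "((\<lambda>x. Mf (t, x)) has_real_derivative
      Mf (t, x) * (J x + driftf (t, x)) / (2 * sqrt_a x)) (at x)"
proof (rule has_field_derivative_transform_within_open[OF _ S(2) assms(2)])
  show "((\<lambda>x. C * exp (lnMf (t, x))) has_real_derivative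
      Mf (t, x) * (J x + driftf (t, x)) / (2 * sqrt_a x)) (at x)"
    by (auto intro!: derivative_eq_intros DERIV_lnMf_x assms simp: Mf_eq_exp[OF assms])
qed (simp add: Mf_eq_exp assms(1))

lemma DERIV_Mf_t:
  assumes "t \<in> A" "x \<in> S"
  shows "((\<lambda>t. Mf (t, x)) has_real_derivative
      Mf (t, x) * (K x + (driftf (t, x))\<^sup>2 / 4 + pre_schwarzian t / 4)) (at t)"
proof (rule has_field_derivative_transform_within_open[OF _ A(2) assms(1)])
  show "((\<lambda>t. C * exp (lnMf (t, x))) has_real_derivative
      Mf (t, x) * (K x + (driftf (t, x))\<^sup>2 / 4 + pre_schwarzian t / 4)) (at t)"
    by (auto intro!: derivative_eq_intros DERIV_lnMf_t assms simp: Mf_eq_exp[OF assms])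
qed (simp add: Mf_eq_exp assms(2))

abbreviation N :: "(real \<times> real) set" where "N \<equiv> A \<times> S"

lemma open_N: "open N"
  using A S by (intro open_Times)

lemma smooth_along:
  assumes U: "open U" and \<tau>: "smooth_on U \<tau>" "\<tau> ` U \<subseteq> A" and \<xi>: "smooth_on U \<xi>" "\<xi> ` U \<subseteq> S"
  shows "smooth_on U (\<lambda>p. T (\<tau> p))" "smooth_on U (\<lambda>p. Xf (\<tau> p, \<xi> p))" "smooth_on U (\<lambda>p. Mf (\<tau> p, \<xi> p))"
    "smooth_on U (\<lambda>p. driftf (\<tau> p, \<xi> p))" "smooth_on U (\<lambda>p. scalingf (\<tau> p))"
proof -
  note along_\<tau> = smooth_on_compose[OF U A(2) _ \<tau>] and along_\<xi> = smooth_on_compose[OF U S(2) _ \<xi>]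
  note along = along_\<tau>[OF smooth_T] along_\<tau>[OF smooth_deriv_T] along_\<tau>[OF smooth_scalingf]
    along_\<tau>[OF smooth_\<omega>]
    along_\<tau>[OF smooth_deriv_\<omega>] along_\<tau>[OF smooth_pre_schwarzian] along_\<tau>[OF smooth_W]
    along_\<xi>[OF smooth_I] along_\<xi>[OF smooth_B]
    along_\<xi>[OF smooth(1)]
  show "smooth_on U (\<lambda>p. T (\<tau> p))" "smooth_on U (\<lambda>p. scalingf (\<tau> p))"
    by (rule along)+
  show "smooth_on U (\<lambda>p. Xf (\<tau> p, \<xi> p))" "smooth_on U (\<lambda>p. driftf (\<tau> p, \<xi> p))"
    unfolding Xf_def driftf_def by (auto intro!: smooth_on_intros along U)
  show "smooth_on U (\<lambda>p. Mf (\<tau> p, \<xi> p))"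
    unfolding Mf_def using \<tau>(2) \<xi>(2) deriv_T_pos a_pos
    by (auto intro!: smooth_on_intros along U mult_pos_pos)
qed

sublocale heat_reduction a b c I B S N "\<lambda>p. T (fst p)" Xf Mf
proof
  note smooth_N = smooth_along[OF open_N smooth_on_fst[OF smooth_on_id[OF open_N]] _
    smooth_on_snd[OF smooth_on_id[OF open_N]]]
  have scalingf_x: "Dx (\<lambda>p. scalingf (fst p)) p = 0" for p
    by (cases p) (auto intro: Dx_eqI)
  show "open N"
    by (rule open_N)
  show "N \<subseteq> UNIV \<times> S"
    by auto
  show smooth_Mf: "smooth_on N Mf" and "smooth_on N (\<lambda>p. T (fst p))" "smooth_on N Xf"
    using smooth_N by auto
  have smooth_driftf: "smooth_on N driftf"
    using smooth_N by auto
  fix p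
  assume "p \<in> N"
  then obtain t x where p: "p = (t, x)" "t \<in> A" "x \<in> S"
    by blast
  show "Mf p \<noteq> 0"
    using C by (simp add: p Mf_eq_exp)
  show "Dx (\<lambda>p. T (fst p)) p = 0"
    unfolding p by (auto intro: Dx_eqI)
  have X_x: "Dx Xf p = scalingf (fst p) / sqrt_a (snd p)" if "p \<in> N" for p
    using that Dx_eqI[OF DERIV_Xf_x] by auto
  show "Dx Xf p \<noteq> 0"
    using p scalingf_pos[of t] sqrt_a_pos[of x] by (simp add: X_x)
  show "Dt (\<lambda>p. T (fst p)) p = a (snd p) * (Dx Xf p)\<^sup>2"
    using p sqrt_a_pos[of x] scalingf_sq Dt_eqI[of "\<lambda>p. T (fst p)"] DERIV_T
    by (simp add: X_x a_eq power_divide)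
  have X_t: "Dt Xf p = scalingf (fst p) * driftf p"
    using p Dt_eqI[OF DERIV_Xf_t] by simp
  have M_x: "Dx Mf p = Mf p * (J (snd p) + driftf p) / (2 * sqrt_a (snd p))" if "p \<in> N" for p
    using that Dx_eqI[OF DERIV_Mf_x] by auto
  show "Mf p * parabolic_op a b (\<lambda>_. 0) Xf p = 2 * a (snd p) * Dx Mf p * Dx Xf p"
    by (rule iffD2[OF X_drift_iff_log_derivative[OF open_N _ \<open>p \<in> N\<close> smooth_N(5) _ scalingf_x X_x X_t]
          M_x[OF \<open>p \<in> N\<close>]]) (use p scalingf_pos[of t] in auto)
  show "parabolic_op a b c Mf p = 0"
    using parabolic_op_of_log_derivative[OF open_N _ smooth_Mf smooth_driftf M_x \<open>p \<in> N\<close>]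
      Dt_eqI[OF DERIV_Mf_t] Dx_eqI[OF DERIV_driftf_x] p sqrt_a_pos[of x] by auto
qed

lemma inj_on_I: "inj_on I S"
  using S by (intro inj_on_of_deriv_pos[OF _ DERIV_I]) (simp_all add: sqrt_a_pos)

lemma inj_on_T: "inj_on T A"
  using A by (intro inj_on_of_deriv_pos[OF _ DERIV_T deriv_T_pos])

lemmas inv_I = smooth_on_inv_into[OF S(2) smooth_I inj_on_I]
lemmas inv_T = smooth_on_inv_into[OF A(2) smooth_T inj_on_T]

lemma inj_on_TX: "inj_on (\<lambda>p. (T (fst p), Xf p)) N"
proof (rule inj_onI)
  fix p p'
  assume p: "p \<in> N" "p' \<in> N" and eq: "(T (fst p), Xf p) = (T (fst p'), Xf p')"
  have "fst p = fst p'"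
    using eq p inj_onD[OF inj_on_T] by auto
  moreover from this have "I (snd p) = I (snd p')"
    using eq p scalingf_pos[of "fst p"] by (auto simp: Xf_def)
  then have "snd p = snd p'"
    using p inj_onD[OF inj_on_I] by auto
  ultimately show "p = p'"
    by (simp add: prod_eq_iff)
qed

abbreviation D :: "(real \<times> real \<times> real) set" where "D \<equiv> A \<times> S \<times> UNIV"

lemma D_eq: "{(t, x, u). (t, x) \<in> N} = D"
  by auto

lemma open_D: "open D"
  using A S by (intro open_Times) auto

lemma inj_\<Phi>: "inj_on \<Phi> D"
  using inj_on_\<Phi>[OF inj_on_TX] unfolding D_eq .

lemma smooth_\<Phi>: "smooth_on D \<Phi>"
proof -
  note fst_D = smooth_on_fst[OF smooth_on_id[OF open_D]]
    and snd_D = smooth_on_snd[OF smooth_on_id[OF open_D]]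
  note smooth_D = smooth_along[OF open_D fst_D _ smooth_on_fst[OF snd_D]]
  have "smooth_on D (\<lambda>p. (T (fst p), Xf (fst p, fst (snd p)), snd (snd p) / Mf (fst p, fst (snd p))))"
    unfolding smooth_on_Pair_iff using M_nonzero
    by (auto intro!: smooth_D smooth_on_divide smooth_on_snd snd_D open_D)
  moreover have "\<Phi> = (\<lambda>p. (T (fst p), Xf (fst p, fst (snd p)), snd (snd p) / Mf (fst p, fst (snd p))))"
    by (auto simp: \<Phi>_def)
  ultimately show ?thesis by simp
qed

lemma open_\<Phi>_image: "open (\<Phi> ` D)"
  by (rule invariance_of_domain[OF smooth_on_imp_continuous_on[OF smooth_\<Phi>] open_D inj_\<Phi>])

lemma smooth_inv_\<Phi>: "smooth_on (\<Phi> ` D) (inv_into D \<Phi>)"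
proof -
  let ?E = "\<Phi> ` D"
  define \<tau> where "\<tau> = (\<lambda>p::real \<times> real \<times> real. inv_into A T (fst p))"
  define y where "y = (\<lambda>p. fst (snd p) / scalingf (\<tau> p) - \<omega> (\<tau> p))"
  define \<xi> where "\<xi> = (\<lambda>p. inv_into S I (y p))"
  have \<tau>: "\<tau> (\<Phi> (t, x, u)) = t" and y: "y (\<Phi> (t, x, u)) = I x" and \<xi>: "\<xi> (\<Phi> (t, x, u)) = x"
    if "t \<in> A" "x \<in> S" for t x u
    using that scalingf_pos[of t]
    by (simp_all add: \<tau>_def y_def \<xi>_def \<Phi>_def Xf_def inv_into_f_f inj_on_T inj_on_I)
  have \<tau>_A: "\<tau> ` ?E \<subseteq> A" and \<xi>_S: "\<xi> ` ?E \<subseteq> S"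
    using \<tau> \<xi> by auto
  note fst_E = smooth_on_fst[OF smooth_on_id[OF open_\<Phi>_image]]
    and snd_E = smooth_on_snd[OF smooth_on_id[OF open_\<Phi>_image]]
  have smooth_\<tau>: "smooth_on ?E \<tau>"
    unfolding \<tau>_def using deriv_T_pos
    by (intro smooth_on_compose[OF open_\<Phi>_image inv_T fst_E]) (force simp: \<Phi>_def)+
  have "smooth_on ?E y"
    unfolding y_def using \<tau>_A scalingf_pos
    by (intro smooth_on_diff smooth_on_divide smooth_on_fst snd_E open_\<Phi>_image
        smooth_on_compose[OF open_\<Phi>_image A(2) smooth_scalingf smooth_\<tau>]
        smooth_on_compose[OF open_\<Phi>_image A(2) smooth_\<omega> smooth_\<tau>]) force+
  then have smooth_\<xi>: "smooth_on ?E \<xi>"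
    unfolding \<xi>_def using y sqrt_a_pos DERIV_imp_deriv[OF DERIV_I]
    by (intro smooth_on_compose[OF open_\<Phi>_image inv_I]) force+
  have "smooth_on ?E (\<lambda>p. (\<tau> p, \<xi> p, snd (snd p) * Mf (\<tau> p, \<xi> p)))"
    unfolding smooth_on_Pair_iff
    by (intro conjI smooth_\<tau> smooth_\<xi> smooth_on_mult smooth_on_snd snd_E open_\<Phi>_image
        smooth_along(3)[OF _ _ \<tau>_A _ \<xi>_S])
  then show ?thesis
  proof (rule smooth_on_cong[OF open_\<Phi>_image, rotated])
    show "(\<tau> p, \<xi> p, snd (snd p) * Mf (\<tau> p, \<xi> p)) = inv_into D \<Phi> p" if in_E: "p \<in> ?E" for p
    proof -
      obtain t x u where p: "t \<in> A" "x \<in> S" "p = \<Phi> (t, x, u)"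
        using in_E by auto
      then show ?thesis
        using M_nonzero[of "(t, x)"] \<tau>[OF p(1,2)] \<xi>[OF p(1,2)]
        by (simp add: inv_into_f_f[OF inj_\<Phi>]) (simp add: \<Phi>_def)
    qed
  qed
qed

theorem maps_to_heat_\<Phi>: "maps_to_heat a b c S A \<Phi>"
  unfolding maps_to_heat_def Let_def point_transformation_def
  using open_D inj_\<Phi> open_\<Phi>_image smooth_\<Phi> smooth_inv_\<Phi> A(3) S(3)
    maps_solutions_to_heat[OF inj_on_TX] maps_solutions_from_heat unfolding D_eq by auto

lemma \<Phi>_eq:
  "\<Phi> = (\<lambda>(t, x, u). (T t, sqrt (deriv T t) * (I x + \<omega> t),
     u / (C * (deriv T t * a x) powr (1/4) * exp
       (- B x + deriv (deriv T) t / (8 * deriv T t) * (I x + \<omega> t)\<^sup>2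
       + deriv \<omega> t * I x / 2 - W t))))"
  by (simp add: \<Phi>_def Xf_def Mf_def scalingf_def pre_schwarzian_def mult.commute[of 8])

end

section \<open>Point transformations to the heat equation\<close>

abbreviation partial_t :: "(real \<times> real \<times> real \<Rightarrow> real) \<Rightarrow> real \<times> real \<times> real \<Rightarrow> real" ("\<partial>\<^sub>t")
  where "\<partial>\<^sub>t \<equiv> dir_deriv (1, 0, 0)"
abbreviation partial_x :: "(real \<times> real \<times> real \<Rightarrow> real) \<Rightarrow> real \<times> real \<times> real \<Rightarrow> real" ("\<partial>\<^sub>x")
  where "\<partial>\<^sub>x \<equiv> dir_deriv (0, 1, 0)"
abbreviation partial_u :: "(real \<times> real \<times> real \<Rightarrow> real) \<Rightarrow> real \<times> real \<times> real \<Rightarrow> real" ("\<partial>\<^sub>u")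
  where "\<partial>\<^sub>u \<equiv> dir_deriv (0, 0, 1)"

lemma dir_deriv_real_triple:
  fixes F :: "real \<times> real \<times> real \<Rightarrow> real"
  assumes "F differentiable (at q)"
  shows "dir_deriv (t, x, u) F q = t * \<partial>\<^sub>t F q + x * \<partial>\<^sub>x F q + u * \<partial>\<^sub>u F q"
proof -
  have L: "linear (\<lambda>v. dir_deriv v F q)"
    by (rule has_derivative_linear[OF differentiable_has_dir_deriv[OF assms]])
  have "dir_deriv (t *\<^sub>R (1, 0, 0) + x *\<^sub>R (0, 1, 0) + u *\<^sub>R (0, 0, 1)) F q =
      t * \<partial>\<^sub>t F q + x * \<partial>\<^sub>x F q + u * \<partial>\<^sub>u F q"
    by (simp only: linear_add[OF L] linear_cmul[OF L] real_scaleR_def)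
  then show ?thesis by simp
qed

lemma has_derivative_along_graph:
  fixes F :: "real \<times> real \<times> real \<Rightarrow> real" and u :: "real \<times> real \<Rightarrow> real"
  assumes F: "F differentiable (at (fst p, snd p, u p))" and u: "u differentiable (at p)"
  shows "((\<lambda>p. F (fst p, snd p, u p)) has_derivative (\<lambda>v. fst v * \<partial>\<^sub>t F (fst p, snd p, u p)
    + snd v * \<partial>\<^sub>x F (fst p, snd p, u p) + dir_deriv v u p * \<partial>\<^sub>u F (fst p, snd p, u p))) (at p)"
proof -
  have "((\<lambda>p. (fst p, snd p, u p)) has_derivative (\<lambda>v. (fst v, snd v, dir_deriv v u p))) (at p)"
    by (intro has_derivative_Pair has_derivative_fst has_derivative_snd has_derivative_ident
        differentiable_has_dir_deriv u)
  from has_derivative_compose[OF this differentiable_has_dir_deriv[OF F]] show ?thesis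
    by (simp only: dir_deriv_real_triple[OF F, of "fst _"])
qed

lemmas dir_deriv_along_graph = dir_deriv_eqI[OF has_derivative_along_graph]
  and differentiable_along_graph = differentiableI[OF has_derivative_along_graph]

lemma implicit_solution_derivatives:
  fixes F :: "real \<times> real \<times> real \<Rightarrow> real" and u :: "real \<times> real \<Rightarrow> real"
  assumes D: "open D" "smooth_on D F" and V: "open V" "p \<in> V" "smooth_on V u"
    and zero: "\<And>p. p \<in> V \<Longrightarrow> (fst p, snd p, u p) \<in> D \<and> F (fst p, snd p, u p) = 0"
  defines "q \<equiv> (fst p, snd p, u p)"
  shows "\<partial>\<^sub>t F q + Dt u p * \<partial>\<^sub>u F q = 0" "\<partial>\<^sub>x F q + Dx u p * \<partial>\<^sub>u F q = 0"
    "\<partial>\<^sub>x (\<partial>\<^sub>x F) q + 2 * Dx u p * \<partial>\<^sub>x (\<partial>\<^sub>u F) q + (Dx u p)\<^sup>2 * \<partial>\<^sub>u (\<partial>\<^sub>u F) q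
      + Dx (Dx u) p * \<partial>\<^sub>u F q = 0"
proof -
  have along: "dir_deriv v (\<lambda>p. G (fst p, snd p, u p)) p = fst v * \<partial>\<^sub>t G (fst p, snd p, u p)
      + snd v * \<partial>\<^sub>x G (fst p, snd p, u p) + dir_deriv v u p * \<partial>\<^sub>u G (fst p, snd p, u p)"
    "(\<lambda>p. G (fst p, snd p, u p)) differentiable (at p)"
    if "smooth_on D G" "p \<in> V" for G v p
  proof -
    have "G differentiable (at (fst p, snd p, u p))" "u differentiable (at p)"
      using D V that zero by (blast intro: smooth_on_imp_differentiable)+
    then show "dir_deriv v (\<lambda>p. G (fst p, snd p, u p)) p = fst v * \<partial>\<^sub>t G (fst p, snd p, u p)
        + snd v * \<partial>\<^sub>x G (fst p, snd p, u p) + dir_deriv v u p * \<partial>\<^sub>u G (fst p, snd p, u p)"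
      "(\<lambda>p. G (fst p, snd p, u p)) differentiable (at p)"
      by (rule dir_deriv_along_graph differentiable_along_graph)+
  qed
  have vanish: "fst v * \<partial>\<^sub>t F (fst p, snd p, u p) + snd v * \<partial>\<^sub>x F (fst p, snd p, u p)
      + dir_deriv v u p * \<partial>\<^sub>u F (fst p, snd p, u p) = 0" if "p \<in> V" for v p
    using dir_deriv_cong[OF V(1) that, of "\<lambda>p. F (fst p, snd p, u p)"
      "\<lambda>_. 0" v] zero along(1)[OF D(2) that]
    by (simp add: dir_deriv_const)
  show "\<partial>\<^sub>t F q + Dt u p * \<partial>\<^sub>u F q = 0" "\<partial>\<^sub>x F q + Dx u p * \<partial>\<^sub>u F q = 0"
    using vanish[OF V(2), of "(1, 0)"] vanish[OF V(2), of "(0, 1)"] by (simp_all add: q_def)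
  have smooth': "smooth_on D (\<partial>\<^sub>x F)" "smooth_on D (\<partial>\<^sub>u F)"
    by (intro smooth_on_dir_deriv D)+
  have "q \<in> D"
    using zero[OF V(2)] by (simp add: q_def)
  have "Dx (\<lambda>p. \<partial>\<^sub>x F (fst p, snd p, u p) + Dx u p * \<partial>\<^sub>u F (fst p, snd p, u p)) p = Dx (\<lambda>_. 0) p"
    using vanish[of _ "(0, 1)"] by (intro dir_deriv_cong[OF V(1,2)]) simp
  then have "\<partial>\<^sub>x (\<partial>\<^sub>x F) q + Dx u p * \<partial>\<^sub>u (\<partial>\<^sub>x F) q
      + (Dx u p * (\<partial>\<^sub>x (\<partial>\<^sub>u F) q + Dx u p * \<partial>\<^sub>u (\<partial>\<^sub>u F) q) + Dx (Dx u) p * \<partial>\<^sub>u F q) = 0"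
    using smooth_on_imp_differentiable[OF V(1) smooth_on_dir_deriv[OF V(1,3)] V(2)]
    by (simp add: dir_deriv_simps along[OF smooth'(1) V(2)] along[OF smooth'(2) V(2)] q_def)
  then show "\<partial>\<^sub>x (\<partial>\<^sub>x F) q + 2 * Dx u p * \<partial>\<^sub>x (\<partial>\<^sub>u F) q + (Dx u p)\<^sup>2 * \<partial>\<^sub>u (\<partial>\<^sub>u F) q
    + Dx (Dx u) p * \<partial>\<^sub>u F q = 0"
    using dir_deriv_commute[OF D(1) \<open>q \<in> D\<close> D(2), of "(0, 0, 1)" "(0, 1, 0)"]
    by (simp add: algebra_simps power2_eq_square)
qed

lemma smooth_implicit_function_triple:
  fixes F :: "real \<times> real \<times> real \<Rightarrow> real"
  assumes D: "open D" "(t, x, k) \<in> D"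
    and F: "smooth_on D F" "F (t, x, k) = 0" and nonzero: "\<partial>\<^sub>u F (t, x, k) \<noteq> 0"
  obtains V u where "open V" "(t, x) \<in> V" "u (t, x) = k" "smooth_on V u"
    "\<And>p. p \<in> V \<Longrightarrow> (fst p, snd p, u p) \<in> D \<and> F (fst p, snd p, u p) = 0"
proof -
  let ?j = "\<lambda>p :: (real \<times> real) \<times> real. (fst (fst p), snd (fst p), snd p)"
  let ?D = "?j -` D" and ?G = "\<lambda>p. F (?j p)"
  have D': "open ?D" "((t, x), k) \<in> ?D"
    using D by (auto intro!: open_vimage continuous_intros)
  have "smooth_on ?D ?j"
    unfolding smooth_on_Pair_iff by (intro conjI smooth_on_intros D'(1))
  then have G: "smooth_on ?D ?G"
    by (rule smooth_on_compose[OF D'(1) D(1) F(1)]) auto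
  have "?G ((t, x), k) = 0" "dir_deriv (0, 1) ?G ((t, x), k) \<noteq> 0"
    using F(2) nonzero by (simp_all add: dir_deriv_def zero_prod_def)
  from smooth_implicit_function[OF D' G this]
  obtain V u where "open V" "(t, x) \<in> V" "u (t, x) = k" "smooth_on V u"
    "\<And>p. p \<in> V \<Longrightarrow> (p, u p) \<in> ?D \<and> ?G (p, u p) = 0"
    by blast
  then show thesis
    by (intro that[of V u]) auto
qed

text \<open>The heat polynomial with $w = w_0$, prescribed $w_y$, $w_s = w_{yy}$ and $w_{ss}$,
  and $w_{sy} = 0$ at $(s_0, y_0)$.\<close>

definition heat_poly :: "real \<Rightarrow> real \<Rightarrow> real \<Rightarrow> real \<Rightarrow> real \<Rightarrow> real \<Rightarrow> real \<times> real \<Rightarrow> real" where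
  "heat_poly s0 y0 w0 wy ws wss k = w0 + wy * (snd k - y0) + ws * ((snd k - y0)\<^sup>2 / 2 + (fst k - s0))
     + wss * ((snd k - y0) ^ 4 / 24 + (fst k - s0) * (snd k - y0)\<^sup>2 / 2 + (fst k - s0)\<^sup>2 / 2)"

lemma smooth_heat_poly: "smooth_on UNIV (heat_poly s0 y0 w0 wy ws wss)"
  unfolding heat_poly_def[abs_def] by (intro smooth_on_intros) auto

lemma Dt_heat_poly: "Dt (heat_poly s0 y0 w0 wy ws wss)
  = (\<lambda>k. ws + wss * ((snd k - y0)\<^sup>2 / 2 + (fst k - s0)))"
proof
  fix k
  have "((\<lambda>s. heat_poly s0 y0 w0 wy ws wss (s, snd k)) has_real_derivative
      ws + wss * ((snd k - y0)\<^sup>2 / 2 + (fst k - s0))) (at (fst k))"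
    unfolding heat_poly_def by (auto intro!: derivative_eq_intros simp: field_simps power2_eq_square)
  from Dt_eqI[OF this] show "Dt (heat_poly s0 y0 w0 wy ws wss) k
    = ws + wss * ((snd k - y0)\<^sup>2 / 2 + (fst k - s0))"
    by simp
qed

lemma Dx_heat_poly:
  "Dx (heat_poly s0 y0 w0 wy ws wss)
    = (\<lambda>k. wy + ws * (snd k - y0) + wss * ((snd k - y0) ^ 3 / 6 + (fst k - s0) * (snd k - y0)))"
proof
  fix k
  have "((\<lambda>y. heat_poly s0 y0 w0 wy ws wss (fst k, y)) has_real_derivative
      wy + ws * (snd k - y0) + wss * ((snd k - y0) ^ 3 / 6 + (fst k - s0) * (snd k - y0))) (at (snd k))"
    unfolding heat_poly_def by (auto intro!: derivative_eq_intros
      simp: field_simps power2_eq_square power3_eq_cube)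
  from Dx_eqI[OF this] show "Dx (heat_poly s0 y0 w0 wy ws wss) k
      = wy + ws * (snd k - y0) + wss * ((snd k - y0) ^ 3 / 6 + (fst k - s0) * (snd k - y0))"
    by simp
qed

lemma Dx_Dx_heat_poly: "Dx (Dx (heat_poly s0 y0 w0 wy ws wss)) k
  = ws + wss * ((snd k - y0)\<^sup>2 / 2 + (fst k - s0))"
proof -
  have "((\<lambda>y. Dx (heat_poly s0 y0 w0 wy ws wss) (fst k, y)) has_real_derivative
      ws + wss * ((snd k - y0)\<^sup>2 / 2 + (fst k - s0))) (at (snd k))"
    unfolding Dx_heat_poly by (auto intro!: derivative_eq_intros simp: field_simps power2_eq_square)
  from Dx_eqI[OF this] show ?thesis by simp
qed

lemma heatsol_heat_poly: "open Om \<Longrightarrow> heatsol Om (\<lambda>s y. heat_poly s0 y0 w0 wy ws wss (s, y))"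
  using smooth_on_subset[OF open_UNIV _ _ smooth_heat_poly]
  by (simp add: heatsol_def lsol_iff_parabolic_op parabolic_op_def Dt_heat_poly Dx_Dx_heat_poly)

lemma heat_poly_jet:
  "heat_poly s0 y0 w0 wy ws wss (s0, y0) = w0" "Dt (heat_poly s0 y0 w0 wy ws wss) (s0, y0) = ws"
  "Dx (heat_poly s0 y0 w0 wy ws wss) (s0, y0) = wy"
  "Dt (Dt (heat_poly s0 y0 w0 wy ws wss)) (s0, y0) = wss"
  "Dx (Dx (heat_poly s0 y0 w0 wy ws wss)) (s0, y0) = ws"
  "Dx (Dt (heat_poly s0 y0 w0 wy ws wss)) (s0, y0) = 0"
  "Dt (Dx (heat_poly s0 y0 w0 wy ws wss)) (s0, y0) = 0"
proof -
  show "heat_poly s0 y0 w0 wy ws wss (s0, y0) = w0"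
    "Dt (heat_poly s0 y0 w0 wy ws wss) (s0, y0) = ws" "Dx (heat_poly s0 y0 w0 wy ws wss) (s0, y0) = wy"
    "Dx (Dx (heat_poly s0 y0 w0 wy ws wss)) (s0, y0) = ws"
    by (simp_all add: Dx_Dx_heat_poly) (simp_all add: heat_poly_def Dt_heat_poly Dx_heat_poly)
  show "Dt (Dt (heat_poly s0 y0 w0 wy ws wss)) (s0, y0) = wss"
    "Dt (Dx (heat_poly s0 y0 w0 wy ws wss)) (s0, y0) = 0"
    "Dx (Dt (heat_poly s0 y0 w0 wy ws wss)) (s0, y0) = 0"
    unfolding Dt_heat_poly Dx_heat_poly
    by (rule Dt_eqI Dx_eqI, auto intro!: derivative_eq_intros)+
qed

locale heat_point_transformation = parabolic +
  fixes A :: "real set" and T X U :: "real \<times> real \<times> real \<Rightarrow> real"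
  assumes open_A: "open A"
    and smooth_TXU: "smooth_on (A \<times> S \<times> UNIV) T" "smooth_on (A \<times> S \<times> UNIV) X"
      "smooth_on (A \<times> S \<times> UNIV) U"
    and immersion: "q \<in> A \<times> S \<times> UNIV \<Longrightarrow> dir_deriv v T q = 0 \<Longrightarrow> dir_deriv v X q = 0 \<Longrightarrow>
      dir_deriv v U q = 0 \<Longrightarrow> v = 0"
    and heat_solution: "heatsol UNIV (\<lambda>s y. w (s, y)) \<Longrightarrow> open V \<Longrightarrow> smooth_on V u \<Longrightarrow>
      (\<And>p. p \<in> V \<Longrightarrow> (fst p, snd p, u p) \<in> A \<times> S \<times> UNIV \<and>
        U (fst p, snd p, u p) = w (T (fst p, snd p, u p), X (fst p, snd p, u p))) \<Longrightarrow>
      p \<in> V \<Longrightarrow> parabolic_op a b c u p = 0"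
begin

abbreviation D :: "(real \<times> real \<times> real) set" where "D \<equiv> A \<times> S \<times> UNIV"

lemma open_D: "open D"
  using open_A S by (intro open_Times) auto

lemma smooth_on_D_differentiable: "smooth_on D f \<Longrightarrow> q \<in> D \<Longrightarrow> f differentiable (at q)" for f :: "_ \<Rightarrow> real"
  by (rule smooth_on_imp_differentiable[OF open_D])

lemma dir_deriv_triple_D:
  fixes F :: "real \<times> real \<times> real \<Rightarrow> real"
  assumes "smooth_on D F" "q \<in> D"
  shows "dir_deriv (t, x, u) F q = t * \<partial>\<^sub>t F q + x * \<partial>\<^sub>x F q + u * \<partial>\<^sub>u F q"
  by (rule dir_deriv_real_triple[OF smooth_on_D_differentiable[OF assms]])

lemma level_set_equation:
  assumes q: "q \<in> D" and w: "heatsol UNIV (\<lambda>s y. w (s, y))" "smooth_on UNIV w"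
  defines "F \<equiv> (\<lambda>q. U q - w (T q, X q))"
  assumes F: "F q = 0" "\<partial>\<^sub>u F q \<noteq> 0"
  shows "(\<partial>\<^sub>u F q)\<^sup>2 * \<partial>\<^sub>t F q = a (fst (snd q)) *
      ((\<partial>\<^sub>u F q)\<^sup>2 * \<partial>\<^sub>x (\<partial>\<^sub>x F) q - 2 * \<partial>\<^sub>u F q * \<partial>\<^sub>x F q * \<partial>\<^sub>x (\<partial>\<^sub>u F) q
        + (\<partial>\<^sub>x F q)\<^sup>2 * \<partial>\<^sub>u (\<partial>\<^sub>u F) q)
    + b (fst (snd q)) * (\<partial>\<^sub>u F q)\<^sup>2 * \<partial>\<^sub>x F q - c (fst (snd q)) * snd (snd q) * (\<partial>\<^sub>u F q) ^ 3"
proof -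
  obtain t x k where q_eq: "q = (t, x, k)"
    by (metis prod_cases3)
  have smooth_F: "smooth_on D F"
    unfolding F_def using smooth_TXU
    by (intro smooth_on_diff smooth_on_compose[OF open_D open_UNIV w(2)] open_D)
      (auto simp: smooth_on_Pair_iff)
  obtain V u where V: "open V" "(t, x) \<in> V" "u (t, x) = k" "smooth_on V u"
    and on_graph: "\<And>p. p \<in> V \<Longrightarrow> (fst p, snd p, u p) \<in> D \<and> F (fst p, snd p, u p) = 0"
    using smooth_implicit_function_triple[OF open_D _ smooth_F, of t x k] q F unfolding q_eq by blast
  have "parabolic_op a b c u (t, x) = 0"
    by (rule heat_solution[OF w(1) V(1,4) _ V(2)]) (use on_graph in \<open>auto simp: F_def\<close>)
  moreover have "\<partial>\<^sub>t F q + Dt u (t, x) * \<partial>\<^sub>u F q = 0" "\<partial>\<^sub>x F q + Dx u (t, x) * \<partial>\<^sub>u F q = 0"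
    "\<partial>\<^sub>x (\<partial>\<^sub>x F) q + 2 * Dx u (t, x) * \<partial>\<^sub>x (\<partial>\<^sub>u F) q + (Dx u (t, x))\<^sup>2 * \<partial>\<^sub>u (\<partial>\<^sub>u F) q
      + Dx (Dx u) (t, x) * \<partial>\<^sub>u F q = 0"
    using implicit_solution_derivatives[OF open_D smooth_F V(1,2,4) on_graph] V(3)
    by (simp_all add: q_eq)
  ultimately show ?thesis
    using V(3) unfolding parabolic_op_def q_eq fst_conv snd_conv by algebra
qed

lemma dir_deriv_compose_TX:
  assumes q: "q \<in> D" and w: "smooth_on UNIV w"
  shows "dir_deriv v (\<lambda>q. w (T q, X q)) q =
      dir_deriv v T q * Dt w (T q, X q) + dir_deriv v X q * Dx w (T q, X q)"
    "(\<lambda>q. w (T q, X q)) differentiable (at q)"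
proof -
  have "w differentiable (at (T q, X q))" "T differentiable (at q)" "X differentiable (at q)"
    using q smooth_TXU smooth_on_imp_differentiable[OF open_UNIV w]
    by (auto intro: smooth_on_D_differentiable)
  then show "dir_deriv v (\<lambda>q. w (T q, X q)) q =
      dir_deriv v T q * Dt w (T q, X q) + dir_deriv v X q * Dx w (T q, X q)"
    "(\<lambda>q. w (T q, X q)) differentiable (at q)"
    by (rule dir_deriv_compose_Pair differentiable_compose_Pair)+
qed

text \<open>The first and second derivatives at \<open>q\<close> of \<open>U - w (T, X)\<close>, in terms of the jet of \<open>w\<close>.\<close>

definition jet1 :: "real \<Rightarrow> real \<Rightarrow> real \<times> real \<times> real \<Rightarrow> real \<times> real \<times> real \<Rightarrow> real" where
  "jet1 wy ws v q = dir_deriv v U q - ws * dir_deriv v T q - wy * dir_deriv v X q"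

definition jet2 ::
  "real \<Rightarrow> real \<Rightarrow> real \<Rightarrow> real \<times> real \<times> real \<Rightarrow> real \<times> real \<times> real \<Rightarrow> real \<times> real \<times> real \<Rightarrow> real"
where
  "jet2 wy ws wss v v' q =
     dir_deriv v (dir_deriv v' U) q - ws * dir_deriv v (dir_deriv v' T) q
       - wy * dir_deriv v (dir_deriv v' X) q
     - wss * dir_deriv v T q * dir_deriv v' T q - ws * dir_deriv v X q * dir_deriv v' X q"

lemma jet_equation:
  assumes q: "q \<in> D" and nonzero: "jet1 wy ws (0, 0, 1) q \<noteq> 0"
  shows "(jet1 wy ws (0, 0, 1) q)\<^sup>2 * jet1 wy ws (1, 0, 0) q = a (fst (snd q)) *
      ((jet1 wy ws (0, 0, 1) q)\<^sup>2 * jet2 wy ws wss (0, 1, 0) (0, 1, 0) q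
        - 2 * jet1 wy ws (0, 0, 1) q * jet1 wy ws (0, 1, 0) q * jet2 wy ws wss (0, 1, 0) (0, 0, 1) q
        + (jet1 wy ws (0, 1, 0) q)\<^sup>2 * jet2 wy ws wss (0, 0, 1) (0, 0, 1) q)
    + b (fst (snd q)) * (jet1 wy ws (0, 0, 1) q)\<^sup>2 * jet1 wy ws (0, 1, 0) q
    - c (fst (snd q)) * snd (snd q) * (jet1 wy ws (0, 0, 1) q) ^ 3"
proof -
  define w where "w = heat_poly (T q) (X q) (U q) wy ws wss"
  define F where "F = (\<lambda>q. U q - w (T q, X q))"
  have w: "smooth_on UNIV w"
    unfolding w_def by (rule smooth_heat_poly)
  note w' = smooth_on_dir_deriv[OF open_UNIV w]
    and jet = heat_poly_jet[of "T q" "X q" "U q" wy ws wss, folded w_def]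
  note diff = smooth_on_D_differentiable[OF _ q] smooth_on_dir_deriv[OF open_D] smooth_TXU
  have F1: "dir_deriv v F q' =
      dir_deriv v U q' - (dir_deriv v T q' * Dt w (T q', X q') + dir_deriv v X q' * Dx w (T q', X q'))"
    if "q' \<in> D" for v q'
    unfolding F_def using that smooth_TXU
    by (simp add: dir_deriv_diff smooth_on_D_differentiable dir_deriv_compose_TX[OF that w])
  have first: "dir_deriv v F q = jet1 wy ws v q" for v
    by (simp add: F1[OF q] jet1_def jet)
  have second: "dir_deriv v (dir_deriv v' F) q = jet2 wy ws wss v v' q" for v v'
  proof -
    have "dir_deriv v (dir_deriv v' F) q = dir_deriv v
        (\<lambda>q. dir_deriv v' U q - (dir_deriv v' T q * Dt w (T q, X q)
          + dir_deriv v' X q * Dx w (T q, X q))) q"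
      by (rule dir_deriv_cong[OF open_D q F1])
    also have "\<dots> = jet2 wy ws wss v v' q"
      by (simp add: dir_deriv_simps diff dir_deriv_compose_TX[OF q w'] jet jet2_def algebra_simps)
    finally show ?thesis .
  qed
  show ?thesis
    using level_set_equation[OF q, of w] nonzero heatsol_heat_poly[OF open_UNIV] w
    unfolding F_def[symmetric] first second by (simp add: w_def jet F_def heat_poly_jet)
qed

lemma spatial_immersion:
  assumes q: "q \<in> D"
    and "x * \<partial>\<^sub>x T q + u * \<partial>\<^sub>u T q = 0" "x * \<partial>\<^sub>x X q + u * \<partial>\<^sub>u X q = 0" "x * \<partial>\<^sub>x U q + u * \<partial>\<^sub>u U q = 0"
  shows "x = 0 \<and> u = 0"
proof -
  have "(0, x, u) = (0 :: real \<times> real \<times> real)"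
    by (rule immersion[OF q])
       (simp_all only: dir_deriv_triple_D[OF smooth_TXU(1) q, of 0 x u]
         dir_deriv_triple_D[OF smooth_TXU(2) q, of 0 x u]
          dir_deriv_triple_D[OF smooth_TXU(3) q, of 0 x u] assms mult_zero_left add_0)
  then show ?thesis
    by (simp add: zero_prod_def)
qed

lemma T_spatial_derivatives_parallel:
  assumes q: "q \<in> D" and nonzero: "jet1 wy ws (0, 0, 1) q \<noteq> 0"
  shows "jet1 wy ws (0, 0, 1) q * \<partial>\<^sub>x T q = jet1 wy ws (0, 1, 0) q * \<partial>\<^sub>u T q"
proof -
  have second: "jet2 wy ws 1 v v' q = jet2 wy ws 0 v v' q - dir_deriv v T q * dir_deriv v' T q" for v v'
    by (simp add: jet2_def)
  have "a (fst (snd q)) * (jet1 wy ws (0, 0, 1) q * \<partial>\<^sub>x T q - jet1 wy ws (0, 1, 0) q * \<partial>\<^sub>u T q)\<^sup>2 = 0"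
    using jet_equation[OF q nonzero, of 0] jet_equation[OF q nonzero, of 1] unfolding second by algebra
  then show ?thesis
    using a_pos[of "fst (snd q)"] q by auto
qed

lemma T_spatial_derivatives:
  assumes q: "q \<in> D"
  shows "\<partial>\<^sub>x T q = 0" "\<partial>\<^sub>u T q = 0"
proof -
  let ?A = "\<partial>\<^sub>u U q * \<partial>\<^sub>x T q - \<partial>\<^sub>x U q * \<partial>\<^sub>u T q" and ?B = "\<partial>\<^sub>u X q * \<partial>\<^sub>x T q - \<partial>\<^sub>x X q * \<partial>\<^sub>u T q"
  have affine: "?A = wy * ?B" if "jet1 wy ws (0, 0, 1) q \<noteq> 0" for wy ws
    using T_spatial_derivatives_parallel[OF q that] by (simp add: jet1_def algebra_simps)
  have T_x: "\<partial>\<^sub>x T q = 0" if T_u: "\<partial>\<^sub>u T q = 0"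
  proof -
    have "\<partial>\<^sub>u X q \<noteq> 0 \<or> \<partial>\<^sub>u U q \<noteq> 0"
      using spatial_immersion[OF q, of 0 1] T_u by auto
    then obtain wy where "jet1 wy 0 (0, 0, 1) q \<noteq> 0"
      unfolding jet1_def by (metis diff_zero mult_zero_left mult_1 right_minus_eq)
    from T_spatial_derivatives_parallel[OF q this] this show ?thesis
      by (simp add: T_u)
  qed
  have T_u: "\<partial>\<^sub>u T q = 0"
  proof (rule ccontr)
    assume T_u: "\<partial>\<^sub>u T q \<noteq> 0"
    have "?A = wy * ?B" for wy
    proof (rule affine)
      show "jet1 wy ((\<partial>\<^sub>u U q - wy * \<partial>\<^sub>u X q - 1) / \<partial>\<^sub>u T q) (0, 0, 1) q \<noteq> 0"
        using T_u by (simp add: jet1_def)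
    qed
    from this[of 0] this[of 1] have "?A = 0" "?B = 0"
      by simp_all
    then show False
      using spatial_immersion[OF q, of "\<partial>\<^sub>u T q" "- \<partial>\<^sub>x T q"] T_u by (simp add: mult.commute)
  qed
  show "\<partial>\<^sub>u T q = 0" "\<partial>\<^sub>x T q = 0"
    using T_u T_x by blast+
qed

lemma T_second_derivatives:
  assumes q: "q \<in> D"
  shows "dir_deriv v (\<partial>\<^sub>x T) q = 0" "dir_deriv v (\<partial>\<^sub>u T) q = 0"
  using dir_deriv_cong[OF open_D q, of _ "\<lambda>_. 0"] T_spatial_derivatives
  by (simp_all add: dir_deriv_const)

lemma T_t_eq_jacobian:
  assumes q: "q \<in> D" and nonzero: "jet1 wy 0 (0, 0, 1) q \<noteq> 0"
  shows "(jet1 wy 0 (0, 0, 1) q)\<^sup>2 * \<partial>\<^sub>t T q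
    = a (fst (snd q)) * (\<partial>\<^sub>x X q * \<partial>\<^sub>u U q - \<partial>\<^sub>u X q * \<partial>\<^sub>x U q)\<^sup>2"
proof -
  have first: "jet1 wy 1 (0, 0, 1) q = jet1 wy 0 (0, 0, 1) q"
    "jet1 wy 1 (0, 1, 0) q = jet1 wy 0 (0, 1, 0) q"
    "jet1 wy 1 (1, 0, 0) q = jet1 wy 0 (1, 0, 0) q - \<partial>\<^sub>t T q"
    by (simp_all add: jet1_def T_spatial_derivatives[OF q])
  have second: "jet2 wy 1 0 v (0, 1, 0) q = jet2 wy 0 0 v (0, 1, 0) q - dir_deriv v X q * \<partial>\<^sub>x X q"
    "jet2 wy 1 0 v (0, 0, 1) q = jet2 wy 0 0 v (0, 0, 1) q - dir_deriv v X q * \<partial>\<^sub>u X q" for v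
    by (simp_all add: jet2_def T_second_derivatives[OF q])
  have "jet1 wy 1 (0, 0, 1) q \<noteq> 0"
    using nonzero by (simp add: first)
  from jet_equation[OF q nonzero, of 0] jet_equation[OF q this, of 0]
  have "(jet1 wy 0 (0, 0, 1) q)\<^sup>2 * \<partial>\<^sub>t T q
      = a (fst (snd q)) * (jet1 wy 0 (0, 0, 1) q * \<partial>\<^sub>x X q - jet1 wy 0 (0, 1, 0) q * \<partial>\<^sub>u X q)\<^sup>2"
    unfolding first second by algebra
  also have "jet1 wy 0 (0, 0, 1) q * \<partial>\<^sub>x X q - jet1 wy 0 (0, 1, 0) q * \<partial>\<^sub>u X q
      = \<partial>\<^sub>x X q * \<partial>\<^sub>u U q - \<partial>\<^sub>u X q * \<partial>\<^sub>x U q"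
    by (simp add: jet1_def algebra_simps)
  finally show ?thesis .
qed

lemma X_u:
  assumes q: "q \<in> D"
  shows "\<partial>\<^sub>u X q = 0"
proof (rule ccontr)
  assume X_u: "\<partial>\<^sub>u X q \<noteq> 0"
  let ?\<Delta> = "\<partial>\<^sub>x X q * \<partial>\<^sub>u U q - \<partial>\<^sub>u X q * \<partial>\<^sub>x U q"
  have rate: "d\<^sup>2 * \<partial>\<^sub>t T q = a (fst (snd q)) * ?\<Delta>\<^sup>2" if "d \<noteq> 0" for d
  proof -
    have "jet1 ((\<partial>\<^sub>u U q - d) / \<partial>\<^sub>u X q) 0 (0, 0, 1) q = d"
      using X_u by (simp add: jet1_def)
    with T_t_eq_jacobian[OF q, of "(\<partial>\<^sub>u U q - d) / \<partial>\<^sub>u X q"] that show ?thesis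
      by simp
  qed
  have "a (fst (snd q)) * ?\<Delta>\<^sup>2 = 0"
    using rate[of 1] rate[of 2] by simp
  moreover have "a (fst (snd q)) \<noteq> 0"
    using a_pos[of "fst (snd q)"] q by auto
  ultimately have "?\<Delta> = 0"
    by simp
  then show False
    using spatial_immersion[OF q, of "\<partial>\<^sub>u X q" "- \<partial>\<^sub>x X q"] T_spatial_derivatives[OF q] X_u
    by (simp add: mult.commute)
qed

lemma U_u_nonzero: "q \<in> D \<Longrightarrow> \<partial>\<^sub>u U q \<noteq> 0"
  using spatial_immersion[of q 0 1] T_spatial_derivatives(2) X_u by auto

lemma X_x_nonzero: "q \<in> D \<Longrightarrow> \<partial>\<^sub>x X q \<noteq> 0"
  using spatial_immersion[of q "\<partial>\<^sub>u U q" "- \<partial>\<^sub>x U q"] T_spatial_derivatives X_u U_u_nonzero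
  by (auto simp: mult.commute)

lemma T_t:
  assumes q: "q \<in> D"
  shows "\<partial>\<^sub>t T q = a (fst (snd q)) * (\<partial>\<^sub>x X q)\<^sup>2"
proof -
  have "(\<partial>\<^sub>u U q)\<^sup>2 * \<partial>\<^sub>t T q = (\<partial>\<^sub>u U q)\<^sup>2 * (a (fst (snd q)) * (\<partial>\<^sub>x X q)\<^sup>2)"
    using T_t_eq_jacobian[OF q, of 0] U_u_nonzero[OF q] X_u[OF q]
    by (simp add: jet1_def power_mult_distrib mult_ac)
  then show ?thesis
    using U_u_nonzero[OF q] by simp
qed

lemma determining_equations:
  assumes q: "q \<in> D"
  shows "\<partial>\<^sub>u (\<partial>\<^sub>u U) q = 0"
    "\<partial>\<^sub>u U q * (\<partial>\<^sub>t X q - a (fst (snd q)) * \<partial>\<^sub>x (\<partial>\<^sub>x X) q - b (fst (snd q)) * \<partial>\<^sub>x X q)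
      = - 2 * a (fst (snd q)) * \<partial>\<^sub>x (\<partial>\<^sub>u U) q * \<partial>\<^sub>x X q"
    "\<partial>\<^sub>u U q * (\<partial>\<^sub>t U q - a (fst (snd q)) * \<partial>\<^sub>x (\<partial>\<^sub>x U) q - b (fst (snd q)) * \<partial>\<^sub>x U q)
      = - 2 * a (fst (snd q)) * \<partial>\<^sub>x (\<partial>\<^sub>u U) q * \<partial>\<^sub>x U q - c (fst (snd q)) * snd (snd q) * (\<partial>\<^sub>u U q)\<^sup>2"
proof -
  let ?g = "\<partial>\<^sub>u U q" and ?a = "a (fst (snd q))" and ?b = "b (fst (snd q))"
    and ?c = "c (fst (snd q)) * snd (snd q)"
  have X_uv: "dir_deriv v (\<partial>\<^sub>u X) q = 0" for v
    using dir_deriv_cong[OF open_D q, of _ "\<lambda>_. 0"] X_u by (simp add: dir_deriv_const)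
  have expanded: "?g\<^sup>2 * (\<partial>\<^sub>t U q - wy * \<partial>\<^sub>t X q)
    = ?a * (?g\<^sup>2 * (\<partial>\<^sub>x (\<partial>\<^sub>x U) q - wy * \<partial>\<^sub>x (\<partial>\<^sub>x X) q)
      - 2 * ?g * (\<partial>\<^sub>x U q - wy * \<partial>\<^sub>x X q) * \<partial>\<^sub>x (\<partial>\<^sub>u U) q
        + (\<partial>\<^sub>x U q - wy * \<partial>\<^sub>x X q)\<^sup>2 * \<partial>\<^sub>u (\<partial>\<^sub>u U) q)
      + ?b * ?g\<^sup>2 * (\<partial>\<^sub>x U q - wy * \<partial>\<^sub>x X q) - ?c * ?g ^ 3" for wy
    using jet_equation[OF q, of wy 0 0] U_u_nonzero[OF q]
    by (simp add: jet1_def jet2_def T_spatial_derivatives[OF q] X_u[OF q]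
      T_second_derivatives[OF q] X_uv)
  have "?a * (\<partial>\<^sub>x X q)\<^sup>2 * \<partial>\<^sub>u (\<partial>\<^sub>u U) q = 0"
    using expanded[of 0] expanded[of 1] expanded[of "-1"] by algebra
  then show U_uu: "\<partial>\<^sub>u (\<partial>\<^sub>u U) q = 0"
    using a_pos[of "fst (snd q)"] X_x_nonzero[OF q] q by auto
  have "?g * (?g * (\<partial>\<^sub>t X q - ?a * \<partial>\<^sub>x (\<partial>\<^sub>x X) q - ?b * \<partial>\<^sub>x X q))
    = ?g * (- 2 * ?a * \<partial>\<^sub>x (\<partial>\<^sub>u U) q * \<partial>\<^sub>x X q)"
    using expanded[of 0] expanded[of 1] unfolding U_uu by algebra
  then show "?g * (\<partial>\<^sub>t X q - ?a * \<partial>\<^sub>x (\<partial>\<^sub>x X) q - ?b * \<partial>\<^sub>x X q) = - 2 * ?a * \<partial>\<^sub>x (\<partial>\<^sub>u U) q * \<partial>\<^sub>x X q"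
    unfolding mult_left_cancel[OF U_u_nonzero[OF q]] .
  have "?g * (?g * (\<partial>\<^sub>t U q - ?a * \<partial>\<^sub>x (\<partial>\<^sub>x U) q - ?b * \<partial>\<^sub>x U q))
      = ?g * (- 2 * ?a * \<partial>\<^sub>x (\<partial>\<^sub>u U) q * \<partial>\<^sub>x U q - ?c * ?g\<^sup>2)"
    using expanded[of 0] unfolding U_uu by algebra
  then show "?g * (\<partial>\<^sub>t U q - ?a * \<partial>\<^sub>x (\<partial>\<^sub>x U) q - ?b * \<partial>\<^sub>x U q)
      = - 2 * ?a * \<partial>\<^sub>x (\<partial>\<^sub>u U) q * \<partial>\<^sub>x U q - ?c * ?g\<^sup>2"
    unfolding mult_left_cancel[OF U_u_nonzero[OF q]] .
qed

end

lemma dir_deriv_reciprocal: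
  fixes g :: "'a::euclidean_space \<Rightarrow> real"
  assumes "open N" "smooth_on N g" "p \<in> N" "g p \<noteq> 0"
  shows "dir_deriv v (\<lambda>p. 1 / g p) p = - dir_deriv v g p / (g p)\<^sup>2"
  using smooth_on_imp_differentiable[OF assms(1-3)] assms(4)
  by (simp add: dir_deriv_divide dir_deriv_const power2_eq_square)

lemma parabolic_op_reciprocal:
  assumes N: "open N" and g: "smooth_on N g" "\<And>p. p \<in> N \<Longrightarrow> g p \<noteq> 0" and p: "p \<in> N"
  shows "parabolic_op a b c (\<lambda>p. 1 / g p) p = (a (snd p) * (g p * Dx (Dx g) p - 2 * (Dx g p)\<^sup>2)
    + b (snd p) * g p * Dx g p - c (snd p) * (g p)\<^sup>2 - g p * Dt g p) / (g p) ^ 3"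
proof -
  note reciprocal = dir_deriv_reciprocal[OF N g(1) _ g(2)]
  have diff: "g differentiable (at p)" "Dx g differentiable (at p)"
    using smooth_on_imp_differentiable[OF N] smooth_on_dir_deriv[OF N] g(1) p by blast+
  have "Dx (Dx (\<lambda>p. 1 / g p)) p = Dx (\<lambda>p. - Dx g p / (g p)\<^sup>2) p"
    by (rule dir_deriv_cong[OF N p reciprocal])
  also have "\<dots> = - Dx (Dx g) p / (g p)\<^sup>2 + 2 * (Dx g p)\<^sup>2 / (g p) ^ 3"
    using g(2)[OF p] diff differentiable_mult[OF diff(1) diff(1)]
    by (simp add: dir_deriv_divide dir_deriv_minus dir_deriv_mult field_simps
      power2_eq_square power3_eq_cube)
  finally have second: "Dx (Dx (\<lambda>p. 1 / g p)) p = \<dots>" .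
  show ?thesis
    using g(2)[OF p]
    by (simp add: parabolic_op_def reciprocal[OF p p] second field_simps
      power2_eq_square power3_eq_cube)
qed

context heat_point_transformation
begin

lemma partial_u_coefficient:
  assumes f: "smooth_on S f" and q: "q \<in> D"
  shows "\<partial>\<^sub>u (\<lambda>q. f (fst (snd q))) q = 0" "(\<lambda>q. f (fst (snd q))) differentiable (at q)"
proof -
  have x: "fst (snd q) \<in> S"
    using q by auto
  have "((\<lambda>q. f (fst (snd q))) has_derivative (\<lambda>v. fst (snd v) * deriv f (fst (snd q)))) (at q)"
    using smooth_on_imp_DERIV[OF S(2) f x]
    by (intro DERIV_compose_FDERIV[of f]) (auto intro!: derivative_eq_intros)
  then show "\<partial>\<^sub>u (\<lambda>q. f (fst (snd q))) q = 0" "(\<lambda>q. f (fst (snd q))) differentiable (at q)"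
    by (auto simp: dir_deriv_eqI differentiable_def)
qed

lemma U_u_determining_equation:
  assumes q: "q \<in> D"
  defines "g \<equiv> \<partial>\<^sub>u U"
  shows "g q * \<partial>\<^sub>t g q = a (fst (snd q)) * (g q * \<partial>\<^sub>x (\<partial>\<^sub>x g) q - 2 * (\<partial>\<^sub>x g q)\<^sup>2)
    + b (fst (snd q)) * g q * \<partial>\<^sub>x g q - c (fst (snd q)) * (g q)\<^sup>2"
proof -
  note D_intros = smooth_on_dir_deriv[OF open_D] smooth_TXU
  have commute: "\<partial>\<^sub>u (dir_deriv v U) q = dir_deriv v g q" if "q \<in> D" for q v
    unfolding g_def by (rule dir_deriv_commute[OF open_D that smooth_TXU(3)])
  have "\<partial>\<^sub>u (\<partial>\<^sub>x (\<partial>\<^sub>x U)) q = \<partial>\<^sub>x (\<partial>\<^sub>u (\<partial>\<^sub>x U)) q"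
    by (rule dir_deriv_commute[OF open_D q]) (intro D_intros)
  also have "\<dots> = \<partial>\<^sub>x (\<partial>\<^sub>x g) q"
    by (rule dir_deriv_cong[OF open_D q commute])
  finally have U_uxx: "\<partial>\<^sub>u (\<partial>\<^sub>x (\<partial>\<^sub>x U)) q = \<partial>\<^sub>x (\<partial>\<^sub>x g) q" .
  have g_u: "\<partial>\<^sub>u g q = 0" if "q \<in> D" for q
    unfolding g_def by (rule determining_equations(1)[OF that])
  have "\<partial>\<^sub>u (\<partial>\<^sub>x g) q = \<partial>\<^sub>x (\<partial>\<^sub>u g) q"
    unfolding g_def by (rule dir_deriv_commute[OF open_D q]) (intro D_intros)
  also have "\<dots> = 0"
    using dir_deriv_cong[OF open_D q g_u] by (simp add: dir_deriv_const)
  finally have g_xu: "\<partial>\<^sub>u (\<partial>\<^sub>x g) q = 0" .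
  have diff: "dir_deriv v U differentiable (at q)" "\<partial>\<^sub>x (\<partial>\<^sub>x U) differentiable (at q)"
    "g differentiable (at q)" "\<partial>\<^sub>x g differentiable (at q)" for v
    unfolding g_def by (intro smooth_on_D_differentiable[OF _ q] D_intros)+
  have height: "\<partial>\<^sub>u (\<lambda>q. snd (snd q)) q = 1" "(\<lambda>q. snd (snd q)) differentiable (at q)"
  proof -
    have L: "bounded_linear (\<lambda>q :: real \<times> real \<times> real. snd (snd q))"
      by (intro bounded_linear_compose[OF bounded_linear_snd] bounded_linear_snd)
    show "\<partial>\<^sub>u (\<lambda>q. snd (snd q)) q = 1" "(\<lambda>q. snd (snd q)) differentiable (at q)"
      using dir_deriv_bounded_linear[OF L] bounded_linear_imp_differentiable[OF L] by auto
  qed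
  have "\<partial>\<^sub>u (\<lambda>q. g q * (\<partial>\<^sub>t U q - a (fst (snd q)) * \<partial>\<^sub>x (\<partial>\<^sub>x U) q - b (fst (snd q)) * \<partial>\<^sub>x U q)
      + 2 * a (fst (snd q)) * \<partial>\<^sub>x g q * \<partial>\<^sub>x U q + c (fst (snd q)) * snd (snd q) * (g q)\<^sup>2) q
        = \<partial>\<^sub>u (\<lambda>_. 0) q"
    unfolding g_def by (rule dir_deriv_cong[OF open_D q]) (use determining_equations(3) in simp)
  then show ?thesis
    by (simp add: dir_deriv_simps diff partial_u_coefficient[OF _ q] smooth height commute[OF q]
      U_uxx g_u[OF q] g_xu
        power2_eq_square algebra_simps)
qed

definition at_u0 :: "(real \<times> real \<times> real \<Rightarrow> real) \<Rightarrow> real \<times> real \<Rightarrow> real" where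
  "at_u0 F p = F (fst p, snd p, 0)"

lemma dir_deriv_at_u0: "Dt (at_u0 F) = at_u0 (\<partial>\<^sub>t F)" "Dx (at_u0 F) = at_u0 (\<partial>\<^sub>x F)"
  by (simp_all add: at_u0_def dir_deriv_def fun_eq_iff)

lemma smooth_at_u0:
  assumes "smooth_on D F"
  shows "smooth_on (A \<times> S) (at_u0 F)"
proof -
  have "open (A \<times> S)"
    using open_A S by (intro open_Times)
  then show ?thesis
    unfolding at_u0_def[abs_def]
    by (intro smooth_on_compose[OF _ open_D assms])
      (auto simp: smooth_on_Pair_iff intro!: smooth_on_intros)
qed

sublocale heat_reduction a b c I B S "A \<times> S" "at_u0 T" "at_u0 X" "\<lambda>p. 1 / at_u0 (\<partial>\<^sub>u U) p"
proof
  show N: "open (A \<times> S)" "A \<times> S \<subseteq> UNIV \<times> S"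
    using open_A S by (auto intro: open_Times)
  show "smooth_on (A \<times> S) (at_u0 T)" "smooth_on (A \<times> S) (at_u0 X)"
    by (intro smooth_at_u0 smooth_TXU)+
  let ?g = "at_u0 (\<partial>\<^sub>u U)"
  have g_nonzero: "?g p \<noteq> 0" if "p \<in> A \<times> S" for p
    using U_u_nonzero that by (auto simp: at_u0_def)
  have smooth_g: "smooth_on (A \<times> S) ?g"
    by (intro smooth_at_u0 smooth_on_dir_deriv open_D smooth_TXU)
  show "smooth_on (A \<times> S) (\<lambda>p. 1 / ?g p)"
    by (intro smooth_on_divide smooth_on_const N smooth_g g_nonzero)
  fix p
  assume p: "p \<in> A \<times> S"
  define q where "q = (fst p, snd p, 0 :: real)"
  have q: "q \<in> D" "fst (snd q) = snd p"
    using p by (auto simp: q_def)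
  have at_q: "at_u0 F p = F q" for F
    by (simp add: at_u0_def q_def)
  show "1 / ?g p \<noteq> 0"
    using g_nonzero[OF p] by simp
  show "Dx (at_u0 X) p \<noteq> 0" "Dx (at_u0 T) p = 0" "Dt (at_u0 T) p = a (snd p) * (Dx (at_u0 X) p)\<^sup>2"
    using X_x_nonzero[OF q(1)] T_spatial_derivatives[OF q(1)] T_t[OF q(1)]
    by (simp_all add: dir_deriv_at_u0 at_q q(2))
  show "1 / ?g p * parabolic_op a b (\<lambda>_. 0) (at_u0 X) p
    = 2 * a (snd p) * Dx (\<lambda>p. 1 / ?g p) p * Dx (at_u0 X) p"
  proof -
    have "parabolic_op a b (\<lambda>_. 0) (at_u0 X) p = - 2 * a (snd p) * Dx ?g p * Dx (at_u0 X) p / ?g p"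
      using determining_equations(2)[OF q(1)] U_u_nonzero[OF q(1)]
      by (simp add: parabolic_op_def dir_deriv_at_u0 at_q q(2) field_simps)
    then show ?thesis
      by (simp add: dir_deriv_reciprocal[OF N(1) smooth_g p g_nonzero[OF p]] power2_eq_square)
  qed
  show "parabolic_op a b c (\<lambda>p. 1 / ?g p) p = 0"
    using parabolic_op_reciprocal[OF N(1) smooth_g g_nonzero p, of a b c]
      U_u_determining_equation[OF q(1)]
    by (simp add: dir_deriv_at_u0 at_q q(2))
qed

end

lemma left_inverse_imp_immersion:
  assumes "open D" "q \<in> D" and f: "(f has_derivative f') (at q)" and g: "g differentiable (at (f q))"
    and inverse: "\<And>p. p \<in> D \<Longrightarrow> g (f p) = p" and "f' v = 0"
  shows "v = 0"
proof -
  obtain g' where g': "(g has_derivative g') (at (f q))"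
    using g by (auto simp: differentiable_def)
  have "((\<lambda>p. p) has_derivative (\<lambda>v. g' (f' v))) (at q)"
    by (rule has_derivative_transform_within_open[OF has_derivative_compose[OF f g']
      assms(1,2) inverse])
  then have "(\<lambda>v. g' (f' v)) = (\<lambda>v. v)"
    using has_derivative_ident has_derivative_unique by blast
  then show ?thesis
    using assms(6) linear_0[OF has_derivative_linear[OF g']] by metis
qed

lemma point_transformation_immersion:
  fixes Phi :: "real \<times> real \<times> real \<Rightarrow> real \<times> real \<times> real"
  assumes Phi: "point_transformation D Phi" and q: "q \<in> D"
    and zero: "dir_deriv v (\<lambda>q. fst (Phi q)) q = 0" "dir_deriv v (\<lambda>q. fst (snd (Phi q))) q = 0"
      "dir_deriv v (\<lambda>q. snd (snd (Phi q))) q = 0"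
  shows "v = 0"
proof -
  have D: "open D" "smooth_on D Phi" "inj_on Phi D"
    and E: "open (Phi ` D)" "smooth_on (Phi ` D) (inv_into D Phi)"
    using Phi by (auto simp: point_transformation_def)
  obtain Phi' where Phi': "(Phi has_derivative Phi') (at q)"
    using smooth_on_imp_differentiable[OF D(1,2) q] by (auto simp: differentiable_def)
  show ?thesis
  proof (rule left_inverse_imp_immersion[OF D(1) q Phi'])
    show "inv_into D Phi differentiable (at (Phi q))"
      by (rule smooth_on_imp_differentiable[OF E imageI[OF q]])
    show "inv_into D Phi (Phi p) = p" if "p \<in> D" for p
      by (rule inv_into_f_f[OF D(3) that])
    show "Phi' v = 0"
      using zero dir_deriv_eqI[OF has_derivative_fst[OF Phi']]
        dir_deriv_eqI[OF has_derivative_fst[OF has_derivative_snd[OF Phi']]]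
        dir_deriv_eqI[OF has_derivative_snd[OF has_derivative_snd[OF Phi']]] by (simp add: prod_eq_iff)
  qed
qed

lemma implicit_heat_image_solution:
  assumes Phi: "inj_on Phi D" "open (Phi ` D)"
    and maps: "maps_solutions heatsol (lsol a b c S) (inv_into D Phi) (Phi ` D)"
    and w: "heatsol UNIV (\<lambda>s y. w (s, y))" and V: "open V" "smooth_on V u"
    and on_graph: "\<And>p. p \<in> V \<Longrightarrow> (fst p, snd p, u p) \<in> D \<and> snd (snd (Phi (fst p, snd p, u p)))
      = w (fst (Phi (fst p, snd p, u p)), fst (snd (Phi (fst p, snd p, u p))))"
  shows "lsol a b c S V (\<lambda>t x. u (t, x))"
proof -
  define Om where "Om = {k. (fst k, snd k, w k) \<in> Phi ` D}"
  have smooth_w: "smooth_on UNIV w"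
    using w by (simp add: heatsol_def lsol_iff_parabolic_op)
  have "continuous_on UNIV (\<lambda>k. (fst k, snd k, w k))"
    by (intro continuous_intros smooth_on_imp_continuous_on[OF smooth_w])
  from open_vimage[OF Phi(2) this] have "open Om"
    by (simp add: Om_def vimage_def)
  then have "heatsol Om (\<lambda>s y. w (s, y))"
    using w smooth_on_subset[OF open_UNIV _ _ smooth_w]
    by (auto simp: heatsol_def lsol_iff_parabolic_op)
  moreover have "graph (\<lambda>s y. w (s, y)) Om \<subseteq> Phi ` D"
    by (auto simp: graph_def Om_def)
  moreover have "graph (\<lambda>t x. u (t, x)) V \<subseteq> inv_into D Phi ` graph (\<lambda>s y. w (s, y)) Om"
  proof
    fix q
    assume "q \<in> graph (\<lambda>t x. u (t, x)) V"
    then obtain p where p: "p \<in> V" "q = (fst p, snd p, u p)"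
      by (auto simp: graph_def)
    then have q: "q \<in> D" and "snd (snd (Phi q)) = w (fst (Phi q), fst (snd (Phi q)))"
      using on_graph[OF p(1)] by simp_all
    then have "Phi q \<in> graph (\<lambda>s y. w (s, y)) Om"
      using q by (auto simp: graph_def Om_def prod_eq_iff intro!: rev_image_eqI[OF q])
    then show "q \<in> inv_into D Phi ` graph (\<lambda>s y. w (s, y)) Om"
      using inv_into_f_f[OF Phi(1) q] by force
  qed
  ultimately show ?thesis
    using maps V unfolding maps_solutions_def by auto
qed

theorem (in parabolic) maps_to_heat_imp_K_quadratic:
  assumes A: "open A" "A \<noteq> {}" and maps: "maps_to_heat a b c S A Phi"
  shows "\<exists>c0 c1 c2. \<forall>x\<in>S. K x = c2 * (I x)\<^sup>2 + c1 * I x + c0"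
proof -
  let ?D = "A \<times> S \<times> (UNIV :: real set)"
  have Phi: "point_transformation ?D Phi"
    and solutions: "maps_solutions heatsol (lsol a b c S) (inv_into ?D Phi) (Phi ` ?D)"
    using maps by (auto simp: maps_to_heat_def Let_def)
  then have smooth_Phi: "smooth_on ?D Phi" and bij_Phi: "inj_on Phi ?D" "open (Phi ` ?D)"
    by (auto simp: point_transformation_def)
  interpret heat_point_transformation a b c I B S A "\<lambda>q. fst (Phi q)" "\<lambda>q. fst (snd (Phi q))"
    "\<lambda>q. snd (snd (Phi q))"
  proof
    show "open A" by (rule A(1))
    show "smooth_on ?D (\<lambda>q. fst (Phi q))" "smooth_on ?D (\<lambda>q. fst (snd (Phi q)))"
      "smooth_on ?D (\<lambda>q. snd (snd (Phi q)))"
      by (intro smooth_on_fst smooth_on_snd smooth_Phi)+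
    show "v = 0" if "q \<in> ?D" "dir_deriv v (\<lambda>q. fst (Phi q)) q = 0"
      "dir_deriv v (\<lambda>q. fst (snd (Phi q))) q = 0"
        "dir_deriv v (\<lambda>q. snd (snd (Phi q))) q = 0" for q v
      by (rule point_transformation_immersion[OF Phi that])
    show "parabolic_op a b c u p = 0"
      if "heatsol UNIV (\<lambda>s y. w (s, y))" "open V" "smooth_on V u"
        "\<And>p. p \<in> V \<Longrightarrow> (fst p, snd p, u p) \<in> ?D \<and> snd (snd (Phi (fst p, snd p, u p)))
          = w (fst (Phi (fst p, snd p, u p)), fst (snd (Phi (fst p, snd p, u p))))" "p \<in> V" for w V u p
      using implicit_heat_image_solution[OF bij_Phi solutions that(1-4)] that(5)
      by (simp add: lsol_iff_parabolic_op)
  qed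
  obtain t where "t \<in> A"
    using A(2) by blast
  then show ?thesis
    by (intro K_quadratic[of t]) auto
qed

section \<open>Solutions of the auxiliary ordinary differential equations\<close>

lemma deriv_transform_within_open:
  fixes f f' g :: "real \<Rightarrow> real"
  assumes "open A" "\<And>t. t \<in> A \<Longrightarrow> (f has_real_derivative f' t) (at t)" "\<And>t. t \<in> A \<Longrightarrow> g t = f t" "t \<in> A"
  shows "g differentiable (at t)" "deriv g t = f' t"
proof -
  have "(g has_real_derivative f' t) (at t)"
    using has_field_derivative_transform_within_open[OF assms(2)[OF assms(4)] assms(1,4),
      of g] assms(3) by simp
  then show "g differentiable (at t)" "deriv g t = f' t"
    by (auto simp: real_differentiable_def DERIV_imp_deriv)
qed

lemma has_schwarzian_on_of_linear_ode:
  assumes A: "open A" and \<phi>_pos: "\<And>t. t \<in> A \<Longrightarrow> \<phi> t > 0"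
    and T: "\<And>t. t \<in> A \<Longrightarrow> (T has_real_derivative 1 / (\<phi> t)\<^sup>2) (at t)"
    and \<phi>: "\<And>t. t \<in> A \<Longrightarrow> (\<phi> has_real_derivative \<psi> t) (at t)"
    and \<psi>: "\<And>t. t \<in> A \<Longrightarrow> (\<psi> has_real_derivative - k * \<phi> t) (at t)"
  shows "has_schwarzian_on T (2 * k) A"
  unfolding has_schwarzian_on_def
proof
  have \<phi>2: "((\<lambda>t. 1 / (\<phi> t)\<^sup>2) has_real_derivative - 2 * \<psi> t / (\<phi> t) ^ 3) (at t)" if "t \<in> A" for t
    using \<phi>_pos[OF that] by (auto intro!: derivative_eq_intros \<phi> that
      simp: field_simps power2_eq_square power3_eq_cube)
  have \<phi>3: "((\<lambda>t. - 2 * \<psi> t / (\<phi> t) ^ 3) has_real_derivative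
      2 * k / (\<phi> t)\<^sup>2 + 6 * (\<psi> t)\<^sup>2 / (\<phi> t) ^ 4) (at t)"
    if "t \<in> A" for t
    using \<phi>_pos[OF that]
    by (auto intro!: derivative_eq_intros \<phi> \<psi> that
      simp: field_simps power2_eq_square power3_eq_cube power4_eq_xxxx)
  have first: "T differentiable (at t)" "deriv T t = 1 / (\<phi> t)\<^sup>2" if "t \<in> A" for t
    using deriv_transform_within_open[OF A T _ that, of T] by simp_all
  have second: "deriv T differentiable (at t)" "deriv (deriv T) t = - 2 * \<psi> t / (\<phi> t) ^ 3"
    if "t \<in> A" for t
    using deriv_transform_within_open[OF A \<phi>2 first(2) that] by simp_all
  have third: "deriv (deriv T) differentiable (at t)"
    "deriv (deriv (deriv T)) t = 2 * k / (\<phi> t)\<^sup>2 + 6 * (\<psi> t)\<^sup>2 / (\<phi> t) ^ 4" if "t \<in> A" for t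
    using deriv_transform_within_open[OF A \<phi>3 second(2) that] by simp_all
  fix t
  assume t: "t \<in> A"
  have "schwarzian T t = 2 * k"
    using \<phi>_pos[OF t] unfolding schwarzian_def first(2)[OF t] second(2)[OF t] third(2)[OF t]
    by (simp add: field_simps power2_eq_square power3_eq_cube power4_eq_xxxx)
  then show "T differentiable (at t) \<and> deriv T differentiable (at t)
    \<and> deriv (deriv T) differentiable (at t) \<and>
      deriv T t > 0 \<and> schwarzian T t = 2 * k"
    using first[OF t] second(1)[OF t] third(1)[OF t] \<phi>_pos[OF t] by simp
qed

lemma has_schwarzian_on_tan:
  assumes "l > 0"
  shows "has_schwarzian_on (\<lambda>t. tan (l * t) / l) (2 * l\<^sup>2) {- (1 / l) <..< 1 / l}"
proof (rule has_schwarzian_on_of_linear_ode[of _ "\<lambda>t. cos (l * t)" _ "\<lambda>t. - l * sin (l * t)"])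
  show cos_pos: "cos (l * t) > 0" if "t \<in> {- (1 / l) <..< 1 / l}" for t
  proof (rule cos_gt_zero_pi)
    have "\<bar>l * t\<bar> < 1"
      using that assms by (auto simp: abs_less_iff field_simps)
    then show "- (pi / 2) < l * t" "l * t < pi / 2"
      using pi_gt3 by linarith+
  qed
  show "((\<lambda>t. tan (l * t) / l) has_real_derivative 1 / (cos (l * t))\<^sup>2) (at t)"
    if "t \<in> {- (1 / l) <..< 1 / l}" for t
    using cos_pos[OF that] assms by (auto intro!: derivative_eq_intros simp: field_simps)
qed (auto intro!: derivative_eq_intros simp: power2_eq_square)

lemma has_schwarzian_on_exp:
  assumes "l \<noteq> 0"
  shows "has_schwarzian_on (\<lambda>t. exp (2 * l * t) / (2 * l)) (- 2 * l\<^sup>2) UNIV"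
proof -
  have "1 / (exp (- l * t))\<^sup>2 = exp (2 * l * t)" for t
    using exp_double[of "l * t"] by (simp add: exp_minus inverse_eq_divide power_one_over mult.assoc)
  then have "((\<lambda>t. exp (2 * l * t) / (2 * l)) has_real_derivative 1 / (exp (- l * t))\<^sup>2) (at t)" for t
    using assms by (auto intro!: derivative_eq_intros)
  then have "has_schwarzian_on (\<lambda>t. exp (2 * l * t) / (2 * l)) (2 * - l\<^sup>2) UNIV"
    by (rule has_schwarzian_on_of_linear_ode[of _ "\<lambda>t. exp (- l * t)" _
      "\<lambda>t. - l * exp (- l * t)", rotated 2])
       (auto intro!: derivative_eq_intros simp: power2_eq_square)
  then show ?thesis by simp
qed

lemma exists_has_schwarzian_on:
  obtains A T where "is_interval A" "open A" "A \<noteq> {}" "has_schwarzian_on T k A"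
proof -
  consider (zero) "k = 0" | (pos) "k > 0" | (neg) "k < 0"
    by linarith
  then show thesis
  proof cases
    case zero
    have "has_schwarzian_on (\<lambda>t. t) (2 * 0) UNIV"
      by (rule has_schwarzian_on_of_linear_ode[of _ "\<lambda>_. 1" _ "\<lambda>_. 0"]) auto
    then show thesis
      using zero that[of UNIV] by simp
  next
    case pos
    define l where "l = sqrt (k / 2)"
    have l: "l > 0" "k = 2 * l\<^sup>2"
      using pos by (simp_all add: l_def)
    then show thesis
      using has_schwarzian_on_tan[OF l(1)] by (intro that[of "{- (1 / l) <..< 1 / l}"]) simp_all
  next
    case neg
    define l where "l = sqrt (- k / 2)"
    have l: "l \<noteq> 0" "k = - 2 * l\<^sup>2"
      using neg by (simp_all add: l_def)
    then show thesis
      using has_schwarzian_on_exp[OF l(1)] by (intro that[of UNIV]) simp_all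
  qed
qed

lemma forced_oscillation_onI:
  assumes A: "open A" and \<omega>: "\<And>t. t \<in> A \<Longrightarrow> (\<omega> has_real_derivative \<omega>' t) (at t)"
    and \<omega>': "\<And>t. t \<in> A \<Longrightarrow> (\<omega>' has_real_derivative f - k * \<omega> t) (at t)"
  shows "forced_oscillation_on \<omega> k f A"
proof -
  have first: "\<omega> differentiable (at t)" "deriv \<omega> t = \<omega>' t" if "t \<in> A" for t
    using deriv_transform_within_open[OF A \<omega> _ that, of \<omega>] by simp_all
  have "deriv \<omega> differentiable (at t)" "deriv (deriv \<omega>) t = f - k * \<omega> t" if "t \<in> A" for t
    using deriv_transform_within_open[OF A \<omega>' first(2) that] by simp_all
  with first show ?thesis
    by (simp add: forced_oscillation_on_def)
qed

lemma exists_forced_oscillation_on: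
  obtains \<omega> W where "forced_oscillation_on \<omega> (4 * c2) (2 * c1) UNIV"
    "\<forall>t. (W has_real_derivative (c2 * (\<omega> t)\<^sup>2 - 1/4 * (deriv \<omega> t)\<^sup>2 - c0)) (at t)"
proof (cases "c2 = 0")
  case True
  have \<omega>': "((\<lambda>t. c1 * t\<^sup>2) has_real_derivative 2 * c1 * t) (at t)" for t
    by (auto intro!: derivative_eq_intros)
  have "forced_oscillation_on (\<lambda>t. c1 * t\<^sup>2) (4 * c2) (2 * c1) UNIV"
    by (rule forced_oscillation_onI[OF open_UNIV \<omega>']) (use True in \<open>auto intro!: derivative_eq_intros\<close>)
  moreover have "\<forall>t. ((\<lambda>t. - (c1\<^sup>2 * t ^ 3 / 3) - c0 * t) has_real_derivative
      c2 * (c1 * t\<^sup>2)\<^sup>2 - 1/4 * (deriv (\<lambda>t. c1 * t\<^sup>2) t)\<^sup>2 - c0) (at t)"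
    unfolding DERIV_imp_deriv[OF \<omega>'] using True
    by (auto intro!: derivative_eq_intros simp: power2_eq_square)
  ultimately show thesis
    by (rule that)
next
  case False
  define \<omega>0 where "\<omega>0 = c1 / (2 * c2)"
  have \<omega>: "forced_oscillation_on (\<lambda>t. \<omega>0) (4 * c2) (2 * c1) UNIV"
    using False by (intro forced_oscillation_onI[where \<omega>' = "\<lambda>t. 0"]) (auto simp: \<omega>0_def)
  have "\<forall>t. ((\<lambda>t. (c2 * \<omega>0\<^sup>2 - c0) * t) has_real_derivative
      c2 * \<omega>0\<^sup>2 - 1/4 * (deriv (\<lambda>t. \<omega>0) t)\<^sup>2 - c0) (at t)"
    by (auto intro!: derivative_eq_intros)
  with \<omega> show thesis
    by (rule that)
qed

theorem (in parabolic) K_quadratic_imp_maps_to_heat: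
  assumes "\<forall>x\<in>S. K x = c2 * (I x)\<^sup>2 + c1 * I x + c0"
  shows "\<exists>A Phi. is_interval A \<and> open A \<and> A \<noteq> {} \<and> maps_to_heat a b c S A Phi"
proof -
  obtain A T where A: "is_interval A" "open A" "A \<noteq> {}" and T: "has_schwarzian_on T (8 * c2) A"
    by (rule exists_has_schwarzian_on)
  obtain \<omega> W where "forced_oscillation_on \<omega> (4 * c2) (2 * c1) UNIV"
    "\<forall>t. (W has_real_derivative (c2 * (\<omega> t)\<^sup>2 - 1/4 * (deriv \<omega> t)\<^sup>2 - c0)) (at t)"
    by (rule exists_forced_oscillation_on)
  with A T assms interpret heat_transformation a b c I B S c0 c1 c2 A T \<omega> W 1
    by unfold_locales (auto simp: forced_oscillation_on_def)
  show ?thesis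
    using maps_to_heat_\<Phi> A by blast
qed

theorem theorem2:
  fixes a b c I B :: "real \<Rightarrow> real" and S :: "real set"
  assumes S: "is_interval S" "open S" "S \<noteq> {}"
    and smooth: "smooth_on S a" "smooth_on S b" "smooth_on S c"
    and apos: "\<forall>x\<in>S. a x > 0"
    and I: "\<forall>x\<in>S. (I has_real_derivative 1 / sqrt (a x)) (at x)"
    and B: "\<forall>x\<in>S. (B has_real_derivative b x / (2 * a x)) (at x)"
  shows "((\<exists>Tint Phi. is_interval Tint \<and> open Tint \<and> Tint \<noteq> {} \<and>
             maps_to_heat a b c S Tint Phi)
          \<longleftrightarrow> (\<exists>c0 c1 c2. \<forall>x\<in>S. Kf a b c x = c2 * (I x)^2 + c1 * I x + c0))
      \<and> (\<forall>c0 c1 c2. (\<forall>x\<in>S. Kf a b c x = c2 * (I x)^2 + c1 * I x + c0) \<longrightarrow>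
          (\<forall>Tint T \<omega> W C.
             is_interval Tint \<and> open Tint \<and> Tint \<noteq> {} \<and>
             (\<forall>t\<in>Tint. T differentiable (at t) \<and> deriv T differentiable (at t) \<and>
                        deriv (deriv T) differentiable (at t) \<and>
                        deriv T t > 0 \<and> schwarzian T t = 8 * c2) \<and>
             (\<forall>t\<in>Tint. \<omega> differentiable (at t) \<and> deriv \<omega> differentiable (at t) \<and>
                        deriv (deriv \<omega>) t + 4 * c2 * \<omega> t = 2 * c1) \<and>
             (\<forall>t\<in>Tint. (W has_real_derivative
                           (c2 * (\<omega> t)^2 - 1/4 * (deriv \<omega> t)^2 - c0)) (at t)) \<and>
             C \<noteq> 0
             \<longrightarrow> maps_to_heat a b c S Tint
                   (\<lambda>(t, x, u). (T t, sqrt (deriv T t) * (I x + \<omega> t),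
                      u / (C * (deriv T t * a x) powr (1/4) *
                           exp (- B x
                                + deriv (deriv T) t / (8 * deriv T t) * (I x + \<omega> t)^2
                                + deriv \<omega> t * I x / 2
                                - W t))))))"
    (is "(?reducible \<longleftrightarrow> (\<exists>c0 c1 c2. ?quadratic c0 c1 c2))
      \<and> (\<forall>c0 c1 c2. ?quadratic c0 c1 c2 \<longrightarrow> ?explicit c0 c1 c2)")
proof -
  interpret parabolic a b c I B S
    using S smooth apos I B by unfold_locales auto
  have explicit: "?explicit c0 c1 c2" if K: "?quadratic c0 c1 c2" for c0 c1 c2
  proof (intro allI impI, elim conjE, goal_cases transformation)
    case (transformation A T \<omega> W C)
    then interpret heat_transformation a b c I B S c0 c1 c2 A T \<omega> W C
      using K by unfold_locales (auto simp: has_schwarzian_on_def forced_oscillation_on_def)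
    show ?case
      using maps_to_heat_\<Phi> unfolding \<Phi>_eq .
  qed
  have reducible: "?reducible" if "?quadratic c0 c1 c2" for c0 c1 c2
    using K_quadratic_imp_maps_to_heat that by blast
  have "?reducible \<longleftrightarrow> (\<exists>c0 c1 c2. ?quadratic c0 c1 c2)"
    using reducible maps_to_heat_imp_K_quadratic by meson
  then show ?thesis
    by (rule conjI, intro allI) (rule impI, rule explicit)
qed

end
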